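(* Let $n\ge1$ and $k\ge1$ be integers, and let $f$ be a symmetric function homogeneous of degree $k$. Then \[ \Delta_f \,\omega(p_n)\Big|_{t=1/q}=\frac{[n]_q\, f[[n]_q]}{[k]_q\,q^{k(n-1)}}\,e_n[X[k]_q]. \]
   Context: Symmetric functions over $\mathbb{Q}(q,t)$; $e_n,p_n,s_\lambda$ elementary, power sum and Schur functions; $\omega$ is the involution with $\omega(e_k)=h_k$ (so $\omega(p_n)=(-1)^{n-1}p_n$). Plethysm $f[A]$: write $f$ in power sums and replace $p_k$ by $A$ with all variables (including $q,t$) raised to the $k$-th power; $X=x_1+x_2+\cdots$; $[m]_q=1+q+\dots+q^{m-1}$, so $f[[n]_q]$ and $e_n[X[k]_q]$ are plethystic evaluations. $B_\mu=\sum_{c\in\mu}q^{a'(c)}t^{l'(c)}$ ($a'(c),l'(c)$ = numbers of cells strictly left of, below $c$). $\widetilde H_\mu$ is the modified Macdonald polynomial (for $\mu\vdash n$ the unique degree-$n$ symmetric function with $\widetilde H_\mu[X(1-q)]\in\mathrm{span}\{s_\lambda:\lambda\ge\mu\}$, $\widetilde H_\mu[X(1-t)]\in\mathrm{span}\{s_\lambda:\lambda\ge\mu'\}$, $\langle\widetilde H_\mu,s_{(n)}\rangle=1$). $\Delta_f$ is the linear operator with $\Delta_f\widetilde H_\mu=f[B_\mu]\widetilde H_\mu$. $|_{t=1/q}$ denotes specialization $t=1/q$ of the coefficients.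
   Formalization: The coefficients of f are assumed to have no pole at t=1/q, and f on the right-hand side is also specialized at t=1/q; otherwise the left side can be undefined (f=p_1/(1-qt)) or the identity false (f=t p_1). Nothing changes when f has coefficients in Q or Q(q). *)

theory Defs
  imports
    "HOL-Library.Multiset"
    "HOL-Computational_Algebra.Fraction_Field"
    "HOL-Computational_Algebra.Polynomial"
    "Jordan_Normal_Form.Determinant"
begin

text \<open>The field $Q(q,t)$ is the fraction field of $Q[q][t]$: the variable of the inner
  polynomials is $q$, that of the outer ones is $t$.\<close>

type_synonym qt = "rat poly poly fract"

definition q_var :: qt where "q_var = Fract [:[:0, 1:]:] 1"
definition t_var :: qt where "t_var = Fract [:0, 1:] 1"

definition qt_eval :: "qt \<Rightarrow> qt \<Rightarrow> rat poly poly \<Rightarrow> qt" where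
  "qt_eval x y P = poly (map_poly (\<lambda>a. poly (map_poly of_rat a) x) P) y"

text \<open>Substitution \<open>q \<mapsto> x\<close>, \<open>t \<mapsto> y\<close> in a rational function. It is meaningful when
  the function can be written with a denominator that does not vanish at \<open>(x, y)\<close>; the value
  does not depend on the choice of such a fraction.\<close>

definition qt_regular :: "qt \<Rightarrow> qt \<Rightarrow> qt \<Rightarrow> bool" where
  "qt_regular x y c \<longleftrightarrow> (\<exists>P Q. Q \<noteq> 0 \<and> c = Fract P Q \<and> qt_eval x y Q \<noteq> 0)"

definition qt_subst :: "qt \<Rightarrow> qt \<Rightarrow> qt \<Rightarrow> qt" where
  "qt_subst x y c = (THE r. \<exists>P Q. Q \<noteq> 0 \<and> c = Fract P Q \<and> qt_eval x y Q \<noteq> 0 \<and>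
     r = qt_eval x y P / qt_eval x y Q)"

lemma qt_eval_0 [simp]: "qt_eval x y 0 = 0"
  by (simp add: qt_eval_def)

lemma qt_eval_1 [simp]: "qt_eval x y 1 = 1"
  by (simp add: qt_eval_def map_poly_1')

lemma qt_subst_0 [simp]: "qt_subst x y 0 = 0"
  unfolding qt_subst_def
proof (rule the_equality)
  show "\<exists>P Q. Q \<noteq> 0 \<and> 0 = Fract P Q \<and> qt_eval x y Q \<noteq> 0 \<and>
     0 = qt_eval x y P / qt_eval x y Q"
    by (rule exI[of _ 0], rule exI[of _ 1]) (simp flip: Zero_fract_def)
next
  fix r assume "\<exists>P Q. Q \<noteq> 0 \<and> 0 = Fract P Q \<and> qt_eval x y Q \<noteq> 0 \<and>
     r = qt_eval x y P / qt_eval x y Q"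
  then obtain P Q where PQ: "Q \<noteq> 0" "0 = Fract P Q" "r = qt_eval x y P / qt_eval x y Q"
    by blast
  then have "P = 0" by (simp add: Zero_fract_def eq_fract)
  with PQ show "r = 0" by simp
qed

text \<open>A monomial in the variables $x_0, x_1, x_2, \ldots$ is a multiset of indices. A symmetric
  function is a formal power series of bounded degree (a coefficient function on monomials) that
  is invariant under permutations of the variables.\<close>

typedef (overloaded) 'a symf =
  "{f :: nat multiset \<Rightarrow> 'a :: comm_ring_1.
     (\<forall>\<pi> m. bij \<pi> \<longrightarrow> f (image_mset \<pi> m) = f m) \<and> (\<exists>d. \<forall>m. size m > d \<longrightarrow> f m = 0)}"
  morphisms coeff_symf Abs_symf
  by (rule exI[of _ "\<lambda>_. 0"]) auto

setup_lifting type_definition_symf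

lemma symf_eqI: "(\<And>m. coeff_symf f m = coeff_symf g m) \<Longrightarrow> f = g"
  by (metis coeff_symf_inject ext)

definition splittings :: "'b multiset \<Rightarrow> ('b multiset \<times> 'b multiset) set" where
  "splittings m = {(a, b). a + b = m}"


lemma finite_splittings [simp]: "finite (splittings m)"
proof (induction m)
  case empty
  have "splittings {#} = {({#} :: 'a multiset, {#})}" by (auto simp: splittings_def)
  then show ?case by simp
next
  case (add x m)
  have "splittings (add_mset x m) \<subseteq>
      (\<lambda>(a, b). (add_mset x a, b)) ` splittings m \<union> (\<lambda>(a, b). (a, add_mset x b)) ` splittings m"
  proof
    fix p assume "p \<in> splittings (add_mset x m)"
    then obtain a b where p: "p = (a, b)" and ab: "a + b = add_mset x m"
      by (auto simp: splittings_def)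
    have "x \<in># a \<or> x \<in># b" using ab by (metis union_iff union_single_eq_member)
    then show "p \<in> (\<lambda>(a, b). (add_mset x a, b)) ` splittings m \<union>
        (\<lambda>(a, b). (a, add_mset x b)) ` splittings m"
    proof
      assume "x \<in># a"
      then obtain a' where "a = add_mset x a'" by (metis mset_add)
      then show ?thesis using p ab by (force simp: splittings_def)
    next
      assume "x \<in># b"
      then obtain b' where "b = add_mset x b'" by (metis mset_add)
      then show ?thesis using p ab by (force simp: splittings_def)
    qed
  qed
  then show ?case using add by (meson finite_UnI finite_imageI finite_subset)
qed

lemma image_mset_inv:
  assumes "bij \<pi>"
  shows "image_mset (inv_into UNIV \<pi>) (image_mset \<pi> m) = m"
    and "image_mset \<pi> (image_mset (inv_into UNIV \<pi>) m') = m'"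
proof -
  show "image_mset (inv_into UNIV \<pi>) (image_mset \<pi> m) = m"
    using assms by (induction m) (simp_all add: bij_is_inj)
  show "image_mset \<pi> (image_mset (inv_into UNIV \<pi>) m') = m'"
    using assms by (induction m') (simp_all add: bij_is_surj surj_f_inv_f)
qed

lemma sum_splittings_image_mset:
  assumes "bij \<pi>"
  shows "(\<Sum>(a, b)\<in>splittings (image_mset \<pi> m). F a b) =
    (\<Sum>(a, b)\<in>splittings m. F (image_mset \<pi> a) (image_mset \<pi> b))"
proof -
  have *: "image_mset (inv_into UNIV \<pi>) (image_mset \<pi> m) = m"
    for m by (rule image_mset_inv(1)[OF assms])
  have **: "image_mset \<pi> (image_mset (inv_into UNIV \<pi>) m) = m" for m
    by (rule image_mset_inv(2)[OF assms])
  show ?thesis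
    by (rule sum.reindex_bij_witness[where
          i = "\<lambda>(a, b). (image_mset \<pi> a, image_mset \<pi> b)" and
          j = "\<lambda>(a, b). (image_mset (inv_into UNIV \<pi>) a, image_mset (inv_into UNIV \<pi>) b)"])
       (auto simp: splittings_def * ** simp flip: image_mset_union)
qed

lemma sum_splittings_commute:
  "(\<Sum>(a, b)\<in>splittings m. F a b) = (\<Sum>(a, b)\<in>splittings m. F b a)"
  by (rule sum.reindex_bij_witness[where i = prod.swap and j = prod.swap])
     (auto simp: splittings_def add.commute)

lemma sum_splittings_assoc:
  "(\<Sum>(p, c)\<in>splittings m. \<Sum>(a, b)\<in>splittings p. F a b c) =
   (\<Sum>(a, p)\<in>splittings m. \<Sum>(b, c)\<in>splittings p. F a b c)"
proof -
  have "(\<Sum>(p, c)\<in>splittings m. \<Sum>(a, b)\<in>splittings p. F a b c) =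
    (\<Sum>((p, c), (a, b))\<in>(SIGMA x:splittings m. splittings (fst x)). F a b c)"
    by (subst sum.Sigma[symmetric]) (auto simp: case_prod_unfold)
  also have "\<dots> = (\<Sum>((a, p), (b, c))\<in>(SIGMA x:splittings m. splittings (snd x)). F a b c)"
    by (rule sum.reindex_bij_witness[where
          i = "\<lambda>((a, p), (b, c)). ((a + b, c), (a, b))" and
          j = "\<lambda>((p, c), (a, b)). ((a, b + c), (b, c))"])
       (auto simp: splittings_def add.assoc)
  also have "\<dots> = (\<Sum>(a, p)\<in>splittings m. \<Sum>(b, c)\<in>splittings p. F a b c)"
    by (subst sum.Sigma[symmetric]) (auto simp: case_prod_unfold)
  finally show ?thesis .
qed

lemma sum_splittings_one:
  fixes F :: "'b multiset \<Rightarrow> 'a :: comm_ring_1"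
  shows "(\<Sum>(a, b)\<in>splittings m. (if a = {#} then c else 0) * F b) = c * F m"
proof -
  have "(\<Sum>(a, b)\<in>splittings m. (if a = {#} then c else 0) * F b) =
    (\<Sum>(a, b)\<in>{({#} :: 'b multiset, m)}. (if a = {#} then c else 0) * F b)"
    by (rule sum.mono_neutral_right, rule finite_splittings)
       (auto simp: splittings_def split: if_splits)
  then show ?thesis by simp
qed

lift_definition const_symf :: "'a :: comm_ring_1 \<Rightarrow> 'a symf" is
  "\<lambda>c m. if m = {#} then c else 0"
  by (auto intro!: exI[of _ 0])

instantiation symf :: (comm_ring_1) comm_ring_1
begin

lift_definition zero_symf :: "'a symf" is "\<lambda>_. 0" by auto

definition one_symf :: "'a symf" where "one_symf = const_symf 1"

lift_definition plus_symf :: "'a symf \<Rightarrow> 'a symf \<Rightarrow> 'a symf" is "\<lambda>f g m. f m + g m"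
proof (intro CollectI conjI; elim CollectE conjE exE)
  fix f g :: "nat multiset \<Rightarrow> 'a" and d d'
  assume "\<forall>m. d < size m \<longrightarrow> f m = 0" "\<forall>m. d' < size m \<longrightarrow> g m = 0"
  then show "\<exists>d. \<forall>m. d < size m \<longrightarrow> f m + g m = 0"
    by (intro exI[of _ "max d d'"]) auto
qed auto

lift_definition uminus_symf :: "'a symf \<Rightarrow> 'a symf" is "\<lambda>f m. - f m" by auto

definition minus_symf :: "'a symf \<Rightarrow> 'a symf \<Rightarrow> 'a symf" where "minus_symf f g = f + - g"

lift_definition times_symf :: "'a symf \<Rightarrow> 'a symf \<Rightarrow> 'a symf" is
  "\<lambda>f g m. \<Sum>(a, b)\<in>splittings m. f a * g b"
proof (intro CollectI conjI; elim CollectE conjE exE)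
  fix f g :: "nat multiset \<Rightarrow> 'a"
  assume "\<forall>\<pi> m. bij \<pi> \<longrightarrow> f (image_mset \<pi> m) = f m"
    "\<forall>\<pi> m. bij \<pi> \<longrightarrow> g (image_mset \<pi> m) = g m"
  then show "\<forall>\<pi> m. bij \<pi> \<longrightarrow>
      (\<Sum>(a, b)\<in>splittings (image_mset \<pi> m). f a * g b) = (\<Sum>(a, b)\<in>splittings m. f a * g b)"
    by (auto simp: sum_splittings_image_mset)
next
  fix f g :: "nat multiset \<Rightarrow> 'a" and d d'
  assume f: "\<forall>m. d < size m \<longrightarrow> f m = 0" and g: "\<forall>m. d' < size m \<longrightarrow> g m = 0"
  have "(\<Sum>(a, b)\<in>splittings m. f a * g b) = 0" if "d + d' < size m" for m
  proof (rule sum.neutral, clarify)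
    fix a b assume "(a, b) \<in> splittings m"
    then have "d < size a \<or> d' < size b" using that by (auto simp: splittings_def)
    then show "f a * g b = 0" using f g by auto
  qed
  then show "\<exists>d. \<forall>m. d < size m \<longrightarrow> (\<Sum>(a, b)\<in>splittings m. f a * g b) = 0" by blast
qed

instance
proof
  fix a b c :: "'a symf"
  show "a * b * c = a * (b * c)"
    by (transfer, rule ext)
       (simp add: sum_distrib_left sum_distrib_right case_prod_unfold mult.assoc
         sum_splittings_assoc[unfolded case_prod_unfold, where F = "\<lambda>x y z. _ x * (_ y * _ z)"])
  show "a * b = b * a"
    by (transfer, rule ext, subst sum_splittings_commute) (simp add: mult.commute)
  show "1 * a = a"
    unfolding one_symf_def by (transfer, rule ext, subst sum_splittings_one) simp
  show "(a + b) * c = a * c + b * c"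
    by (transfer, rule ext) (simp add: distrib_right sum.distrib case_prod_unfold)
  show "a + b + c = a + (b + c)" by (transfer, rule ext) (rule add.assoc)
  show "a + b = b + a" by (transfer, rule ext) (rule add.commute)
  show "0 + a = a" by (transfer, rule ext) simp
  show "- a + a = 0" by (transfer, rule ext) simp
  show "a - b = a + - b" by (rule minus_symf_def)
  show "(0 :: 'a symf) \<noteq> 1"
    unfolding one_symf_def
  proof transfer
    show "(\<lambda>_ :: nat multiset. 0 :: 'a) \<noteq> (\<lambda>m. if m = {#} then 1 else 0)"
      by (auto simp: fun_eq_iff)
  qed
qed

end

lemma coeff_const_times: "coeff_symf (const_symf c * f) m = c * coeff_symf f m"
  by transfer (rule sum_splittings_one)

lemma const_symf_add: "const_symf (a + b) = const_symf a + const_symf b"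
  by transfer auto

lemma const_symf_mult: "const_symf (a * b) = const_symf a * const_symf b"
  by (rule symf_eqI) (simp add: coeff_const_times, transfer, simp)

definition scale_symf :: "'a :: comm_ring_1 \<Rightarrow> 'a symf \<Rightarrow> 'a symf" where
  "scale_symf c f = const_symf c * f"

global_interpretation symf: vector_space "scale_symf :: 'a :: field \<Rightarrow> 'a symf \<Rightarrow> 'a symf"
  by unfold_locales
     (simp_all add: scale_symf_def const_symf_add const_symf_mult algebra_simps
       flip: one_symf_def)

definition homogeneous_symf :: "nat \<Rightarrow> 'a :: comm_ring_1 symf \<Rightarrow> bool" where
  "homogeneous_symf d f \<longleftrightarrow> (\<forall>m. coeff_symf f m \<noteq> 0 \<longrightarrow> size m = d)"

lift_definition elem_sym :: "nat \<Rightarrow> 'a :: comm_ring_1 symf" is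
  "\<lambda>n m. if size m = n \<and> (\<forall>i. count m i \<le> 1) then 1 else 0"
proof (intro CollectI conjI allI impI)
  fix n m and \<pi> :: "nat \<Rightarrow> nat" assume \<pi>: "bij \<pi>"
  have "count (image_mset \<pi> m) (\<pi> i) = count m i" for i
    using \<pi> by (induction m) (auto simp: bij_is_inj inj_eq)
  then have "(\<forall>i. count (image_mset \<pi> m) i \<le> 1) \<longleftrightarrow> (\<forall>i. count m i \<le> 1)"
    using \<pi> by (metis bij_pointE)
  then show "(if size (image_mset \<pi> m) = n \<and> (\<forall>i. count (image_mset \<pi> m) i \<le> 1)
      then 1 else 0 :: 'a) = (if size m = n \<and> (\<forall>i. count m i \<le> 1) then 1 else 0)"
    by simp
qed auto

lift_definition complete_sym :: "nat \<Rightarrow> 'a :: comm_ring_1 symf" is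
  "\<lambda>n m. if size m = n then 1 else 0"
  by auto

text \<open>Only \<open>n \<ge> 1\<close> is meaningful; by convention \<open>power_sum 0 = 1\<close>.\<close>

lift_definition power_sum :: "nat \<Rightarrow> 'a :: comm_ring_1 symf" is
  "\<lambda>n m. if \<exists>i. m = replicate_mset n i then 1 else 0"
proof (intro CollectI conjI allI impI)
  fix n m and \<pi> :: "nat \<Rightarrow> nat" assume \<pi>: "bij \<pi>"
  have "(\<exists>i. image_mset \<pi> m = replicate_mset n i) \<longleftrightarrow> (\<exists>i. m = replicate_mset n i)"
    using \<pi> by (metis image_mset_inv(1) image_replicate_mset)
  then show "(if \<exists>i. image_mset \<pi> m = replicate_mset n i then 1 else 0 :: 'a) =
      (if \<exists>i. m = replicate_mset n i then 1 else 0)" by simp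
next
  fix n
  show "\<exists>d. \<forall>m. d < size m \<longrightarrow> (if \<exists>i :: nat. m = replicate_mset n i then 1 else 0 :: 'a) = 0"
    by (intro exI[of _ n]) auto
qed

definition is_partition :: "nat list \<Rightarrow> bool" where
  "is_partition \<mu> \<longleftrightarrow> sorted_wrt (\<ge>) \<mu> \<and> 0 \<notin> set \<mu>"

definition dominates :: "nat list \<Rightarrow> nat list \<Rightarrow> bool" where
  "dominates \<nu> \<mu> \<longleftrightarrow> sum_list \<nu> = sum_list \<mu> \<and>
     (\<forall>i. sum_list (take i \<mu>) \<le> sum_list (take i \<nu>))"

definition conjugate :: "nat list \<Rightarrow> nat list" where
  "conjugate \<mu> = map (\<lambda>j. length (filter (\<lambda>r. j < r) \<mu>)) [0..<(if \<mu> = [] then 0 else hd \<mu>)]"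

text \<open>Jacobi-Trudi determinant of the matrix $h_{\mu_i - i + j}$, where $h_r = 0$ for $r < 0$.\<close>

definition schur :: "nat list \<Rightarrow> 'a :: comm_ring_1 symf" where
  "schur \<mu> = det (mat (length \<mu>) (length \<mu>)
     (\<lambda>(i, j). if i \<le> \<mu> ! i + j then complete_sym (\<mu> ! i + j - i) else 0))"

definition power_sum_part :: "nat list \<Rightarrow> 'a :: comm_ring_1 symf" where
  "power_sum_part \<mu> = prod_list (map power_sum \<mu>)"

text \<open>The coefficients of the unique expression of a symmetric function (over a field of
  characteristic zero) in the basis of the \<open>power_sum_part \<mu>\<close>, \<open>\<mu>\<close> a partition.\<close>

definition power_sum_coeffs :: "'a :: field_char_0 symf \<Rightarrow> nat list \<Rightarrow> 'a" where
  "power_sum_coeffs f = (THE c. finite {\<mu>. c \<mu> \<noteq> 0} \<and> (\<forall>\<mu>. c \<mu> \<noteq> 0 \<longrightarrow> is_partition \<mu>) \<and>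
     f = (\<Sum>\<mu> | c \<mu> \<noteq> 0. scale_symf (c \<mu>) (power_sum_part \<mu>)))"

text \<open>The Hall scalar product is determined by $\langle p_\mu, p_\nu\rangle = z_\mu \delta_{\mu\nu}$
  with $z_\mu = \prod_i i^{m_i} m_i!$, where $m_i$ is the multiplicity of $i$ in $\mu$.\<close>

definition z_part :: "nat list \<Rightarrow> nat" where
  "z_part \<mu> = (\<Prod>i\<in>set \<mu>. i ^ count_list \<mu> i * fact (count_list \<mu> i))"

definition hall :: "'a :: field_char_0 symf \<Rightarrow> 'a symf \<Rightarrow> 'a" where
  "hall f g = (\<Sum>\<mu> | power_sum_coeffs f \<mu> \<noteq> 0.
     power_sum_coeffs f \<mu> * power_sum_coeffs g \<mu> * of_nat (z_part \<mu>))"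

definition omega :: "'a :: field_char_0 symf \<Rightarrow> 'a symf" where
  "omega = (THE w. (\<forall>f g. w (f + g) = w f + w g) \<and> (\<forall>f g. w (f * g) = w f * w g) \<and>
     (\<forall>c f. w (scale_symf c f) = scale_symf c (w f)) \<and> (\<forall>k. w (elem_sym k) = complete_sym k))"

text \<open>\<open>adams k A\<close> replaces all the variables $x_i$, $q$, $t$ in \<open>A\<close> by their \<open>k\<close>-th powers.
  For \<open>k \<ge> 1\<close> the sum below has at most one term; \<open>k = 0\<close> is not meaningful (the value is then 0).\<close>

lift_definition adams :: "nat \<Rightarrow> qt symf \<Rightarrow> qt symf" is
  "\<lambda>k A m. \<Sum>m' | repeat_mset k m' = m. qt_subst (q_var ^ k) (t_var ^ k) (A m')"
proof (intro CollectI conjI allI impI; elim CollectE conjE exE)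
  fix k m and A :: "nat multiset \<Rightarrow> qt" and \<pi> :: "nat \<Rightarrow> nat"
  assume A: "\<forall>\<pi> m. bij \<pi> \<longrightarrow> A (image_mset \<pi> m) = A m" and \<pi>: "bij \<pi>"
  have rep: "repeat_mset k (image_mset \<rho> m') = image_mset \<rho> (repeat_mset k m')"
    for \<rho> :: "nat \<Rightarrow> nat" and m'
    by (induction k) auto
  show "(\<Sum>m' | repeat_mset k m' = image_mset \<pi> m. qt_subst (q_var ^ k) (t_var ^ k) (A m')) =
      (\<Sum>m' | repeat_mset k m' = m. qt_subst (q_var ^ k) (t_var ^ k) (A m'))"
    by (rule sum.reindex_bij_witness[where i = "image_mset \<pi>" and j = "image_mset (inv_into UNIV \<pi>)"])
       (use A \<pi> in \<open>auto simp: rep bij_imp_bij_inv image_mset_inv\<close>)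
next
  fix k d and A :: "nat multiset \<Rightarrow> qt"
  assume A: "\<forall>m. d < size m \<longrightarrow> A m = 0"
  have "(\<Sum>m' | repeat_mset k m' = m. qt_subst (q_var ^ k) (t_var ^ k) (A m')) = 0"
    if "k * d < size m" for m
    by (rule sum.neutral) (use A that in auto)
  then show "\<exists>d. \<forall>m. d < size m \<longrightarrow>
      (\<Sum>m' | repeat_mset k m' = m. qt_subst (q_var ^ k) (t_var ^ k) (A m')) = 0"
    by blast
qed

definition plethysm :: "qt symf \<Rightarrow> qt symf \<Rightarrow> qt symf" where
  "plethysm f A = (\<Sum>\<mu> | power_sum_coeffs f \<mu> \<noteq> 0.
     scale_symf (power_sum_coeffs f \<mu>) (prod_list (map (\<lambda>k. adams k A) \<mu>)))"

definition X_alphabet :: "qt symf" where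
  "X_alphabet = power_sum 1"

definition q_int :: "nat \<Rightarrow> qt" where
  "q_int m = (\<Sum>i<m. q_var ^ i)"

text \<open>The parts of \<open>\<mu>\<close> are the row lengths of its diagram, listed from the bottom row upwards (French
  convention): the cell \<open>j\<close> of row \<open>i\<close> has \<open>j\<close> cells strictly left of it and \<open>i\<close> cells below it.\<close>

definition B_part :: "nat list \<Rightarrow> qt" where
  "B_part \<mu> = (\<Sum>i<length \<mu>. \<Sum>j<\<mu> ! i. q_var ^ j * t_var ^ i)"

definition mod_macdonald :: "nat list \<Rightarrow> qt symf" where
  "mod_macdonald \<mu> = (THE H.
     homogeneous_symf (sum_list \<mu>) H \<and>
     plethysm H (X_alphabet * const_symf (1 - q_var)) \<in>
       symf.span (schur ` {\<nu>. is_partition \<nu> \<and> dominates \<nu> \<mu>}) \<and>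
     plethysm H (X_alphabet * const_symf (1 - t_var)) \<in>
       symf.span (schur ` {\<nu>. is_partition \<nu> \<and> dominates \<nu> (conjugate \<mu>)}) \<and>
     hall H (schur [sum_list \<mu>]) = 1)"

text \<open>The eigenvalue \<open>f[B\<^sub>\<mu>]\<close> is the constant symmetric function
  \<open>plethysm f (const_symf (B_part \<mu>))\<close>, acting by multiplication.\<close>

definition Delta :: "qt symf \<Rightarrow> qt symf \<Rightarrow> qt symf" where
  "Delta f = (THE D. Vector_Spaces.linear scale_symf scale_symf D \<and>
     (\<forall>\<mu>. is_partition \<mu> \<longrightarrow>
        D (mod_macdonald \<mu>) = plethysm f (const_symf (B_part \<mu>)) * mod_macdonald \<mu>))"

definition t_regular :: "qt symf \<Rightarrow> bool" where
  "t_regular f \<longleftrightarrow> (\<forall>m. qt_regular q_var (1 / q_var) (coeff_symf f m))"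

text \<open>Only meaningful for symmetric functions \<open>f\<close> with \<open>t_regular f\<close>.\<close>

lift_definition t_specialize :: "qt symf \<Rightarrow> qt symf" is
  "\<lambda>f m. qt_subst q_var (1 / q_var) (f m)"
proof (intro CollectI conjI; elim CollectE conjE exE)
  fix f :: "nat multiset \<Rightarrow> qt" and d
  assume "\<forall>m. d < size m \<longrightarrow> f m = 0"
  then show "\<exists>d. \<forall>m. d < size m \<longrightarrow> qt_subst q_var (1 / q_var) (f m) = 0"
    by (intro exI[of _ d]) auto
qed auto

end

(* Write M = (1 - q)(1 - t). The operator D0 F = F[X + M/z] (sum_i (-z)^i e_i) |_(z^0) becomes, after
   the substitution X -> X(1 - q), triangular in the products h_mu for the dominance order, with
   eigenvalues 1 - M B_mu; since D0 is symmetric in q and t, the same holds after X -> X(1 - t) with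
   conjugate partitions. The eigenvalues being distinct, its eigenvectors are the modified Macdonald
   polynomials, and Delta_f acts on them by f[B_mu]. The projections onto the eigenlines are
   polynomials in D0, so everything stays regular at t = 1/q. There D0 is diagonalized by the
   s_mu[X/(1 - q)] (which also shows that H_mu[1] is not zero), and p_n is (1 - q^n) times the
   alternating sum of the s_mu[X/(1 - q)] over hooks mu of size n. For the hook with r + 1 rows B_mu
   specializes to q^(-r) [n]_q, hence f[B_mu] to q^(-rk) f[[n]_q], and the resulting sum over r is a
   multiple of h_n[X (1 - q^(-k)) / (1 - q)], i.e. of e_n[X [k]_q]. *)

theory Submission
  imports
    Defs
    "HOL-Computational_Algebra.Formal_Power_Series"
    "HOL-Combinatorics.Permutations"
begin

subsection \<open>Coefficients\<close>

text \<open>The objects \<open>mod_macdonald\<close>, \<open>Delta\<close>, \<open>omega\<close> and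
  \<open>power_sum_coeffs\<close> are definite descriptions, so each needs existence and uniqueness
  before anything can be computed; the eigenlines of \<open>D0\<close> supply both for the Macdonald
  polynomials. Normalizing an eigenvector v means dividing by v[1]; at t = 1/q this is, up to a
  nonzero factor, a Jacobi-Trudi determinant at X = 1/(1 - q), whose nonvanishing comes from
  counting roots of a polynomial. The point t = 1/q is harmless because the eigenvalues stay
  distinct there: they record the contents of the cells, which determine the partition. Hence the
  interpolation polynomials for the projections keep nonzero denominators, and it is the projections
  that are specialized. The special feature of t = 1/q is a relation L B = t B L + (1 - t) q^a B,
  with L the operator \<open>D0\<close> read in the alphabet X(1 - q) and B the Bernstein operator
  adding a row of length a; so a Schur function built row by row remains an eigenvector. Families
  indexed by n are identified by comparing power sums, since Newton's recursion then fixes the whole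
  generating series.\<close>

lemma coeff_symf_zero [simp]: "coeff_symf 0 m = 0"
  by transfer simp

lemma coeff_symf_add [simp]: "coeff_symf (f + g) m = coeff_symf f m + coeff_symf g m"
  by transfer simp

lemma coeff_symf_uminus [simp]: "coeff_symf (- f) m = - coeff_symf f m"
  by transfer simp

lemma coeff_symf_diff [simp]: "coeff_symf (f - g) m = coeff_symf f m - coeff_symf g m"
  using coeff_symf_add[of f "- g" m] by simp

lemma coeff_symf_sum: "coeff_symf (sum f A) m = (\<Sum>x\<in>A. coeff_symf (f x) m)"
  by (induction A rule: infinite_finite_induct) auto

lemma coeff_symf_mult: "coeff_symf (f * g) m = (\<Sum>(a, b)\<in>splittings m. coeff_symf f a * coeff_symf g b)"
  by transfer simp

lemma coeff_symf_scale [simp]: "coeff_symf (scale_symf c f) m = c * coeff_symf f m"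
  by (simp add: scale_symf_def coeff_const_times)

lemma coeff_symf_const: "coeff_symf (const_symf c) m = (if m = {#} then c else 0)"
  by transfer simp

lemma coeff_symf_one: "coeff_symf 1 m = (if m = {#} then 1 else 0)"
  by (simp add: one_symf_def coeff_symf_const)

lemma coeff_symf_bij: "bij \<pi> \<Longrightarrow> coeff_symf f (image_mset \<pi> m) = coeff_symf f m"
  by transfer blast

lemma coeff_symf_bounded: obtains d where "\<And>m. size m > d \<Longrightarrow> coeff_symf f m = 0"
proof -
  have "\<exists>d. \<forall>m. size m > d \<longrightarrow> coeff_symf f m = 0" by transfer blast
  then show ?thesis using that by blast
qed

lemma const_symf_0 [simp]: "const_symf 0 = 0"
  by transfer auto

lemma const_symf_1 [simp]: "const_symf 1 = 1"
  by (simp add: one_symf_def)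

lemma const_symf_minus: "const_symf (- a) = - const_symf a"
  by transfer auto

lemma const_symf_diff: "const_symf (a - b) = const_symf a - const_symf b"
  using const_symf_add[of a "- b"] by (simp add: const_symf_minus)

lemma const_symf_of_nat: "const_symf (of_nat n) = of_nat n"
  by (induction n) (auto simp: const_symf_add)

lemma const_symf_power: "const_symf (a ^ n) = const_symf a ^ n"
  by (induction n) (auto simp: const_symf_mult)

lemma scale_symf_mult_left: "scale_symf c f * g = scale_symf c (f * g)"
  by (simp add: scale_symf_def mult.assoc)

lemma scale_symf_mult_right: "f * scale_symf c g = scale_symf c (f * g)"
  by (simp add: scale_symf_def mult.left_commute)

lemma scale_symf_sum_right: "scale_symf c (sum f A) = (\<Sum>x\<in>A. scale_symf c (f x))"
  by (simp add: scale_symf_def sum_distrib_left)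

text \<open>A splitting contributes only if its first half is k copies of a single variable i. Since
  \<open>k > 0\<close>, distinct i give distinct splittings, so the sum runs over the variables
  occurring at least k times.\<close>

lemma coeff_power_sum_times:
  assumes "k > 0"
  shows "coeff_symf (power_sum k * f) m =
    (\<Sum>i\<in>{i \<in> set_mset m. k \<le> count m i}. coeff_symf f (m - replicate_mset k i))"
proof -
  define A where "A = {i \<in> set_mset m. k \<le> count m i}"
  define g where "g = (\<lambda>i. (replicate_mset k i, m - replicate_mset k i))"
  have finA: "finite A" by (simp add: A_def)
  have inj: "inj_on g A"
    using assms unfolding inj_on_def g_def
    by (metis Pair_inject bot_nat_0.not_eq_extremum in_replicate_mset)
  have sub: "replicate_mset k i \<subseteq># m" if "k \<le> count m i" for i
    using that by (simp add: subseteq_mset_def)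
  have gA: "g ` A \<subseteq> splittings m"
    by (auto simp: g_def A_def splittings_def sub)
  have "coeff_symf (power_sum k * f) m =
      (\<Sum>(a, b)\<in>splittings m. (if \<exists>i. a = replicate_mset k i then 1 else 0) * coeff_symf f b)"
    by (simp add: coeff_symf_mult power_sum.rep_eq)
  also have "\<dots> = (\<Sum>(a, b)\<in>g ` A. (if \<exists>i. a = replicate_mset k i then 1 else 0) * coeff_symf f b)"
  proof (rule sum.mono_neutral_right[OF finite_splittings gA], clarify)
    fix a b assume ab: "(a, b) \<in> splittings m" "(a, b) \<notin> g ` A"
    have "\<not> (\<exists>i. a = replicate_mset k i)"
    proof
      assume "\<exists>i. a = replicate_mset k i"
      then obtain i where a: "a = replicate_mset k i" by blast
      have "m = replicate_mset k i + b" using ab a by (simp add: splittings_def)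
      then have "i \<in> A \<and> (a, b) = g i" using assms a by (auto simp: A_def g_def)
      then show False using ab by blast
    qed
    then show "(if \<exists>i. a = replicate_mset k i then 1 else 0) * coeff_symf f b = 0" by simp
  qed
  also have "\<dots> = (\<Sum>i\<in>A. coeff_symf f (m - replicate_mset k i))"
    by (subst sum.reindex[OF inj]) (auto simp: g_def intro!: sum.cong)
  finally show ?thesis by (simp add: A_def)
qed

subsection \<open>The power sum basis\<close>

text \<open>The multiset of nonzero exponents of a monomial, which names its orbit under
  permutations of the variables.\<close>

definition shape :: "'b multiset \<Rightarrow> nat multiset" where
  "shape m = image_mset (count m) (mset_set (set_mset m))"

lemma size_shape: "size (shape m) = card (set_mset m)"
  by (simp add: shape_def)

lemma sum_shape: "sum_mset (shape m) = size m"
  by (simp add: shape_def size_multiset_overloaded_eq sum_unfold_sum_mset)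

lemma zero_notin_shape: "0 \<notin># shape m"
  by (auto simp: shape_def not_in_iff simp flip: count_greater_zero_iff)

text \<open>On the union C of the two supports the exponents, padded with zeros, form equal
  multisets, so a permutation of C matches them. Outside C it is the identity and all exponents are
  0.\<close>

lemma shape_eq_imp_bij:
  fixes m m' :: "'b multiset"
  assumes "shape m = shape m'"
  shows "\<exists>\<pi>. bij \<pi> \<and> image_mset \<pi> m = m'"
proof -
  define C where "C = set_mset m \<union> set_mset m'"
  have aux: "image_mset (count n) (mset_set C) = shape n + replicate_mset (card C - size (shape n)) 0"
    if "set_mset n \<subseteq> C" "finite C" for n :: "'b multiset" and C
  proof -
    have "mset_set C = mset_set (set_mset n) + mset_set (C - set_mset n)"
      using that by (metis finite_set_mset finite_Diff mset_set_Union Diff_disjoint Un_Diff_cancel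
          Un_absorb1)
    moreover have "image_mset (count n) (mset_set (C - set_mset n)) =
        image_mset (\<lambda>_. 0) (mset_set (C - set_mset n))"
      using that by (intro image_mset_cong) (auto simp: not_in_iff)
    moreover have "card (C - set_mset n) = card C - card (set_mset n)"
      using that by (simp add: card_Diff_subset)
    ultimately show ?thesis
      by (simp add: shape_def image_mset_const_eq)
  qed
  have fin: "finite C" by (simp add: C_def)
  have "image_mset (count m) (mset_set C) = image_mset (count m') (mset_set C)"
    using aux[of m C] aux[of m' C] assms fin by (simp add: C_def)
  then obtain p where p: "p permutes C" and pc: "\<forall>x\<in>C. count m x = count m' (p x)"
    by (rule image_mset_eq_implies_permutes[OF fin])
  have bp: "bij p" using p by (rule permutes_bij)
  have "count (image_mset p m) y = count m' y" for y
  proof -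
    obtain x where x: "y = p x" using bp by (metis bij_pointE)
    have "count (image_mset p m) (p x) = count m x"
      using bp by (induction m) (auto simp: bij_is_inj inj_eq)
    also have "count m x = count m' (p x)"
    proof (cases "x \<in> C")
      case False
      then have "p x \<notin> C" using p by (metis permutes_in_image)
      then show ?thesis using False by (simp add: C_def not_in_iff)
    qed (use pc in auto)
    finally show ?thesis using x by simp
  qed
  then show ?thesis using bp by (metis multiset_eqI)
qed

lemma coeff_symf_shape: "shape m = shape m' \<Longrightarrow> coeff_symf f m = coeff_symf f m'"
  using shape_eq_imp_bij[of m m'] by (metis coeff_symf_bij)

text \<open>For nonzero parts this is the coefficient of the monomial m in p_\<mu>: the number of
  ways to place the parts at variables so that the parts at each variable add up to its exponent. As
  a natural number it can be shown positive before being mapped to a field.\<close>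

fun power_sum_count :: "nat list \<Rightarrow> nat multiset \<Rightarrow> nat" where
  "power_sum_count [] m = (if m = {#} then 1 else 0)"
| "power_sum_count (k # \<mu>) m =
    (\<Sum>i\<in>{i \<in> set_mset m. k \<le> count m i}. power_sum_count \<mu> (m - replicate_mset k i))"

lemma power_sum_part_Nil [simp]: "power_sum_part [] = 1"
  by (simp add: power_sum_part_def)

lemma power_sum_part_Cons [simp]: "power_sum_part (k # \<mu>) = power_sum k * power_sum_part \<mu>"
  by (simp add: power_sum_part_def)

lemma power_sum_part_append: "power_sum_part (\<mu> @ \<nu>) = power_sum_part \<mu> * power_sum_part \<nu>"
  by (simp add: power_sum_part_def)

lemma coeff_power_sum_part:
  "0 \<notin> set \<mu> \<Longrightarrow> coeff_symf (power_sum_part \<mu>) m = of_nat (power_sum_count \<mu> m)"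
  by (induction \<mu> arbitrary: m) (auto simp: coeff_symf_one coeff_power_sum_times)

lemma shape_remove:
  assumes "i \<in># m" "count m i = k"
  shows "shape m = add_mset k (shape (m - replicate_mset k i))"
proof -
  have s: "set_mset (m - replicate_mset k i) = set_mset m - {i}"
    using assms by (force simp: set_eq_iff in_diff_count not_in_iff)
  have "mset_set (set_mset m) = add_mset i (mset_set (set_mset m - {i}))"
    using assms by (meson finite_set_mset mset_set.remove)
  moreover have "image_mset (count m) (mset_set (set_mset m - {i})) =
      image_mset (count (m - replicate_mset k i)) (mset_set (set_mset m - {i}))"
    by (intro image_mset_cong) auto
  ultimately show ?thesis using assms by (simp add: shape_def s)
qed

text \<open>Each variable of the monomial must receive at least one part, and if there are as many
  variables as parts then each receives exactly one. This is the triangularity behind the basis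
  property, filtered by the number of variables.\<close>

lemma power_sum_count_nonzero:
  assumes "power_sum_count \<mu> m \<noteq> 0" "0 \<notin> set \<mu>"
  shows "size m = sum_list \<mu> \<and> card (set_mset m) \<le> length \<mu> \<and>
    (card (set_mset m) = length \<mu> \<longrightarrow> shape m = mset \<mu>)"
  using assms
proof (induction \<mu> arbitrary: m)
  case Nil
  then show ?case by (auto simp: shape_def split: if_splits)
next
  case (Cons k \<mu>)
  then obtain i where i: "i \<in># m" "k \<le> count m i" "power_sum_count \<mu> (m - replicate_mset k i) \<noteq> 0"
    by (auto elim: sum.not_neutral_contains_not_neutral)
  define m' where "m' = m - replicate_mset k i"
  have sub: "replicate_mset k i \<subseteq># m" using i by (simp add: subseteq_mset_def)
  have IH: "size m' = sum_list \<mu>" "card (set_mset m') \<le> length \<mu>"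
      "card (set_mset m') = length \<mu> \<Longrightarrow> shape m' = mset \<mu>"
    using Cons.IH[of m'] i Cons.prems by (auto simp: m'_def)
  have sz: "size m = k + size m'"
    using sub by (simp add: m'_def size_Diff_submset) (metis add_diff_inverse_nat
        not_less size_mset_mono size_replicate_mset)
  show ?case
  proof (cases "count m i = k")
    case True
    have "shape m = add_mset k (shape m')" unfolding m'_def by (rule shape_remove[OF i(1) True])
    moreover from this have "card (set_mset m) = Suc (card (set_mset m'))"
      by (metis size_add_mset size_shape)
    ultimately show ?thesis using IH sz by auto
  next
    case False
    then have "i \<in># m'" using i by (simp add: m'_def in_diff_count)
    then have "set_mset m' = set_mset m"
      unfolding m'_def by (auto simp: in_diff_count dest: in_diffD split: if_splits)
    then show ?thesis using IH sz by simp
  qed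
qed

lemma power_sum_count_shape:
  assumes "shape m = mset \<mu>"
  shows "power_sum_count \<mu> m > 0"
  using assms
proof (induction \<mu> arbitrary: m)
  case Nil
  then have "card (set_mset m) = 0" using size_shape[of m] by simp
  then have "m = {#}" by simp
  then show ?case by simp
next
  case (Cons k \<mu>)
  then have "k \<in># shape m" by simp
  then obtain i where i: "i \<in># m" "count m i = k" by (auto simp: shape_def)
  have "shape (m - replicate_mset k i) = mset \<mu>"
    using shape_remove[OF i] Cons.prems by simp
  then have "power_sum_count \<mu> (m - replicate_mset k i) > 0" by (rule Cons.IH)
  then show ?case using i by (auto intro!: sum_pos2[of _ i])
qed

definition sort_part :: "nat multiset \<Rightarrow> nat list" where
  "sort_part M = rev (sorted_list_of_multiset (filter_mset (\<lambda>k. k \<noteq> 0) M))"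

lemma mset_sort_part: "mset (sort_part M) = filter_mset (\<lambda>k. k \<noteq> 0) M"
  by (simp add: sort_part_def)

lemma is_partition_sort_part [simp]: "is_partition (sort_part M)"
proof -
  have "set (sort_part M) = set_mset (filter_mset (\<lambda>k. k \<noteq> 0) M)"
    by (metis mset_sort_part set_mset_mset)
  then show ?thesis
    by (auto simp: is_partition_def sort_part_def sorted_wrt_rev)
qed

lemma partition_eqI:
  assumes "is_partition \<mu>" "is_partition \<nu>" "mset \<mu> = mset \<nu>"
  shows "\<mu> = \<nu>"
proof -
  have "sorted (rev \<mu>)" "sorted (rev \<nu>)" using assms(1,2) by (auto simp: is_partition_def sorted_wrt_rev)
  then have "rev \<mu> = rev \<nu>" using assms(3) by (metis mset_rev properties_for_sort)
  then show ?thesis by simp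
qed

lemma sum_list_sort_part: "sum_list (sort_part M) = sum_mset M"
proof -
  have "sum_mset (filter_mset (\<lambda>k. k \<noteq> 0) M) = sum_mset M" by (induction M) auto
  then show ?thesis by (metis mset_sort_part sum_mset_sum_list)
qed

lemma power_sum_part_perm: "mset \<mu> = mset \<nu> \<Longrightarrow> power_sum_part \<mu> = power_sum_part \<nu>"
  unfolding power_sum_part_def by (metis mset_map prod_mset_prod_list)

definition monom_part :: "nat list \<Rightarrow> nat multiset" where
  "monom_part \<mu> = (\<Sum>i<length \<mu>. replicate_mset (\<mu> ! i) i)"

lemma count_monom_part: "count (monom_part \<mu>) i = (if i < length \<mu> then \<mu> ! i else 0)"
  by (simp add: monom_part_def count_sum sum.delta' split: if_splits)

lemma shape_monom_part:
  assumes "0 \<notin> set \<mu>"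
  shows "shape (monom_part \<mu>) = mset \<mu>"
proof -
  have s: "set_mset (monom_part \<mu>) = {..<length \<mu>}"
    using assms by (auto simp: set_eq_iff count_monom_part in_set_conv_nth intro!: gr0I
        simp flip: count_greater_zero_iff split: if_splits)
  have "shape (monom_part \<mu>) = image_mset (\<lambda>i. \<mu> ! i) (mset_set {..<length \<mu>})"
    unfolding shape_def s by (intro image_mset_cong) (auto simp: count_monom_part)
  also have "mset_set {..<length \<mu>} = mset [0..<length \<mu>]" by (simp add: lessThan_atLeast0)
  finally show ?thesis by (metis map_nth mset_map)
qed

definition partitions_of :: "nat \<Rightarrow> nat list set" where
  "partitions_of n = {\<mu>. is_partition \<mu> \<and> sum_list \<mu> = n}"

lemma length_le_sum_list: "0 \<notin> set \<mu> \<Longrightarrow> length \<mu> \<le> sum_list (\<mu> :: nat list)"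
  by (induction \<mu>) auto

lemma finite_partitions_of [simp]: "finite (partitions_of n)"
proof (rule finite_subset)
  show "partitions_of n \<subseteq> {xs. set xs \<subseteq> {..n} \<and> length xs \<le> n}"
    by (auto simp: partitions_of_def is_partition_def length_le_sum_list member_le_sum_list)
  show "finite {xs :: nat list. set xs \<subseteq> {..n} \<and> length xs \<le> n}"
    by (rule finite_lists_length_le) simp
qed

text \<open>Induction on a bound for the number of variables in the monomials of f: the coefficients
  at monomials with the most variables are matched by power sum products with that many parts, and
  subtracting these lowers the bound. The predicate \<open>R\<close> can be carried along because
  only ring operations and division by positive integers occur. Taken later as regularity at t =
  1/q, it makes the expansion specialize.\<close>

lemma power_sum_expansion_exists:
  fixes f :: "'a :: field_char_0 symf"
  assumes cl: "\<And>n. R (of_nat n)" "\<And>a b. R a \<Longrightarrow> R b \<Longrightarrow> R (a - b)" "\<And>a b. R a \<Longrightarrow> R b \<Longrightarrow> R (a * b)"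
    "\<And>a n. R a \<Longrightarrow> n > 0 \<Longrightarrow> R (a / of_nat n)"
  assumes Rf: "\<And>m. R (coeff_symf f m)"
  shows "\<exists>c. finite {\<mu>. c \<mu> \<noteq> 0} \<and> (\<forall>\<mu>. c \<mu> \<noteq> 0 \<longrightarrow> is_partition \<mu>) \<and> (\<forall>\<mu>. R (c \<mu>)) \<and>
    f = (\<Sum>\<mu> | c \<mu> \<noteq> 0. scale_symf (c \<mu>) (power_sum_part \<mu>))"
proof -
  have R0: "R 0" using cl(1)[of 0] by simp
  have Radd: "R (a + b)" if "R a" "R b" for a b
    using cl(2)[OF that(1) cl(2)[OF R0 that(2)]] by simp
  have main: "\<exists>S c. finite S \<and> S \<subseteq> Collect is_partition \<and> (\<forall>\<mu>. R (c \<mu>)) \<and>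
      g = (\<Sum>\<mu>\<in>S. scale_symf (c \<mu>) (power_sum_part \<mu>))"
    if "\<And>m. R (coeff_symf g m)" "\<And>m. card (set_mset m) \<ge> L \<Longrightarrow> coeff_symf g m = 0"
    for L and g :: "'a symf"
    using that
  proof (induction L arbitrary: g)
    case 0
    then have "g = 0" by (intro symf_eqI) simp
    then show ?case using R0 by (intro exI[of _ "{}"] exI[of _ "\<lambda>_. 0"]) auto
  next
    case (Suc L)
    obtain d where d: "\<And>m. size m > d \<Longrightarrow> coeff_symf g m = 0" using coeff_symf_bounded[of g] by blast
    define S where "S = {\<mu>. length \<mu> = L \<and> \<mu> \<in> (\<Union>n\<le>d. partitions_of n)}"
    have finS: "finite S" by (simp add: S_def)
    have Sp: "\<mu> \<in> S \<Longrightarrow> is_partition \<mu>" for \<mu> by (auto simp: S_def partitions_of_def)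
    \<comment> \<open>The divisor is the coefficient of p_\<mu> at its own monomial, a positive
      integer, so \<open>R\<close> survives the division.\<close>
    define c where "c = (\<lambda>\<mu>. coeff_symf g (monom_part \<mu>) / of_nat (power_sum_count \<mu> (monom_part \<mu>)))"
    define c' where "c' = (\<lambda>\<mu>. if \<mu> \<in> S then c \<mu> else 0)"
    define h where "h = (\<Sum>\<mu>\<in>S. scale_symf (c' \<mu>) (power_sum_part \<mu>))"
    have Rc: "R (c' \<mu>)" for \<mu>
    proof (cases "\<mu> \<in> S")
      case True
      then have "power_sum_count \<mu> (monom_part \<mu>) > 0"
        by (intro power_sum_count_shape shape_monom_part) (use Sp in \<open>auto simp: is_partition_def\<close>)
      then show ?thesis using True Suc.prems by (auto simp: c'_def c_def cl(4))
    qed (auto simp: c'_def R0)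
    have ch: "coeff_symf h m = (\<Sum>\<mu>\<in>S. c' \<mu> * of_nat (power_sum_count \<mu> m))" for m
      unfolding h_def coeff_symf_sum
      by (intro sum.cong refl) (use Sp in \<open>auto simp: coeff_power_sum_part is_partition_def\<close>)
    have Rh: "R (coeff_symf h m)" for m
      unfolding ch using finS
      by (induction S rule: finite_induct) (auto simp: R0 intro!: Radd cl Rc)
    have hz: "coeff_symf (g - h) m = 0" if "card (set_mset m) \<ge> L" for m
    proof -
      \<comment> \<open>The exponents of m as a partition: the only index in \<open>S\<close> whose
        power sum product can contain m.\<close>
      define \<mu>0 where "\<mu>0 = sort_part (shape m)"
      have ms0: "mset \<mu>0 = shape m"
        using zero_notin_shape[of m] by (auto simp: \<mu>0_def mset_sort_part filter_mset_eq_conv intro: gr0I)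
      have z: "power_sum_count \<mu> m = 0" if "\<mu> \<in> S" "\<mu> \<noteq> \<mu>0 \<or> card (set_mset m) \<noteq> L" for \<mu>
      proof (rule ccontr)
        assume nz: "power_sum_count \<mu> m \<noteq> 0"
        have "0 \<notin> set \<mu>" using Sp[OF that(1)] by (simp add: is_partition_def)
        then have "card (set_mset m) = L" "shape m = mset \<mu>"
          using power_sum_count_nonzero[OF nz] that \<open>card (set_mset m) \<ge> L\<close> by (auto simp: S_def)
        moreover from this have "\<mu> = \<mu>0"
          using Sp[OF that(1)] ms0 by (intro partition_eqI) (simp_all add: \<mu>0_def)
        ultimately show False using that(2) by blast
      qed
      show ?thesis
      proof (cases "\<mu>0 \<in> S \<and> card (set_mset m) = L")
        case True
        then have "coeff_symf h m = c \<mu>0 * of_nat (power_sum_count \<mu>0 m)"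
          unfolding ch using z finS by (subst sum.remove[of _ \<mu>0]) (auto simp: c'_def)
        also have "of_nat (power_sum_count \<mu>0 m) = (coeff_symf (power_sum_part \<mu>0) m :: 'a)"
          using Sp True by (subst coeff_power_sum_part) (auto simp: is_partition_def)
        also have "\<dots> = coeff_symf (power_sum_part \<mu>0) (monom_part \<mu>0)"
          using Sp True by (intro coeff_symf_shape)
             (auto simp: ms0 shape_monom_part is_partition_def)
        also have "\<dots> = of_nat (power_sum_count \<mu>0 (monom_part \<mu>0))"
          using Sp True by (subst coeff_power_sum_part) (auto simp: is_partition_def)
        also have "c \<mu>0 * \<dots> = coeff_symf g (monom_part \<mu>0)"
          using power_sum_count_shape[of "monom_part \<mu>0" \<mu>0] Sp True
          by (simp add: c_def shape_monom_part is_partition_def)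
        also have "\<dots> = coeff_symf g m"
          using Sp True by (intro coeff_symf_shape) (auto simp: ms0 shape_monom_part is_partition_def)
        finally show ?thesis by simp
      next
        case False
        have "coeff_symf h m = 0"
          unfolding ch
        proof (intro sum.neutral ballI)
          fix \<mu> assume "\<mu> \<in> S"
          then have "power_sum_count \<mu> m = 0" using z[of \<mu>] False by blast
          then show "c' \<mu> * of_nat (power_sum_count \<mu> m) = 0" by simp
        qed
        moreover have "coeff_symf g m = 0"
        proof (cases "card (set_mset m) = L")
          case True
          then have "\<mu>0 \<notin> S" using False by simp
          moreover have "length \<mu>0 = L" using ms0 True by (metis size_mset size_shape)
          moreover have "sum_list \<mu>0 = size m" by (metis ms0 sum_mset_sum_list sum_shape)
          ultimately have "size m > d"
            by (auto simp: S_def partitions_of_def \<mu>0_def not_le)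
          then show ?thesis by (rule d)
        next
          case False
          then show ?thesis using that Suc.prems(2)[of m] by simp
        qed
        ultimately show ?thesis by simp
      qed
    qed
    obtain S2 c2 where 2: "finite S2" "S2 \<subseteq> Collect is_partition" "\<And>\<mu>. R (c2 \<mu>)"
      "g - h = (\<Sum>\<mu>\<in>S2. scale_symf (c2 \<mu>) (power_sum_part \<mu>))"
      using Suc.IH[of "g - h"] hz Suc.prems(1) Rh cl(2) by auto
    define c3 where "c3 = (\<lambda>\<mu>. c' \<mu> + (if \<mu> \<in> S2 then c2 \<mu> else 0))"
    have h1: "h = (\<Sum>\<mu>\<in>S \<union> S2. scale_symf (c' \<mu>) (power_sum_part \<mu>))"
      unfolding h_def by (rule sum.mono_neutral_left) (use finS 2(1) in \<open>auto simp: c'_def\<close>)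
    have h2: "g - h = (\<Sum>\<mu>\<in>S \<union> S2. scale_symf (if \<mu> \<in> S2 then c2 \<mu> else 0) (power_sum_part \<mu>))"
      unfolding 2(4) by (rule sum.mono_neutral_cong_left) (use finS 2(1) in auto)
    have "g = h + (g - h)" by simp
    then have "g = (\<Sum>\<mu>\<in>S \<union> S2. scale_symf (c3 \<mu>) (power_sum_part \<mu>))"
      unfolding h2 unfolding h1 by (simp only: c3_def symf.scale_left_distrib sum.distrib)
    moreover have "R (c3 \<mu>)" for \<mu> unfolding c3_def using Radd Rc 2(3) R0 by simp
    ultimately show ?case
      using finS 2(1,2) Sp by (intro exI[of _ "S \<union> S2"] exI[of _ c3]) auto
  qed
  obtain d where d: "\<And>m. size m > d \<Longrightarrow> coeff_symf f m = 0" using coeff_symf_bounded[of f] by blast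
  have card_le: "card (set_mset m) \<le> size m" for m :: "nat multiset"
    by (induction m) (auto simp: card_insert_if)
  obtain S c where S: "finite S" "S \<subseteq> Collect is_partition" "\<And>\<mu>. R (c \<mu>)"
    "f = (\<Sum>\<mu>\<in>S. scale_symf (c \<mu>) (power_sum_part \<mu>))"
    using main[OF Rf, of "Suc d"] d card_le by (meson Suc_le_lessD less_le_trans)
  define c' where "c' = (\<lambda>\<mu>. if \<mu> \<in> S then c \<mu> else 0)"
  have sub: "{\<mu>. c' \<mu> \<noteq> 0} \<subseteq> S" by (auto simp: c'_def)
  have "f = (\<Sum>\<mu> | c' \<mu> \<noteq> 0. scale_symf (c' \<mu>) (power_sum_part \<mu>))"
    unfolding S(4) by (rule sum.mono_neutral_cong_right) (use S(1) sub in \<open>auto simp: c'_def\<close>)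
  then show ?thesis
    using S(1-3) sub R0 by (intro exI[of _ c']) (auto simp: c'_def intro: finite_subset)
qed

text \<open>Take \<nu> of maximal length among the partitions with nonzero coefficient: at the
  monomial with exponents \<nu> no other term of the sum contributes.\<close>

lemma power_sum_part_independent:
  fixes c :: "nat list \<Rightarrow> 'a :: field_char_0"
  assumes S: "finite S" "\<And>\<mu>. \<mu> \<in> S \<Longrightarrow> is_partition \<mu>"
    and z: "(\<Sum>\<mu>\<in>S. scale_symf (c \<mu>) (power_sum_part \<mu>)) = 0" and "\<mu> \<in> S"
  shows "c \<mu> = 0"
proof (rule ccontr)
  assume "c \<mu> \<noteq> 0"
  define S' where "S' = {\<mu> \<in> S. c \<mu> \<noteq> 0}"
  have "finite S'" "S' \<noteq> {}" using S \<open>c \<mu> \<noteq> 0\<close> \<open>\<mu> \<in> S\<close> by (auto simp: S'_def)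
  then have "Max (length ` S') \<in> length ` S'" by simp
  then obtain \<nu> where nu: "\<nu> \<in> S'" "length \<nu> = Max (length ` S')" by auto
  then have max: "\<And>\<kappa>. \<kappa> \<in> S' \<Longrightarrow> length \<kappa> \<le> length \<nu>"
    using \<open>finite S'\<close> by simp
  let ?m = "monom_part \<nu>"
  have S'S: "S' \<subseteq> S" by (auto simp: S'_def)
  have nz: "0 \<notin> set \<kappa>" if "\<kappa> \<in> S'" for \<kappa> using that S by (auto simp: S'_def is_partition_def)
  have sh: "shape ?m = mset \<nu>" using nz[OF nu(1)] by (rule shape_monom_part)
  then have card: "card (set_mset ?m) = length \<nu>" by (metis size_mset size_shape)
  have "0 = coeff_symf (\<Sum>\<mu>\<in>S. scale_symf (c \<mu>) (power_sum_part \<mu>)) ?m" by (simp add: z)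
  also have "\<dots> = (\<Sum>\<kappa>\<in>S'. c \<kappa> * of_nat (power_sum_count \<kappa> ?m))"
    unfolding coeff_symf_sum coeff_symf_scale
    by (rule sum.mono_neutral_cong_right) (use S nz in \<open>auto simp: coeff_power_sum_part S'_def\<close>)
  also have "\<dots> = c \<nu> * of_nat (power_sum_count \<nu> ?m)"
  proof -
    have "power_sum_count \<kappa> ?m = 0" if "\<kappa> \<in> S'" "\<kappa> \<noteq> \<nu>" for \<kappa>
    proof (rule ccontr)
      assume "power_sum_count \<kappa> ?m \<noteq> 0"
      then have "mset \<kappa> = mset \<nu>"
        using power_sum_count_nonzero[OF _ nz[OF that(1)], of ?m] max[OF that(1)] card sh by auto
      then show False using that S S'S nu partition_eqI by blast
    qed
    then show ?thesis using nu \<open>finite S'\<close> by (subst sum.remove[of _ \<nu>]) auto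
  qed
  finally show False using power_sum_count_shape[OF sh] nu by (auto simp: S'_def)
qed

lemma power_sum_coeffs_unique:
  fixes c :: "nat list \<Rightarrow> 'a :: field_char_0"
  assumes "finite {\<mu>. c \<mu> \<noteq> 0}" "\<And>\<mu>. c \<mu> \<noteq> 0 \<Longrightarrow> is_partition \<mu>"
    "f = (\<Sum>\<mu> | c \<mu> \<noteq> 0. scale_symf (c \<mu>) (power_sum_part \<mu>))"
  shows "power_sum_coeffs f = c"
  unfolding power_sum_coeffs_def
proof (rule the_equality)
  fix d assume d: "finite {\<mu>. d \<mu> \<noteq> 0} \<and> (\<forall>\<mu>. d \<mu> \<noteq> 0 \<longrightarrow> is_partition \<mu>) \<and>
     f = (\<Sum>\<mu> | d \<mu> \<noteq> 0. scale_symf (d \<mu>) (power_sum_part \<mu>))"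
  define S where "S = {\<mu>. c \<mu> \<noteq> 0} \<union> {\<mu>. d \<mu> \<noteq> 0}"
  have S: "finite S" "\<And>\<mu>. \<mu> \<in> S \<Longrightarrow> is_partition \<mu>"
    using assms(1,2) d unfolding S_def by blast+
  have c: "f = (\<Sum>\<mu>\<in>S. scale_symf (c \<mu>) (power_sum_part \<mu>))"
    unfolding assms(3) by (rule sum.mono_neutral_left) (use S in \<open>auto simp: S_def\<close>)
  have d': "f = (\<Sum>\<mu>\<in>S. scale_symf (d \<mu>) (power_sum_part \<mu>))"
    using d by (subst (asm) sum.mono_neutral_left[of S]) (use S in \<open>auto simp: S_def\<close>)
  have "(\<Sum>\<mu>\<in>S. scale_symf (c \<mu> - d \<mu>) (power_sum_part \<mu>)) = 0"
    using c d' by (simp add: symf.scale_left_diff_distrib sum_subtractf)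
  then have "c \<mu> - d \<mu> = 0" if "\<mu> \<in> S" for \<mu>
    using power_sum_part_independent[OF S, of "\<lambda>\<mu>. c \<mu> - d \<mu>"] that by blast
  then have "d \<mu> = c \<mu>" for \<mu>
    by (cases "\<mu> \<in> S") (force simp: S_def)+
  then show "d = c" by blast
qed (use assms in auto)

lemma power_sum_coeffs_props:
  fixes f :: "'a :: field_char_0 symf"
  shows finite_power_sum_coeffs: "finite {\<mu>. power_sum_coeffs f \<mu> \<noteq> 0}"
    and power_sum_coeffs_partition: "\<And>\<mu>. power_sum_coeffs f \<mu> \<noteq> 0 \<Longrightarrow> is_partition \<mu>"
    and power_sum_expansion: "(\<Sum>\<mu> | power_sum_coeffs f \<mu> \<noteq> 0. scale_symf (power_sum_coeffs f \<mu>) (power_sum_part \<mu>)) = f"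
proof -
  obtain c where c: "finite {\<mu>. c \<mu> \<noteq> 0}" "\<And>\<mu>. c \<mu> \<noteq> 0 \<Longrightarrow> is_partition \<mu>"
    "f = (\<Sum>\<mu> | c \<mu> \<noteq> 0. scale_symf (c \<mu>) (power_sum_part \<mu>))"
    using power_sum_expansion_exists[of "\<lambda>_. True" f] by auto
  then have e: "power_sum_coeffs f = c" by (rule power_sum_coeffs_unique)
  show "finite {\<mu>. power_sum_coeffs f \<mu> \<noteq> 0}"
    "\<And>\<mu>. power_sum_coeffs f \<mu> \<noteq> 0 \<Longrightarrow> is_partition \<mu>"
    "(\<Sum>\<mu> | power_sum_coeffs f \<mu> \<noteq> 0. scale_symf (power_sum_coeffs f \<mu>) (power_sum_part \<mu>)) = f"
    unfolding e using c by auto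
qed

lemma power_sum_coeffs_sum:
  fixes c :: "nat list \<Rightarrow> 'a :: field_char_0"
  assumes "finite S" "\<And>\<mu>. \<mu> \<in> S \<Longrightarrow> is_partition \<mu>"
  shows "power_sum_coeffs (\<Sum>\<mu>\<in>S. scale_symf (c \<mu>) (power_sum_part \<mu>)) = (\<lambda>\<mu>. if \<mu> \<in> S then c \<mu> else 0)"
proof (rule power_sum_coeffs_unique)
  let ?c = "\<lambda>\<mu>. if \<mu> \<in> S then c \<mu> else 0"
  show "finite {\<mu>. ?c \<mu> \<noteq> 0}" using assms by (auto intro: finite_subset)
  show "(\<Sum>\<mu>\<in>S. scale_symf (c \<mu>) (power_sum_part \<mu>)) =
      (\<Sum>\<mu> | ?c \<mu> \<noteq> 0. scale_symf (?c \<mu>) (power_sum_part \<mu>))"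
    by (rule sum.mono_neutral_cong_right) (use assms in auto)
qed (use assms in \<open>auto split: if_splits\<close>)

lemma power_sum_expansion_superset:
  fixes f :: "'a :: field_char_0 symf"
  assumes "finite S" "{\<mu>. power_sum_coeffs f \<mu> \<noteq> 0} \<subseteq> S"
  shows "f = (\<Sum>\<mu>\<in>S. scale_symf (power_sum_coeffs f \<mu>) (power_sum_part \<mu>))"
  by (subst power_sum_expansion[symmetric], rule sum.mono_neutral_left) (use assms in auto)

lemma power_sum_coeffs_add:
  "power_sum_coeffs (f + g) \<mu> = power_sum_coeffs f \<mu> + power_sum_coeffs (g :: 'a :: field_char_0 symf) \<mu>"
proof -
  define S where "S = {\<mu>. power_sum_coeffs f \<mu> \<noteq> 0} \<union> {\<mu>. power_sum_coeffs g \<mu> \<noteq> 0}"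
  have S: "finite S" "\<And>\<mu>. \<mu> \<in> S \<Longrightarrow> is_partition \<mu>"
    using finite_power_sum_coeffs power_sum_coeffs_partition by (auto simp: S_def)
  have "f + g = (\<Sum>\<mu>\<in>S. scale_symf (power_sum_coeffs f \<mu> + power_sum_coeffs g \<mu>) (power_sum_part \<mu>))"
    using power_sum_expansion_superset[OF S(1), of f] power_sum_expansion_superset[OF S(1), of g]
    by (simp add: S_def symf.scale_left_distrib sum.distrib)
  then show ?thesis
    using power_sum_coeffs_sum[OF S, of "\<lambda>\<mu>. power_sum_coeffs f \<mu> + power_sum_coeffs g \<mu>"]
    by (auto simp: S_def)
qed

lemma power_sum_coeffs_scale:
  "power_sum_coeffs (scale_symf a f) \<mu> = a * power_sum_coeffs (f :: 'a :: field_char_0 symf) \<mu>"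
proof -
  define S where "S = {\<mu>. power_sum_coeffs f \<mu> \<noteq> 0}"
  have S: "finite S" "\<And>\<mu>. \<mu> \<in> S \<Longrightarrow> is_partition \<mu>"
    using finite_power_sum_coeffs power_sum_coeffs_partition by (auto simp: S_def)
  have "scale_symf a f = (\<Sum>\<mu>\<in>S. scale_symf (a * power_sum_coeffs f \<mu>) (power_sum_part \<mu>))"
    using arg_cong[OF power_sum_expansion_superset[OF S(1), of f], of "scale_symf a"]
    by (simp add: S_def scale_symf_sum_right)
  then show ?thesis
    using power_sum_coeffs_sum[OF S, of "\<lambda>\<mu>. a * power_sum_coeffs f \<mu>"]
    by (auto simp: S_def)
qed

lemma power_sum_coeffs_part:
  assumes "is_partition \<nu>"
  shows "power_sum_coeffs (power_sum_part \<nu> :: 'a :: field_char_0 symf) \<mu> = (if \<mu> = \<nu> then 1 else 0)"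
  using power_sum_coeffs_sum[of "{\<nu>}" "\<lambda>_. 1 :: 'a"] assms by (simp add: scale_symf_def)

lemma power_sum_part_sort:
  assumes "0 \<notin> set \<mu>"
  shows "power_sum_part \<mu> = power_sum_part (sort_part (mset \<mu>))"
proof (rule power_sum_part_perm)
  have "filter_mset (\<lambda>k. k \<noteq> 0) (mset \<mu>) = mset \<mu>"
    using assms by (auto simp: filter_mset_eq_conv intro!: gr0I)
  then show "mset \<mu> = mset (sort_part (mset \<mu>))" by (simp only: mset_sort_part)
qed

lemma symf_induct [case_names const power_sum add mult]:
  fixes f :: "'a :: field_char_0 symf"
  assumes "\<And>c. P (const_symf c)" "\<And>k. k > 0 \<Longrightarrow> P (power_sum k)"
    and add: "\<And>f g. P f \<Longrightarrow> P g \<Longrightarrow> P (f + g)" and mult: "\<And>f g. P f \<Longrightarrow> P g \<Longrightarrow> P (f * g)"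
  shows "P f"
proof -
  have part: "P (power_sum_part \<mu>)" if "0 \<notin> set \<mu>" for \<mu>
    using that
  proof (induction \<mu>)
    case Nil
    then show ?case using assms(1)[of 1] by simp
  next
    case (Cons k \<mu>)
    then show ?case by (auto intro!: mult assms(2))
  qed
  have 0: "P 0" using assms(1)[of 0] by simp
  have "P (\<Sum>\<mu>\<in>S. scale_symf (c \<mu>) (power_sum_part \<mu>))"
    if "finite S" "\<And>\<mu>. \<mu> \<in> S \<Longrightarrow> is_partition \<mu>" for S and c :: "nat list \<Rightarrow> 'a"
    using that
    by (induction S rule: finite_induct)
       (auto simp: scale_symf_def 0 is_partition_def intro!: add mult assms(1) part)
  then have "P (\<Sum>\<mu> | power_sum_coeffs f \<mu> \<noteq> 0. scale_symf (power_sum_coeffs f \<mu>) (power_sum_part \<mu>))"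
    using finite_power_sum_coeffs power_sum_coeffs_partition by blast
  then show ?thesis by (simp only: power_sum_expansion)
qed


subsection \<open>Homomorphisms out of the ring of symmetric functions\<close>

text \<open>For a homomorphism \<iota>, this is the ring homomorphism that acts on constants by
  \<iota> and sends p_k to \<open>v k\<close>. Plethysm, \<open>trans\<close>,
  \<open>dilate\<close>, the principal specialization and the evaluation in one variable are all
  instances, so that equalities between them reduce to the p_k.\<close>

definition psub :: "('a :: field_char_0 \<Rightarrow> 'b :: comm_ring_1) \<Rightarrow> (nat \<Rightarrow> 'b) \<Rightarrow> 'a symf \<Rightarrow> 'b" where
  "psub \<iota> v f = (\<Sum>\<mu> | power_sum_coeffs f \<mu> \<noteq> 0. \<iota> (power_sum_coeffs f \<mu>) * prod_list (map v \<mu>))"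

lemma comm_ring_homI:
  assumes "h 1 = 1" "\<And>x y. h (x + y) = h x + h y" "\<And>x y. h (x * y) = h x * h y"
  shows "comm_ring_hom (h :: 'a :: comm_ring_1 \<Rightarrow> 'b :: comm_ring_1)"
proof -
  have "h 0 + h 0 = h 0 + 0" using assms(2)[of 0 0] by simp
  then have "h 0 = 0" by (simp only: add_left_cancel)
  then show ?thesis using assms by unfold_locales auto
qed

lemma comm_ring_hom_const_symf: "comm_ring_hom const_symf"
  by (rule comm_ring_homI) (auto simp: const_symf_add const_symf_mult)

lemma comm_ring_hom_const_poly: "comm_ring_hom (\<lambda>c :: 'a :: comm_ring_1. [:c:])"
  by (rule comm_ring_homI) (auto simp: one_pCons)

lemma comm_ring_hom_comp:
  assumes "comm_ring_hom f" "comm_ring_hom g"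
  shows "comm_ring_hom (\<lambda>x. f (g x))"
proof -
  interpret f: comm_ring_hom f by fact
  interpret g: comm_ring_hom g by fact
  show ?thesis by (rule comm_ring_homI) (auto simp: f.hom_add f.hom_mult g.hom_add g.hom_mult)
qed

lemma comm_ring_hom_ident: "comm_ring_hom (\<lambda>x. x)"
  by (rule comm_ring_homI) auto

lemma psub_superset:
  assumes "comm_ring_hom \<iota>" "finite S" "{\<mu>. power_sum_coeffs f \<mu> \<noteq> 0} \<subseteq> S"
  shows "psub \<iota> v f = (\<Sum>\<mu>\<in>S. \<iota> (power_sum_coeffs f \<mu>) * prod_list (map v \<mu>))"
proof -
  interpret comm_ring_hom \<iota> by fact
  show ?thesis unfolding psub_def
    by (rule sum.mono_neutral_left) (use assms in auto)
qed

lemma psub_add: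
  assumes "comm_ring_hom \<iota>"
  shows "psub \<iota> v (f + g) = psub \<iota> v f + psub \<iota> v g"
proof -
  interpret comm_ring_hom \<iota> by fact
  define S where "S = {\<mu>. power_sum_coeffs f \<mu> \<noteq> 0} \<union> {\<mu>. power_sum_coeffs g \<mu> \<noteq> 0}"
  have "finite S" using finite_power_sum_coeffs by (auto simp: S_def)
  note * = psub_superset[OF assms this, where v = v]
  have "{\<mu>. power_sum_coeffs (f + g) \<mu> \<noteq> 0} \<subseteq> S"
    by (auto simp: S_def power_sum_coeffs_add)
  then have "psub \<iota> v (f + g) = (\<Sum>\<mu>\<in>S. \<iota> (power_sum_coeffs (f + g) \<mu>) * prod_list (map v \<mu>))"
    by (rule *)
  also have "\<dots> = psub \<iota> v f + psub \<iota> v g"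
    using *[of f] *[of g]
    by (simp add: S_def power_sum_coeffs_add hom_add distrib_right sum.distrib)
  finally show ?thesis .
qed

lemma psub_0 [simp]: "psub \<iota> v (0 :: 'a :: field_char_0 symf) = 0"
  using power_sum_coeffs_sum[of "{}" "\<lambda>_. 0 :: 'a :: field_char_0"] by (simp add: psub_def)

lemma psub_sum:
  assumes "comm_ring_hom \<iota>"
  shows "psub \<iota> v (sum f A) = (\<Sum>x\<in>A. psub \<iota> v (f x))"
  by (induction A rule: infinite_finite_induct) (auto simp: psub_add[OF assms])

text \<open>Stated for unsorted lists, so that products, where the parts are merely concatenated,
  can be evaluated directly.\<close>

lemma psub_scale_part:
  assumes "comm_ring_hom \<iota>" "0 \<notin> set \<mu>"
  shows "psub \<iota> v (scale_symf c (power_sum_part \<mu>)) = \<iota> c * prod_list (map v \<mu>)"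
proof -
  interpret comm_ring_hom \<iota> by fact
  define \<nu> where "\<nu> = sort_part (mset \<mu>)"
  have nu: "is_partition \<nu>" by (simp add: \<nu>_def)
  have "power_sum_coeffs (scale_symf c (power_sum_part \<nu>)) = (\<lambda>\<kappa>. if \<kappa> \<in> {\<nu>} then c else 0)"
    using power_sum_coeffs_sum[of "{\<nu>}" "\<lambda>_. c"] nu by simp
  then have "psub \<iota> v (scale_symf c (power_sum_part \<nu>)) = \<iota> c * prod_list (map v \<nu>)"
    by (subst psub_superset[OF assms(1), of "{\<nu>}"]) auto
  also have "power_sum_part \<nu> = power_sum_part \<mu>"
    unfolding \<nu>_def by (rule power_sum_part_sort[symmetric]) fact
  also have "mset \<nu> = mset \<mu>"
    using assms(2) by (auto simp: \<nu>_def mset_sort_part filter_mset_eq_conv intro!: gr0I)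
  then have "prod_list (map v \<nu>) = prod_list (map v \<mu>)"
    by (metis mset_map prod_mset_prod_list)
  finally show ?thesis .
qed

lemma psub_mult:
  assumes "comm_ring_hom \<iota>"
  shows "psub \<iota> v (f * g) = psub \<iota> v f * psub \<iota> v g"
proof -
  interpret comm_ring_hom \<iota> by fact
  let ?c = power_sum_coeffs
  define S where "S = (\<lambda>f :: 'a symf. {\<mu>. ?c f \<mu> \<noteq> 0})"
  have nz: "0 \<notin> set \<mu>" if "\<mu> \<in> S f" for \<mu> f
    using that power_sum_coeffs_partition by (auto simp: S_def is_partition_def)
  have "f * g = (\<Sum>\<mu>\<in>S f. scale_symf (?c f \<mu>) (power_sum_part \<mu>)) *
      (\<Sum>\<nu>\<in>S g. scale_symf (?c g \<nu>) (power_sum_part \<nu>))"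
    by (simp only: S_def power_sum_expansion)
  also have "\<dots> = (\<Sum>\<mu>\<in>S f. \<Sum>\<nu>\<in>S g. scale_symf (?c f \<mu> * ?c g \<nu>) (power_sum_part (\<mu> @ \<nu>)))"
    by (simp add: sum_product scale_symf_mult_left scale_symf_mult_right power_sum_part_append mult.commute)
  finally have "psub \<iota> v (f * g) = (\<Sum>\<mu>\<in>S f. \<Sum>\<nu>\<in>S g. \<iota> (?c f \<mu> * ?c g \<nu>) * prod_list (map v (\<mu> @ \<nu>)))"
    by (simp only: psub_sum[OF assms], intro sum.cong refl psub_scale_part[OF assms])
       (use nz in auto)
  also have "\<dots> = psub \<iota> v f * psub \<iota> v g"
    by (simp add: psub_def S_def sum_product hom_mult mult_ac)
  finally show ?thesis .
qed

lemma psub_const: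
  assumes "comm_ring_hom \<iota>"
  shows "psub \<iota> v (const_symf c) = \<iota> c"
  using psub_scale_part[OF assms, of "[]" v c] by (simp add: scale_symf_def)

lemma psub_power_sum:
  assumes "comm_ring_hom \<iota>" "k > 0"
  shows "psub \<iota> v (power_sum k) = v k"
proof -
  interpret comm_ring_hom \<iota> by fact
  show ?thesis using psub_scale_part[OF assms(1), of "[k]" v 1] assms(2) by simp
qed

lemma psub_hom: "comm_ring_hom \<iota> \<Longrightarrow> comm_ring_hom (psub \<iota> v)"
proof (rule comm_ring_homI)
  assume \<iota>: "comm_ring_hom \<iota>"
  interpret comm_ring_hom \<iota> by fact
  show "psub \<iota> v 1 = 1" using psub_const[OF \<iota>, of v 1] by simp
qed (auto simp: psub_add psub_mult)

lemma symf_hom_eqI: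
  fixes f :: "'a :: field_char_0 symf"
  assumes "comm_ring_hom \<phi>" "comm_ring_hom \<psi>"
    and "\<And>c. \<phi> (const_symf c) = \<psi> (const_symf c)" "\<And>k. k > 0 \<Longrightarrow> \<phi> (power_sum k) = \<psi> (power_sum k)"
  shows "\<phi> f = \<psi> f"
proof -
  interpret p: comm_ring_hom \<phi> by fact
  interpret s: comm_ring_hom \<psi> by fact
  show ?thesis
    by (induction f rule: symf_induct) (auto simp: assms p.hom_add s.hom_add p.hom_mult s.hom_mult)
qed

subsection \<open>Newton's identities\<close>

no_notation vec_index (infixl "$" 100)
notation fps_nth (infixl "$" 75)

text \<open>Newton's recursion determines a sequence after division by n. This has to work with
  values in rings of symmetric functions and in polynomials over them, which are not fields.\<close>

class q_algebra = comm_ring_1 +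
  assumes of_nat_invertible: "n > 0 \<Longrightarrow> \<exists>u. u * of_nat n = 1"

instance field_char_0 \<subseteq> q_algebra
proof
  fix n :: nat assume "n > 0"
  then show "\<exists>u. u * of_nat n = (1 :: 'a)" by (intro exI[of _ "inverse (of_nat n)"]) simp
qed

instance symf :: (q_algebra) q_algebra
proof
  fix n :: nat assume "n > 0"
  then obtain u where "u * of_nat n = (1 :: 'a)" using of_nat_invertible by blast
  then have "const_symf u * of_nat n = 1"
    by (metis const_symf_mult const_symf_of_nat const_symf_1)
  then show "\<exists>u. u * of_nat n = (1 :: 'a symf)" by blast
qed

instance poly :: (q_algebra) q_algebra
proof
  fix n :: nat assume "n > 0"
  then obtain u where "u * of_nat n = (1 :: 'a)" using of_nat_invertible by blast
  then have "[:u:] * of_nat n = 1" by (simp add: of_nat_poly one_pCons mult.commute)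
  then show "\<exists>u. u * of_nat n = (1 :: 'a poly)" by blast
qed

lemma of_nat_cancel_left:
  assumes "of_nat n * a = of_nat n * (b :: 'a :: q_algebra)" "n > 0"
  shows "a = b"
proof -
  obtain u :: 'a where "u * of_nat n = 1" using of_nat_invertible assms(2) by blast
  then show ?thesis using assms(1) by (metis mult.assoc mult_1)
qed

text \<open>Says that A(z) = exp(\<Sum> v_k z^k / k): A is the generating series of the h_n of an
  alphabet with power sums v_k. The differential form avoids the division by k. Adding alphabets
  multiplies the series (\<open>newton_mult\<close>), scaling an alphabet by x rescales z
  (\<open>newton_scale\<close>).\<close>

definition newton :: "(nat \<Rightarrow> 'a :: comm_ring_1) \<Rightarrow> 'a fps \<Rightarrow> bool" where
  "newton v A \<longleftrightarrow> A $ 0 = 1 \<and> fps_X * fps_deriv A = Abs_fps (\<lambda>k. if k = 0 then 0 else v k) * A"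

lemma newton_iff:
  "newton v A \<longleftrightarrow> A $ 0 = 1 \<and> (\<forall>n. of_nat n * A $ n = (\<Sum>k=1..n. v k * A $ (n - k)))"
proof -
  have "(fps_X * fps_deriv A) $ n = of_nat n * A $ n" for n
    by (cases n) auto
  moreover have "(Abs_fps (\<lambda>k. if k = 0 then 0 else v k) * A) $ n = (\<Sum>k=1..n. v k * A $ (n - k))" for n
    unfolding fps_mult_nth by (rule sum.mono_neutral_cong_right) auto
  ultimately show ?thesis by (simp add: newton_def fps_eq_iff)
qed

lemma newton_cong: "newton v A \<Longrightarrow> (\<And>k. k > 0 \<Longrightarrow> v k = v' k) \<Longrightarrow> newton v' A"
  unfolding newton_iff by (auto intro!: sum.cong)

lemma newton_unique:
  assumes "newton v A" "newton v B"
  shows "A = (B :: 'a :: q_algebra fps)"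
proof (rule fps_ext)
  fix n show "A $ n = B $ n"
  proof (induction n rule: less_induct)
    case (less n)
    show ?case
    proof (cases "n = 0")
      case False
      have "(\<Sum>k=1..n. v k * A $ (n - k)) = (\<Sum>k=1..n. v k * B $ (n - k))"
        by (intro sum.cong refl) (use less in auto)
      moreover have "of_nat n * A $ n = (\<Sum>k=1..n. v k * A $ (n - k))"
        "of_nat n * B $ n = (\<Sum>k=1..n. v k * B $ (n - k))"
        using assms unfolding newton_iff by blast+
      ultimately have "of_nat n * A $ n = of_nat n * B $ n" by (simp only:)
      then show ?thesis using of_nat_cancel_left[of n "A $ n" "B $ n"] False by blast
    qed (use assms in \<open>auto simp: newton_iff\<close>)
  qed
qed

lemma newton_one: "newton (\<lambda>_. 0) 1"
  by (simp add: newton_def fps_eq_iff)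

lemma newton_mult:
  assumes "newton v A" "newton u B"
  shows "newton (\<lambda>k. v k + u k) (A * B)"
proof -
  define V U where "V = Abs_fps (\<lambda>k. if k = 0 then 0 else v k)"
    and "U = Abs_fps (\<lambda>k. if k = 0 then 0 else u k)"
  have VU: "Abs_fps (\<lambda>k. if k = 0 then 0 else v k + u k) = V + U"
    by (simp add: fps_eq_iff V_def U_def)
  have "fps_X * fps_deriv (A * B) = (fps_X * fps_deriv A) * B + A * (fps_X * fps_deriv B)"
    by (simp add: algebra_simps)
  also have "\<dots> = (V + U) * (A * B)"
    using assms by (simp add: newton_def algebra_simps flip: V_def U_def)
  finally show ?thesis
    using assms by (simp add: newton_def VU)
qed

lemma newton_geometric: "newton (\<lambda>k. x ^ k) (Abs_fps (\<lambda>n. x ^ n))"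
  by (auto simp: newton_iff simp flip: power_add)

lemma newton_linear: "newton (\<lambda>k. - (x ^ k)) (1 - fps_const x * fps_X)"
proof -
  have "(\<Sum>k=1..n. - (x ^ k) * (1 - fps_const x * fps_X) $ (n - k)) =
      of_nat n * (1 - fps_const x * fps_X) $ n" for n
  proof (cases "n \<le> 1")
    case True
    then have "n = 0 \<or> n = 1" by auto
    then show ?thesis by auto
  next
    case False
    then obtain m where n: "n = Suc (Suc m)" by (metis One_nat_def Suc_le_D not_less_eq_eq)
    have "(\<Sum>k=1..n. - (x ^ k) * (1 - fps_const x * fps_X) $ (n - k)) =
        (\<Sum>k\<in>{n - 1, n}. - (x ^ k) * (1 - fps_const x * fps_X) $ (n - k))"
      by (rule sum.mono_neutral_right) (auto simp: n)
    then show ?thesis by (simp add: n)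
  qed
  then show ?thesis by (simp add: newton_iff)
qed

lemma newton_scale:
  assumes "newton v A"
  shows "newton (\<lambda>k. x ^ k * v k) (Abs_fps (\<lambda>n. x ^ n * A $ n))"
  unfolding newton_iff
proof (intro conjI allI)
  fix n
  have "(\<Sum>k=1..n. x ^ k * v k * (x ^ (n - k) * A $ (n - k))) = (\<Sum>k=1..n. x ^ n * (v k * A $ (n - k)))"
    by (intro sum.cong refl) (auto simp: mult_ac simp flip: power_add mult.assoc[of "x ^ _" "x ^ _"])
  also have "\<dots> = x ^ n * (of_nat n * A $ n)"
    using assms by (simp add: newton_iff sum_distrib_left)
  finally show "of_nat n * Abs_fps (\<lambda>n. x ^ n * A $ n) $ n =
      (\<Sum>k=1..n. x ^ k * v k * Abs_fps (\<lambda>n. x ^ n * A $ n) $ (n - k))"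
    by (simp add: mult_ac)
qed (use assms in \<open>auto simp: newton_iff\<close>)

lemma newton_hom:
  assumes "comm_ring_hom \<phi>" "newton v A"
  shows "newton (\<lambda>k. \<phi> (v k)) (Abs_fps (\<lambda>n. \<phi> (A $ n)))"
proof -
  interpret comm_ring_hom \<phi> by fact
  have "of_nat n * \<phi> (A $ n) = (\<Sum>k=1..n. \<phi> (v k) * \<phi> (A $ (n - k)))" for n
  proof -
    have "of_nat n * \<phi> (A $ n) = \<phi> (of_nat n * A $ n)" by (simp add: hom_mult hom_of_nat)
    also have "\<dots> = \<phi> (\<Sum>k=1..n. v k * A $ (n - k))" using assms(2) by (simp add: newton_iff)
    finally show ?thesis by (simp add: hom_sum hom_mult)
  qed
  then show ?thesis using assms(2) by (simp add: newton_iff)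
qed

text \<open>At a monomial of degree n the right side counts the pairs of a variable and an exponent
  k between 1 and its multiplicity; there are n of them.\<close>

lemma newton_complete_sym: "newton power_sum (Abs_fps complete_sym)"
  unfolding newton_iff
proof (intro conjI allI)
  show "Abs_fps complete_sym $ 0 = (1 :: 'a symf)"
    by (intro symf_eqI) (simp add: complete_sym.rep_eq coeff_symf_one)
  fix n
  show "of_nat n * Abs_fps complete_sym $ n =
      (\<Sum>k=1..n. power_sum k * Abs_fps complete_sym $ (n - k) :: 'a symf)"
  proof (rule symf_eqI)
    fix m :: "nat multiset"
    have sub: "size (m - replicate_mset k i) = size m - k" if "k \<le> count m i" for k i
      using that by (subst size_Diff_submset) (auto simp: subseteq_mset_def)
    have le: "count m i \<le> size m" for i by (rule count_le_size)
    have "coeff_symf (\<Sum>k=1..n. power_sum k * Abs_fps complete_sym $ (n - k) :: 'a symf) m =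
      (\<Sum>k=1..n. \<Sum>i\<in>{i \<in> set_mset m. k \<le> count m i}. if size m = n then 1 else 0)"
      unfolding coeff_symf_sum fps_nth_Abs_fps
    proof (intro sum.cong refl, subst coeff_power_sum_times)
      fix k assume k: "k \<in> {1..n}"
      have "size (m - replicate_mset k i) = n - k \<longleftrightarrow> size m = n" if "k \<le> count m i" for i
        using that sub[OF that] le[of i] k by auto
      then show "(\<Sum>i\<in>{i \<in> set_mset m. k \<le> count m i}. coeff_symf (complete_sym (n - k)) (m - replicate_mset k i)) =
         (\<Sum>i\<in>{i \<in> set_mset m. k \<le> count m i}. if size m = n then 1 else 0 :: 'a)"
        by (intro sum.cong refl) (auto simp: complete_sym.rep_eq)
    qed auto
    also have "\<dots> = (\<Sum>k=1..n. \<Sum>i\<in>set_mset m. if k \<le> count m i then (if size m = n then 1 else 0) else 0)"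
      by (intro sum.cong refl sum.inter_filter) auto
    also have "\<dots> = (\<Sum>i\<in>set_mset m. \<Sum>k=1..n. if k \<le> count m i then (if size m = n then 1 else 0) else 0)"
      by (rule sum.swap)
    also have "\<dots> = (\<Sum>i\<in>set_mset m. if size m = n then of_nat (count m i) else 0)"
    proof (intro sum.cong refl)
      fix i
      show "(\<Sum>k=1..n. if k \<le> count m i then (if size m = n then 1 else 0) else 0) =
         (if size m = n then of_nat (count m i) else 0 :: 'a)"
      proof (cases "size m = n")
        case True
        have "(\<Sum>k=1..n. if k \<le> count m i then 1 else 0 :: 'a) = (\<Sum>k\<in>{1..count m i}. 1)"
          by (rule sum.mono_neutral_cong_right) (use le[of i] True in auto)
        then show ?thesis using True by simp
      qed auto
    qed
    also have "\<dots> = (if size m = n then of_nat n else 0)"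
      by (auto simp: size_multiset_overloaded_eq simp flip: of_nat_sum)
    also have "\<dots> = coeff_symf (of_nat n * Abs_fps complete_sym $ n) m"
      by (simp add: coeff_const_times complete_sym.rep_eq flip: const_symf_of_nat)
    finally show "coeff_symf (of_nat n * Abs_fps complete_sym $ n) m =
       coeff_symf (\<Sum>k=1..n. power_sum k * Abs_fps complete_sym $ (n - k) :: 'a symf) m" ..
  qed
qed

text \<open>For a variable of multiplicity c only k = c and k = c - 1 can contribute, with opposite
  signs. They cancel unless c = 1, where k = 0 is out of range. What remains counts the variables of
  a squarefree monomial.\<close>

lemma newton_elem_sym: "newton (\<lambda>k. - ((- 1) ^ k * power_sum k)) (Abs_fps elem_sym)"
  unfolding newton_iff
proof (intro conjI allI)
  show "Abs_fps elem_sym $ 0 = (1 :: 'a symf)"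
    by (intro symf_eqI) (auto simp: elem_sym.rep_eq coeff_symf_one)
  fix n
  show "of_nat n * Abs_fps elem_sym $ n =
      (\<Sum>k=1..n. - ((- 1) ^ k * power_sum k) * Abs_fps elem_sym $ (n - k) :: 'a symf)"
  proof (rule symf_eqI)
    fix m :: "nat multiset"
    define others where "others = (\<lambda>i. \<forall>j. j \<noteq> i \<longrightarrow> count m j \<le> 1)"
    have sub: "size (m - replicate_mset k i) = size m - k" if "k \<le> count m i" for k i
      using that by (subst size_Diff_submset) (auto simp: subseteq_mset_def)
    have le: "count m i \<le> size m" for i by (rule count_le_size)
    have sgn: "- ((- 1) ^ k * f) = scale_symf (- ((- 1) ^ k)) f" for k and f :: "'a symf"
      by (simp add: scale_symf_def const_symf_minus const_symf_power)
    have "coeff_symf (\<Sum>k=1..n. - ((- 1) ^ k * power_sum k) * Abs_fps elem_sym $ (n - k) :: 'a symf) m =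
      (\<Sum>k=1..n. \<Sum>i\<in>{i \<in> set_mset m. k \<le> count m i}.
        if size m = n \<and> others i \<and> count m i \<le> k + 1 then - ((- 1) ^ k) else 0)"
      unfolding coeff_symf_sum fps_nth_Abs_fps sgn scale_symf_mult_left coeff_symf_scale
    proof (intro sum.cong refl, subst coeff_power_sum_times)
      fix k assume k: "k \<in> {1..n}"
      have "size (m - replicate_mset k i) = n - k \<longleftrightarrow> size m = n" if "k \<le> count m i" for i
        using that sub[OF that] le[of i] k by auto
      moreover have "(\<forall>j. count (m - replicate_mset k i) j \<le> 1) \<longleftrightarrow> others i \<and> count m i \<le> k + 1" for i
        by (auto simp: others_def)
      ultimately show "- ((- 1) ^ k) * (\<Sum>i\<in>{i \<in> set_mset m. k \<le> count m i}. coeff_symf (elem_sym (n - k)) (m - replicate_mset k i)) =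
         (\<Sum>i\<in>{i \<in> set_mset m. k \<le> count m i}. if size m = n \<and> others i \<and> count m i \<le> k + 1 then - ((- 1) ^ k) else 0 :: 'a)"
        unfolding sum_distrib_left by (intro sum.cong refl) (auto simp: elem_sym.rep_eq)
    qed auto
    also have "\<dots> = (\<Sum>k=1..n. \<Sum>i\<in>set_mset m. if k \<le> count m i then
        (if size m = n \<and> others i \<and> count m i \<le> k + 1 then - ((- 1) ^ k) else 0) else 0)"
      by (intro sum.cong refl sum.inter_filter) auto
    also have "\<dots> = (\<Sum>i\<in>set_mset m. \<Sum>k=1..n. if k \<le> count m i then
        (if size m = n \<and> others i \<and> count m i \<le> k + 1 then - ((- 1) ^ k) else 0) else 0)"
      by (rule sum.swap)
    also have "\<dots> = (\<Sum>i\<in>set_mset m. if size m = n \<and> others i \<and> count m i = 1 then 1 else 0)"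
    proof (intro sum.cong refl)
      fix i assume i: "i \<in># m"
      show "(\<Sum>k=1..n. if k \<le> count m i then
          (if size m = n \<and> others i \<and> count m i \<le> k + 1 then - ((- 1) ^ k) else 0) else 0) =
         (if size m = n \<and> others i \<and> count m i = 1 then 1 else 0 :: 'a)"
      proof (cases "size m = n \<and> others i")
        case True
        have "count m i > 0" using i by simp
        define c where "c = count m i"
        have c: "c > 0" "c \<le> n" using i le[of i] True by (auto simp: c_def)
        have "(\<Sum>k=1..n. if k \<le> c then (if c \<le> k + 1 then - ((- 1) ^ k) else 0) else 0) =
            (\<Sum>k\<in>{1..n} \<inter> {c - 1, c}. - ((- 1) ^ k) :: 'a)"
          by (rule sum.mono_neutral_cong_right) auto
        also have "\<dots> = (if c = 1 then 1 else 0)"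
        proof (cases "c = 1")
          case True
          then have "{1..n} \<inter> {c - 1, c} = {1}" using c by auto
          then show ?thesis using True by simp
        next
          case False
          then obtain d where d: "c = Suc (Suc d)" using c
            by (cases c; cases "c - 1") auto
          then have "{1..n} \<inter> {c - 1, c} = {Suc d, Suc (Suc d)}" using c by auto
          then show ?thesis using d by simp
        qed
        finally show ?thesis unfolding c_def using True by (simp cong: if_cong)
      next
        case False
        then have "(\<Sum>k=1..n. if k \<le> count m i then
            (if size m = n \<and> others i \<and> count m i \<le> k + 1 then - ((- 1) ^ k) else 0) else 0) = (0 :: 'a)"
          by (intro sum.neutral) auto
        then show ?thesis using False by auto
      qed
    qed
    also have "\<dots> = (if size m = n \<and> (\<forall>i. count m i \<le> 1) then of_nat n else 0)"
    proof (cases "size m = n \<and> (\<forall>i. count m i \<le> 1)")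
      case True
      have c1: "count m i = 1" if "i \<in># m" for i
        using that spec[OF conjunct2[OF True], of i] by (simp add: le_antisym Suc_le_eq)
      have "(\<Sum>i\<in>set_mset m. if size m = n \<and> others i \<and> count m i = 1 then 1 else 0 :: 'a) =
          (\<Sum>i\<in>set_mset m. of_nat (count m i))"
        by (intro sum.cong refl) (use True c1 in \<open>auto simp: others_def\<close>)
      then show ?thesis using True by (auto simp: size_multiset_overloaded_eq simp flip: of_nat_sum)
    next
      case False
      have "\<not> (size m = n \<and> others i \<and> count m i = 1)" for i
        using False unfolding others_def by (metis le_refl)
      then have "(\<Sum>i\<in>set_mset m. if size m = n \<and> others i \<and> count m i = 1 then 1 else 0 :: 'a) = 0"
        by (intro sum.neutral) (simp only: if_False simp_thms, blast)
      then show ?thesis using False by (simp only: if_False)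
    qed
    also have "\<dots> = coeff_symf (of_nat n * Abs_fps elem_sym $ n) m"
      by (auto simp: coeff_const_times elem_sym.rep_eq simp flip: const_symf_of_nat)
    finally show "coeff_symf (of_nat n * Abs_fps elem_sym $ n) m =
       coeff_symf (\<Sum>k=1..n. - ((- 1) ^ k * power_sum k) * Abs_fps elem_sym $ (n - k) :: 'a symf) m" ..
  qed
qed

section \<open>Images of complete and elementary functions, computed from images of power
  sums\<close>

lemma hom_complete_sym:
  fixes \<phi> :: "'a :: field_char_0 symf \<Rightarrow> 'b :: q_algebra"
  assumes "comm_ring_hom \<phi>" "newton v A" "\<And>k. k > 0 \<Longrightarrow> \<phi> (power_sum k) = v k"
  shows "\<phi> (complete_sym n) = A $ n"
proof -
  have "newton v (Abs_fps (\<lambda>n. \<phi> (complete_sym n)))"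
    using newton_cong[OF newton_hom[OF assms(1) newton_complete_sym], of v] assms(3) by simp
  then have "Abs_fps (\<lambda>n. \<phi> (complete_sym n)) = A" using assms(2) by (rule newton_unique)
  then show ?thesis by (metis fps_nth_Abs_fps)
qed

lemma hom_elem_sym:
  fixes \<phi> :: "'a :: field_char_0 symf \<Rightarrow> 'b :: q_algebra"
  assumes "comm_ring_hom \<phi>" "newton v A" "\<And>k. k > 0 \<Longrightarrow> - ((- 1) ^ k * \<phi> (power_sum k)) = v k"
  shows "\<phi> (elem_sym n) = A $ n"
proof -
  interpret comm_ring_hom \<phi> by fact
  have "newton v (Abs_fps (\<lambda>n. \<phi> (elem_sym n)))"
    using newton_cong[OF newton_hom[OF assms(1) newton_elem_sym], of v] assms(3)
    by (simp add: hom_mult hom_power hom_uminus)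
  then have "Abs_fps (\<lambda>n. \<phi> (elem_sym n)) = A" using assms(2) by (rule newton_unique)
  then show ?thesis by (metis fps_nth_Abs_fps)
qed

lemma complete_sym_0 [simp]: "complete_sym 0 = (1 :: 'a :: comm_ring_1 symf)"
  using newton_complete_sym[where 'a = 'a] by (simp add: newton_iff)

lemma elem_sym_0 [simp]: "elem_sym 0 = (1 :: 'a :: comm_ring_1 symf)"
  using newton_elem_sym[where 'a = 'a] by (simp add: newton_iff)

lemma newton_alt_elem_sym:
  "newton (\<lambda>k. - power_sum k) (Abs_fps (\<lambda>n. (- 1) ^ n * elem_sym n :: 'a :: comm_ring_1 symf))"
  using newton_scale[OF newton_elem_sym, of "- 1"]
  by (simp flip: mult.assoc power_mult_distrib)

lemma sum_elem_complete:
  "(\<Sum>i\<le>n. (- 1) ^ i * elem_sym i * complete_sym (n - i)) = (if n = 0 then 1 else 0 :: 'a :: field_char_0 symf)"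
proof -
  have "newton (\<lambda>_. 0) (Abs_fps (\<lambda>n. (- 1) ^ n * elem_sym n :: 'a symf) * Abs_fps complete_sym)"
    using newton_mult[OF newton_alt_elem_sym newton_complete_sym] by simp
  then have "Abs_fps (\<lambda>n. (- 1) ^ n * elem_sym n :: 'a symf) * Abs_fps complete_sym = 1"
    using newton_one by (rule newton_unique)
  then have "(Abs_fps (\<lambda>n. (- 1) ^ n * elem_sym n :: 'a symf) * Abs_fps complete_sym) $ n = 1 $ n" by simp
  then show ?thesis by (simp add: fps_mult_nth atMost_atLeast0)
qed


subsection \<open>Translation and dilation of the alphabet\<close>

text \<open>\<open>trans v\<close> is \<open>f \<mapsto> f[X + V w]\<close> with \<open>p\<^sub>k[V] = v k\<close>, a polynomial in \<open>w\<close> (which plays the role of \<open>1/z\<close>);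
  \<open>dilate a\<close> is \<open>f \<mapsto> f[A X]\<close> with \<open>p\<^sub>k[A] = a k\<close>.\<close>

definition trans :: "(nat \<Rightarrow> 'a :: field_char_0) \<Rightarrow> 'a symf \<Rightarrow> 'a symf poly" where
  "trans v = psub (\<lambda>c. [:const_symf c:]) (\<lambda>k. [:power_sum k:] + monom (const_symf (v k)) k)"

definition dilate :: "(nat \<Rightarrow> 'a :: field_char_0) \<Rightarrow> 'a symf \<Rightarrow> 'a symf" where
  "dilate a = psub const_symf (\<lambda>k. const_symf (a k) * power_sum k)"

lemma comm_ring_hom_const_symf_poly: "comm_ring_hom (\<lambda>c. [:const_symf c:])"
  by (rule comm_ring_hom_comp[OF comm_ring_hom_const_poly comm_ring_hom_const_symf])

lemma comm_ring_hom_trans: "comm_ring_hom (trans v)"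
  unfolding trans_def by (rule psub_hom[OF comm_ring_hom_const_symf_poly])

lemma comm_ring_hom_dilate: "comm_ring_hom (dilate a)"
  unfolding dilate_def by (rule psub_hom[OF comm_ring_hom_const_symf])

interpretation trans: comm_ring_hom "trans v"
  by (rule comm_ring_hom_trans)

interpretation dilate: comm_ring_hom "dilate a"
  by (rule comm_ring_hom_dilate)

lemma trans_const [simp]: "trans v (const_symf c) = [:const_symf c:]"
  unfolding trans_def by (rule psub_const[OF comm_ring_hom_const_symf_poly])

lemma trans_power_sum:
  "k > 0 \<Longrightarrow> trans v (power_sum k) = [:power_sum k:] + monom (const_symf (v k)) k"
  unfolding trans_def by (rule psub_power_sum[OF comm_ring_hom_const_symf_poly])

lemma dilate_const [simp]: "dilate a (const_symf c) = const_symf c"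
  unfolding dilate_def by (rule psub_const[OF comm_ring_hom_const_symf])

lemma dilate_power_sum: "k > 0 \<Longrightarrow> dilate a (power_sum k) = const_symf (a k) * power_sum k"
  unfolding dilate_def by (rule psub_power_sum[OF comm_ring_hom_const_symf])

lemma trans_scale: "trans v (scale_symf c f) = smult (const_symf c) (trans v f)"
  by (simp add: scale_symf_def trans.hom_mult)

lemma dilate_scale: "dilate a (scale_symf c f) = scale_symf c (dilate a f)"
  by (simp add: scale_symf_def dilate.hom_mult)

lemma dilate_dilate:
  assumes "\<And>k. k > 0 \<Longrightarrow> a k * b k = 1"
  shows "dilate a (dilate b f) = f"
  by (rule symf_hom_eqI[OF comm_ring_hom_comp[OF comm_ring_hom_dilate comm_ring_hom_dilate] comm_ring_hom_ident])
     (use assms in \<open>auto simp: dilate_power_sum dilate.hom_mult mult.commute[of "b _"]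
       simp flip: mult.assoc const_symf_mult\<close>)

lemma coeff_trans_0: "coeff (trans v f) 0 = f"
proof (rule symf_hom_eqI[where \<phi> = "\<lambda>f. coeff (trans v f) 0" and \<psi> = "\<lambda>f. f"])
  show "comm_ring_hom (\<lambda>f. coeff (trans v f) 0)"
    by (rule comm_ring_homI) (auto simp: trans.hom_add trans.hom_mult coeff_mult)
qed (auto simp: comm_ring_hom_ident trans_power_sum)

text \<open>The addition formula h_n[A(X + Vw)] = \<Sum> h_k[AV] w^k h_(n-k)[AX], where A has power
  sums \<open>a k\<close>, F_n is h_n[AX] and C collects the h_k[AV]. The case a = 1 covers complete
  functions; other choices of a cover elementary functions and \<open>geo\<close>.\<close>

lemma coeff_trans_newton:
  fixes F :: "nat \<Rightarrow> 'a :: field_char_0 symf"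
  assumes F: "newton (\<lambda>k. const_symf (a k) * power_sum k) (Abs_fps F)"
    and C: "newton (\<lambda>k. a k * v k) C"
  shows "coeff (trans v (F n)) k = (if k \<le> n then scale_symf (C $ k) (F (n - k)) else 0)"
proof -
  define x :: "'a symf poly" where "x = monom 1 1"
  have xk: "x ^ k * [:f:] = monom f k" for f k
    by (simp add: x_def monom_power smult_monom)
  then have xk': "smult f (x ^ k) = monom f k" for f k
    by (metis mult.commute mult_pCons_left mult_zero_left pCons_0_0 add.right_neutral)
  have "newton (\<lambda>k. trans v (const_symf (a k) * power_sum k)) (Abs_fps (\<lambda>n. trans v (F n)))"
    using newton_hom[OF comm_ring_hom_trans F] by simp
  moreover have "newton (\<lambda>k. [:const_symf (a k) * power_sum k:] + x ^ k * [:const_symf (a k * v k):])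
      (Abs_fps (\<lambda>n. [:F n:]) * Abs_fps (\<lambda>n. x ^ n * [:const_symf (C $ n):]))"
    using newton_mult[OF newton_hom[OF comm_ring_hom_const_poly F]
        newton_scale[OF newton_hom[OF comm_ring_hom_const_symf_poly C], of x]] by simp
  then have "newton (\<lambda>k. trans v (const_symf (a k) * power_sum k))
      (Abs_fps (\<lambda>n. [:F n:]) * Abs_fps (\<lambda>n. x ^ n * [:const_symf (C $ n):]))"
    by (rule newton_cong)
       (simp add: trans.hom_mult trans_power_sum xk xk' smult_monom const_symf_mult smult_add_right)
  ultimately have "Abs_fps (\<lambda>n. trans v (F n)) =
      Abs_fps (\<lambda>n. [:F n:]) * Abs_fps (\<lambda>n. x ^ n * [:const_symf (C $ n):])"
    by (rule newton_unique)
  then have "Abs_fps (\<lambda>n. trans v (F n)) $ n =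
      (Abs_fps (\<lambda>n. x ^ n * [:const_symf (C $ n):]) * Abs_fps (\<lambda>n. [:F n:])) $ n"
    by (simp only: mult.commute)
  then have "trans v (F n) = (\<Sum>i=0..n. x ^ i * [:const_symf (C $ i):] * [:F (n - i):])"
    by (simp only: fps_nth_Abs_fps fps_mult_nth)
  also have "\<dots> = (\<Sum>i=0..n. monom (scale_symf (C $ i) (F (n - i))) i)"
    by (simp add: xk xk' smult_monom scale_symf_def mult.commute)
  finally show ?thesis by (simp add: coeff_sum)
qed

lemma newton_complete_sym': "newton (\<lambda>k. const_symf 1 * power_sum k) (Abs_fps complete_sym)"
  using newton_complete_sym by simp

text \<open>The complete functions of the alphabet 1 - t: in (1 - tz)/(1 - z) every coefficient
  after the first is 1 - t.\<close>

lemma newton_one_minus: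
  "newton (\<lambda>k. 1 - t ^ k) (Abs_fps (\<lambda>k. if k = 0 then 1 else 1 - t :: 'a :: comm_ring_1))"
proof -
  have "Abs_fps (\<lambda>n. 1 ^ n) * (1 - fps_const t * fps_X) = Abs_fps (\<lambda>k. if k = 0 then 1 else 1 - t)"
  proof -
    define A where "A = Abs_fps (\<lambda>n. 1 ^ n :: 'a)"
    have "A * (1 - fps_const t * fps_X) = A - fps_const t * (fps_X * A)"
      by (simp add: right_diff_distrib mult_ac)
    also have "\<dots> = Abs_fps (\<lambda>k. if k = 0 then 1 else 1 - t)"
      by (rule fps_ext) (simp add: A_def)
    finally show ?thesis by (simp add: A_def)
  qed
  then show ?thesis
    using newton_mult[OF newton_geometric[of 1] newton_linear[of t]] by simp
qed

text \<open>This is h_n[X(q - 1)], because (-1)^n e_n[Y] = h_n[-Y].\<close>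

definition geo :: "'a :: field_char_0 \<Rightarrow> nat \<Rightarrow> 'a symf" where
  "geo q n = dilate (\<lambda>k. 1 - q ^ k) ((- 1) ^ n * elem_sym n)"

lemma newton_geo: "newton (\<lambda>k. const_symf (- (1 - q ^ k)) * power_sum k) (Abs_fps (geo q))"
proof -
  have "newton (\<lambda>k. dilate (\<lambda>k. 1 - q ^ k) (- power_sum k)) (Abs_fps (geo q))"
    using newton_hom[OF comm_ring_hom_dilate newton_alt_elem_sym] by (simp add: geo_def[abs_def])
  then show ?thesis
    by (rule newton_cong) (simp add: dilate.hom_uminus dilate_power_sum const_symf_diff algebra_simps)
qed

lemma geo_0 [simp]: "geo q 0 = 1"
  by (simp add: geo_def)

text \<open>X + X(q - 1) = qX, and h_n[qX] = q^n h_n.\<close>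

lemma sum_complete_geo: "(\<Sum>i\<le>n. complete_sym i * geo q (n - i)) = scale_symf (q ^ n) (complete_sym n)"
proof -
  have "newton (\<lambda>k. power_sum k + const_symf (- (1 - q ^ k)) * power_sum k)
      (Abs_fps complete_sym * Abs_fps (geo q))"
    by (rule newton_mult[OF newton_complete_sym newton_geo])
  then have "newton (\<lambda>k. const_symf q ^ k * power_sum k) (Abs_fps complete_sym * Abs_fps (geo q))"
    by (rule newton_cong)
       (simp add: const_symf_minus const_symf_diff const_symf_power algebra_simps)
  then have "Abs_fps complete_sym * Abs_fps (geo q) = Abs_fps (\<lambda>n. const_symf q ^ n * complete_sym n)"
    using newton_scale[OF newton_complete_sym, of "const_symf q"] newton_unique by fastforce
  then have "(Abs_fps complete_sym * Abs_fps (geo q)) $ n = Abs_fps (\<lambda>n. const_symf q ^ n * complete_sym n) $ n"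
    by simp
  then show ?thesis
    by (simp add: fps_mult_nth atMost_atLeast0 scale_symf_def const_symf_power)
qed

text \<open>The constant term in z of P(1/z) \<Sum> w_i z^i, written as a pairing so that no series
  in both directions occur. Shifting w extracts the other powers of z.\<close>

definition pair :: "'b :: comm_ring_1 poly \<Rightarrow> (nat \<Rightarrow> 'b) \<Rightarrow> 'b" where
  "pair P w = (\<Sum>i\<le>degree P. coeff P i * w i)"

lemma pair_bound: "degree P \<le> N \<Longrightarrow> pair P w = (\<Sum>i\<le>N. coeff P i * w i)"
  unfolding pair_def by (rule sum.mono_neutral_left) (auto simp: coeff_eq_0)

lemma pair_add: "pair (P + Q) w = pair P w + pair Q w"
proof -
  let ?N = "max (degree P) (degree Q)"
  have "degree (P + Q) \<le> ?N" by (rule degree_add_le_max)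
  then show ?thesis
    by (simp add: pair_bound[of _ ?N] distrib_right sum.distrib)
qed

lemma pair_smult: "pair (smult a P) w = a * pair P w"
  using degree_smult_le[of a P]
  by (simp add: pair_bound[of _ "degree P"] sum_distrib_left mult.assoc)

lemma pair_pCons: "pair (pCons a P) w = a * w 0 + pair P (\<lambda>i. w (Suc i))"
proof -
  have "pair (pCons a P) w = (\<Sum>i\<le>Suc (degree P). coeff (pCons a P) i * w i)"
    by (rule pair_bound) (rule degree_pCons_le)
  then show ?thesis by (simp only: sum.atMost_Suc_shift) (simp add: pair_def)
qed

lemma pair_0 [simp]: "pair 0 w = 0"
  by (simp add: pair_def)

lemma pair_mult: "pair (P * Q) w = pair P (\<lambda>i. pair Q (\<lambda>k. w (i + k)))"
proof (induction P arbitrary: w)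
  case (pCons a P)
  show ?case
    by (simp add: pair_add pair_smult pair_pCons pCons.IH)
qed simp

lemma pair_cong: "(\<And>i. i \<le> degree P \<Longrightarrow> w i = w' i) \<Longrightarrow> pair P w = pair P w'"
  by (simp add: pair_def)

lemma pair_sum: "pair P (\<lambda>i. \<Sum>s\<in>S. w s i) = (\<Sum>s\<in>S. pair P (w s))"
  unfolding pair_def sum_distrib_left by (rule sum.swap)

lemma pair_diff_right: "pair P (\<lambda>i. w i - u i) = pair P w - pair P u"
  by (simp add: pair_def algebra_simps sum_subtractf)

lemma pair_add_right: "pair P (\<lambda>i. w i + u i) = pair P w + pair P u"
  by (simp add: pair_def algebra_simps sum.distrib)

lemma pair_mult_right: "pair P (\<lambda>i. a * w i) = a * pair P w"
  by (simp add: pair_def sum_distrib_left mult_ac)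

lemma pair_trans_complete:
  assumes "newton v C"
  shows "pair (trans v (complete_sym a)) w = (\<Sum>k\<le>a. scale_symf (C $ k) (complete_sym (a - k)) * w k)"
proof -
  have c: "coeff (trans v (complete_sym a)) k =
      (if k \<le> a then scale_symf (C $ k) (complete_sym (a - k)) else 0)" for k
    by (rule coeff_trans_newton[OF newton_complete_sym']) (use assms in simp)
  have "degree (trans v (complete_sym a)) \<le> a"
    by (rule degree_le) (simp add: c)
  then show ?thesis by (simp add: pair_bound c)
qed

subsection \<open>The triangular operator\<close>

text \<open>The coefficient of \<open>z\<close> to the power \<open>- j\<close> in \<open>f[X + (1 - t)/z] \<Sum>\<^sub>i z\<^sup>i h\<^sub>i[X (q - 1)]\<close>.\<close>

definition lower :: "'a :: field_char_0 \<Rightarrow> 'a \<Rightarrow> nat \<Rightarrow> 'a symf \<Rightarrow> 'a symf" where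
  "lower q t j f = pair (trans (\<lambda>k. 1 - t ^ k) f) (\<lambda>i. if j \<le> i then geo q (i - j) else 0)"

text \<open>Writing the first coefficient of (1 - tz)/(1 - z) as t + (1 - t) makes the factor 1 - t
  uniform. What is then summed is an initial piece of the convolution of the h_u with
  \<open>geo\<close>, whose total is q^M h_M for M = i + a - j. The missing terms u > a are the
  products of h_(a+s) with the kernel for j + s, and \<open>i \<le> N\<close> ensures that s up to N
  reaches all of them.\<close>

lemma lower_key:
  fixes q t :: "'a :: field_char_0"
  assumes "i \<le> N"
  defines "\<gamma> \<equiv> \<lambda>j i. if j \<le> i then geo q (i - j) else 0"
  shows "(\<Sum>k\<le>a. scale_symf (if k = 0 then 1 else 1 - t) (complete_sym (a - k)) * \<gamma> j (i + k)) =
    scale_symf t (complete_sym a * \<gamma> j i) +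
    scale_symf (1 - t) ((if j \<le> i + a then scale_symf (q ^ (i + a - j)) (complete_sym (i + a - j)) else 0)
      - (\<Sum>s=1..N. complete_sym (a + s) * \<gamma> (j + s) i))"
proof -
  have "(\<Sum>k\<le>a. scale_symf (if k = 0 then 1 else 1 - t) (complete_sym (a - k)) * \<gamma> j (i + k)) =
      (\<Sum>k\<le>a. scale_symf (1 - t) (complete_sym (a - k) * \<gamma> j (i + k)) +
        (if k = 0 then scale_symf t (complete_sym a * \<gamma> j i) else 0))"
    by (intro sum.cong refl)
       (auto simp: scale_symf_mult_left simp flip: symf.scale_left_distrib)
  also have "\<dots> = scale_symf (1 - t) (\<Sum>k\<le>a. complete_sym (a - k) * \<gamma> j (i + k)) +
      scale_symf t (complete_sym a * \<gamma> j i)"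
    by (simp add: sum.distrib scale_symf_sum_right)
  finally have 1: "(\<Sum>k\<le>a. scale_symf (if k = 0 then 1 else 1 - t) (complete_sym (a - k)) * \<gamma> j (i + k)) =
      scale_symf (1 - t) (\<Sum>k\<le>a. complete_sym (a - k) * \<gamma> j (i + k)) +
      scale_symf t (complete_sym a * \<gamma> j i)" .
  have "(\<Sum>k\<le>a. complete_sym (a - k) * \<gamma> j (i + k)) + (\<Sum>s=1..N. complete_sym (a + s) * \<gamma> (j + s) i) =
      (if j \<le> i + a then scale_symf (q ^ (i + a - j)) (complete_sym (i + a - j)) else 0)"
  proof (cases "j \<le> i + a")
    case True
    define M where "M = i + a - j"
    let ?f = "\<lambda>u. complete_sym u * geo q (M - u)"
    have "(\<Sum>k\<le>a. complete_sym (a - k) * \<gamma> j (i + k)) = (\<Sum>u\<in>{..a} \<inter> {..M}. ?f u)"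
    proof -
      have "(\<Sum>k\<le>a. complete_sym (a - k) * \<gamma> j (i + k)) = (\<Sum>u\<le>a. complete_sym u * \<gamma> j (i + (a - u)))"
        by (rule sum.reindex_bij_witness[of _ "\<lambda>u. a - u" "\<lambda>u. a - u"]) auto
      also have "\<dots> = (\<Sum>u\<in>{..a} \<inter> {..M}. ?f u)"
        by (rule sum.mono_neutral_cong_right)
           (use True in \<open>auto simp: \<gamma>_def M_def add.commute[of _ j]\<close>)
      finally show ?thesis .
    qed
    moreover have "(\<Sum>s=1..N. complete_sym (a + s) * \<gamma> (j + s) i) = (\<Sum>u\<in>{a<..M}. ?f u)"
    proof -
      have "(\<Sum>s=1..N. complete_sym (a + s) * \<gamma> (j + s) i) =
          (\<Sum>s\<in>{s\<in>{1..N}. j + s \<le> i}. complete_sym (a + s) * geo q (i - (j + s)))"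
        by (rule sum.mono_neutral_cong_right) (auto simp: \<gamma>_def)
      also have "\<dots> = (\<Sum>u\<in>{a<..M}. ?f u)"
        by (rule sum.reindex_bij_witness[of _ "\<lambda>u. u - a" "\<lambda>s. a + s"])
           (use assms in \<open>auto simp: M_def intro!: arg_cong[of _ _ "geo q"]\<close>)
      finally show ?thesis .
    qed
    moreover have "(\<Sum>u\<in>{..a} \<inter> {..M}. ?f u) + (\<Sum>u\<in>{a<..M}. ?f u) = (\<Sum>u\<le>M. ?f u)"
    proof -
      have "{..M} = ({..a} \<inter> {..M}) \<union> {a<..M}" by auto
      then show ?thesis by (metis (no_types, lifting) sum.union_disjoint finite_atMost
          finite_greaterThanAtMost finite_Int disjoint_iff IntE atMost_iff greaterThanAtMost_iff leD)
    qed
    ultimately show ?thesis using True sum_complete_geo[of q M] by (simp add: M_def)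
  next
    case False
    then show ?thesis by (simp add: \<gamma>_def)
  qed
  then have 2: "(\<Sum>k\<le>a. complete_sym (a - k) * \<gamma> j (i + k)) =
      (if j \<le> i + a then scale_symf (q ^ (i + a - j)) (complete_sym (i + a - j)) else 0) -
      (\<Sum>s=1..N. complete_sym (a + s) * \<gamma> (j + s) i)"
    by (simp add: eq_diff_eq)
  show ?thesis unfolding 1 2 by (simp add: add.commute)
qed

text \<open>\<open>lower_key\<close>, paired with the coefficients of f[X + (1 - t)w], peels off one
  factor h_a. In every term the degree lost by f beyond the overall loss j reappears in the index of
  the complete function in front; this is what makes the operator triangular for dominance.\<close>

lemma lower_complete_times:
  fixes q t :: "'a :: field_char_0" and f
  defines "P \<equiv> trans (\<lambda>k. 1 - t ^ k) f"
  assumes N: "degree P \<le> N"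
  shows "lower q t j (complete_sym a * f) =
    scale_symf t (complete_sym a * lower q t j f) +
    scale_symf (1 - t)
      ((\<Sum>i\<le>N. if j \<le> i + a then scale_symf (q ^ (i + a - j)) (complete_sym (i + a - j)) * coeff P i else 0)
       - (\<Sum>s=1..N. complete_sym (a + s) * lower q t (j + s) f))"
proof -
  define \<gamma> where "\<gamma> = (\<lambda>j i. if j \<le> i then geo q (i - j) else 0)"
  let ?H = "\<lambda>i. if j \<le> i + a then scale_symf (q ^ (i + a - j)) (complete_sym (i + a - j)) else 0"
  have L: "lower q t j f = pair P (\<gamma> j)" for j
    by (simp add: lower_def P_def \<gamma>_def)
  have "lower q t j (complete_sym a * f) =
      pair (P * trans (\<lambda>k. 1 - t ^ k) (complete_sym a)) (\<gamma> j)"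
    by (simp add: lower_def P_def \<gamma>_def trans.hom_mult mult.commute)
  also have "\<dots> = pair P (\<lambda>i. \<Sum>k\<le>a. scale_symf (if k = 0 then 1 else 1 - t) (complete_sym (a - k)) * \<gamma> j (i + k))"
    by (simp add: pair_mult pair_trans_complete[OF newton_one_minus])
  also have "\<dots> = pair P (\<lambda>i. scale_symf t (complete_sym a * \<gamma> j i) +
      scale_symf (1 - t) (?H i - (\<Sum>s=1..N. complete_sym (a + s) * \<gamma> (j + s) i)))"
    unfolding \<gamma>_def by (rule pair_cong, rule lower_key) (use N in simp)
  also have "\<dots> = scale_symf t (complete_sym a * pair P (\<gamma> j)) +
      scale_symf (1 - t) (pair P ?H - (\<Sum>s=1..N. complete_sym (a + s) * pair P (\<gamma> (j + s))))"
    by (simp only: scale_symf_def pair_add_right pair_diff_right pair_mult_right pair_sum)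
  also have "pair P ?H = (\<Sum>i\<le>N. if j \<le> i + a then scale_symf (q ^ (i + a - j)) (complete_sym (i + a - j)) * coeff P i else 0)"
    unfolding pair_bound[OF N] by (intro sum.cong refl) (auto simp: mult.commute)
  finally show ?thesis unfolding L .
qed

section \<open>Triangularity of \<open>lower\<close> on the products h_b\<close>

definition h_prod :: "nat list \<Rightarrow> 'a :: comm_ring_1 symf" where
  "h_prod c = prod_list (map complete_sym c)"

lemma h_prod_Nil [simp]: "h_prod [] = 1" and h_prod_Cons [simp]: "h_prod (a # c) = complete_sym a * h_prod c"
  by (simp_all add: h_prod_def)

text \<open>Exponent vectors dominating \<open>b\<close> up to a total loss of \<open>j\<close>.\<close>

definition above :: "nat \<Rightarrow> nat list \<Rightarrow> nat list set" where
  "above j b = {c. length c = length b \<and> sum_list c + j = sum_list b \<and>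
     (\<forall>i. sum_list (take i b) \<le> sum_list (take i c) + j)}"

definition upset :: "nat \<Rightarrow> nat list \<Rightarrow> 'a :: field_char_0 symf set" where
  "upset j b = symf.span (h_prod ` above j b)"

definition strict_upset :: "nat list \<Rightarrow> 'a :: field_char_0 symf set" where
  "strict_upset b = symf.span (h_prod ` (above 0 b - {b}))"

lemma above_Cons: "c \<in> above j b \<Longrightarrow> a' + j' = a + j \<Longrightarrow> a' # c \<in> above j' (a # b)"
  unfolding above_def
proof (safe, goal_cases)
  case (3 i)
  then show ?case by (cases i) (auto, metis add.assoc add.commute add_le_mono le_refl nat_add_left_cancel_le)
qed auto

lemma span_times:
  assumes "f \<in> symf.span S" "\<And>x. x \<in> S \<Longrightarrow> g * x \<in> symf.span T"
  shows "g * f \<in> symf.span T"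
  using assms(1)
proof (induction rule: symf.span_induct_alt)
  case base
  then show ?case by (simp add: symf.span_zero)
next
  case (step c x y)
  then show ?case
    using assms(2) by (simp add: distrib_left scale_symf_mult_right symf.span_add symf.span_scale)
qed

lemma upset_Cons: "f \<in> upset j b \<Longrightarrow> a' + j' = a + j \<Longrightarrow> complete_sym a' * f \<in> upset j' (a # b)"
  unfolding upset_def
  by (erule span_times) (auto intro!: symf.span_base image_eqI[of _ h_prod "a' # _"] above_Cons)

lemma strict_upset_Cons: "f \<in> strict_upset b \<Longrightarrow> complete_sym a * f \<in> strict_upset (a # b)"
  unfolding strict_upset_def
  by (erule span_times) (auto intro!: symf.span_base image_eqI[of _ h_prod "a # _"] above_Cons)

lemma strict_upset_Cons':
  "f \<in> upset j b \<Longrightarrow> j > 0 \<Longrightarrow> complete_sym (a + j) * f \<in> strict_upset (a # b)"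
  unfolding strict_upset_def upset_def
  by (erule span_times) (auto intro!: symf.span_base image_eqI[of _ h_prod "(a + j) # _"] above_Cons)

lemma upset_Nil: "1 \<in> upset 0 []"
  unfolding upset_def by (rule symf.span_base, rule image_eqI[of _ h_prod "[]"]) (auto simp: above_def)

text \<open>Translating a factor h_a takes k from its index at the cost of w^k; over all factors the
  losses add up to i.\<close>

lemma coeff_trans_h_prod:
  assumes "newton v C"
  shows "coeff (trans v (h_prod b)) i \<in> upset i b"
proof (induction b arbitrary: i)
  case Nil
  then show ?case
    using upset_Nil by (cases "i = 0") (auto simp: coeff_pCons upset_def symf.span_zero trans.hom_one split: nat.split)
next
  case (Cons a b)
  have "coeff (trans v (complete_sym a)) k =
      (if k \<le> a then scale_symf (C $ k) (complete_sym (a - k)) else 0)" for k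
    by (rule coeff_trans_newton[OF newton_complete_sym']) (use assms in simp)
  then have "coeff (trans v (h_prod (a # b))) i = (\<Sum>k\<le>i. if k \<le> a then
      scale_symf (C $ k) (complete_sym (a - k) * coeff (trans v (h_prod b)) (i - k)) else 0)"
    by (auto simp: trans.hom_mult coeff_mult scale_symf_mult_left intro!: sum.cong)
  also have "\<dots> \<in> upset i (a # b)"
    unfolding upset_def
    by (intro symf.span_sum)
       (auto intro!: symf.span_scale symf.span_zero upset_Cons[unfolded upset_def] Cons.IH[unfolded upset_def])
  finally show ?case .
qed

lemma lower_h_prod: "lower q t j (h_prod b) \<in> upset j b"
proof (induction b arbitrary: j)
  case Nil
  then show ?case
    using upset_Nil by (cases "j = 0") (simp_all add: lower_def pair_def trans.hom_one upset_def symf.span_zero)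
next
  case (Cons a b)
  let ?P = "trans (\<lambda>k. 1 - t ^ k) (h_prod b)"
  have P: "coeff ?P i \<in> upset i b" for i
    by (rule coeff_trans_h_prod[OF newton_one_minus])
  show ?case
    unfolding h_prod_Cons lower_complete_times[OF order_refl] upset_def
    by (intro symf.span_add symf.span_diff symf.span_scale symf.span_sum)
       (auto simp: scale_symf_mult_left intro!: symf.span_zero symf.span_scale upset_Cons[unfolded upset_def]
          Cons.IH[unfolded upset_def] P[unfolded upset_def])
qed

text \<open>The diagonal factor that \<open>lower_complete_times\<close> produces at j = 0: the
  factor of the remaining rows is multiplied by t, and the new row contributes (1 - t) q^a through
  the term i = 0. \<open>eigenval_cell_sum\<close> identifies it with 1 - (1 - q)(1 - t)
  B_\<mu>.\<close>

primrec eigenval :: "'a :: comm_ring_1 \<Rightarrow> 'a \<Rightarrow> nat list \<Rightarrow> 'a" where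
  "eigenval q t [] = 1"
| "eigenval q t (a # b) = t * eigenval q t b + (1 - t) * q ^ a"

text \<open>Terms of the recursion with i > 0 or s > 0 have a front index larger than a and hence
  lie strictly above; A and B collect them, and C is the inductive error with h_a in front.\<close>

lemma lower_h_prod_diag:
  "lower q t 0 (h_prod b) - scale_symf (eigenval q t b) (h_prod b) \<in> strict_upset b"
proof (induction b)
  case Nil
  then show ?case
    by (simp add: lower_def pair_def trans.hom_one strict_upset_def symf.span_zero)
next
  case (Cons a b)
  let ?P = "trans (\<lambda>k. 1 - t ^ k) (h_prod b)"
  let ?N = "degree ?P"
  let ?h = "h_prod b :: 'a symf"
  have P: "coeff ?P i \<in> upset i b" for i
    by (rule coeff_trans_h_prod[OF newton_one_minus])
  define A where "A = (\<Sum>i\<in>{1..?N}. scale_symf (q ^ (i + a)) (complete_sym (i + a)) * coeff ?P i)"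
  define B where "B = (\<Sum>s=1..?N. complete_sym (a + s) * lower q t (0 + s) ?h)"
  define C where "C = complete_sym a * (lower q t 0 ?h - scale_symf (eigenval q t b) ?h)"
  have A: "A \<in> strict_upset (a # b)"
    unfolding A_def strict_upset_def
    by (intro symf.span_sum)
       (auto simp: scale_symf_mult_left add.commute[of _ a] intro!: symf.span_scale strict_upset_Cons'[unfolded strict_upset_def] P)
  have B: "B \<in> strict_upset (a # b)"
    unfolding B_def strict_upset_def
    by (intro symf.span_sum)
       (auto intro!: strict_upset_Cons'[unfolded strict_upset_def] lower_h_prod)
  have C: "C \<in> strict_upset (a # b)"
    unfolding C_def by (rule strict_upset_Cons[OF Cons.IH])
  have "(\<Sum>i\<le>?N. if 0 \<le> i + a then scale_symf (q ^ (i + a - 0)) (complete_sym (i + a - 0)) * coeff ?P i else 0) =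
      scale_symf (q ^ a) (complete_sym a) * ?h + A"
    unfolding A_def
    by (subst sum.remove[of _ 0]) (auto simp: coeff_trans_0 intro!: sum.cong)
  then have "lower q t 0 (h_prod (a # b)) = scale_symf t (complete_sym a * lower q t 0 ?h) +
      scale_symf (1 - t) (scale_symf (q ^ a) (complete_sym a) * ?h + A - B)"
    unfolding h_prod_Cons lower_complete_times[OF order_refl] B_def by simp
  then have "lower q t 0 (h_prod (a # b)) - scale_symf (eigenval q t (a # b)) (h_prod (a # b)) =
      scale_symf t C + scale_symf (1 - t) (A - B)"
    by (simp add: C_def algebra_simps scale_symf_def const_symf_add const_symf_mult const_symf_diff)
  then show ?case
    using A B C unfolding strict_upset_def
    by (simp add: symf.span_add symf.span_diff symf.span_scale)
qed

subsection \<open>Dominance\<close>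

lemma sum_take_mono: "i \<le> j \<Longrightarrow> sum_list (take i xs) \<le> sum_list (take j (xs :: nat list))"
  by (metis le_add1 sum_list_append take_add nat_le_iff_add)

text \<open>Remove the largest element x from both lists. If a prefix of c contains x, compare what
  is left; if not, its last entry is at most x and may be traded for it.\<close>

lemma sum_take_sorted:
  assumes "sorted_wrt (\<ge>) d" "mset c = mset (d :: nat list)"
  shows "sum_list (take i c) \<le> sum_list (take i d)"
  using assms
proof (induction d arbitrary: c i)
  case (Cons x d)
  then have "x \<in> set c" by (metis list.set_intros(1) mset_eq_setD)
  then obtain c1 c2 where c: "c = c1 @ x # c2" by (meson split_list)
  then have "mset (c1 @ c2) = mset d" using Cons.prems by simp
  then have IH: "sum_list (take j (c1 @ c2)) \<le> sum_list (take j d)" for j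
    using Cons.IH[of "c1 @ c2" j] Cons.prems(1) by simp
  have le: "y \<le> x" if "y \<in> set c1" for y
    using that Cons.prems c by (metis UnCI insert_iff le_refl list.simps(15) mset_eq_setD set_append sorted_wrt.simps(2))
  show ?case
  proof (cases i)
    case (Suc j)
    show ?thesis
    proof (cases "i \<le> length c1")
      case True
      then have "sum_list (take i c) = sum_list (take j c1) + c1 ! j"
        using Suc c by (simp add: take_Suc_conv_app_nth)
      also have "\<dots> \<le> sum_list (take j (c1 @ c2)) + x"
        using le[of "c1 ! j"] True Suc by simp
      finally show ?thesis using IH[of j] Suc by simp
    next
      case False
      then have "sum_list (take i c) = x + sum_list (take j (c1 @ c2))"
        using Suc c by (simp add: Suc_diff_le)
      then show ?thesis using IH[of j] Suc by simp
    qed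
  qed simp
qed simp

lemma sum_take_filter: "sum_list (take i xs) \<le> sum_list (take i (filter (\<lambda>k. k \<noteq> 0) (xs :: nat list)))"
proof (induction xs arbitrary: i)
  case (Cons x xs)
  show ?case
  proof (cases i)
    case (Suc j)
    show ?thesis
      using Cons.IH[of j] sum_take_mono[of j "Suc j" "filter (\<lambda>k. k \<noteq> 0) xs"]
      by (cases "x = 0") (auto simp: Suc)
  qed simp
qed simp

lemma sum_take_sort_part: "sum_list (take i c) \<le> sum_list (take i (sort_part (mset c)))"
proof -
  have "sorted_wrt (\<ge>) (sort_part (mset c))"
    using is_partition_sort_part by (simp add: is_partition_def)
  moreover have "mset (filter (\<lambda>k. k \<noteq> 0) c) = mset (sort_part (mset c))"
    by (simp add: mset_sort_part)
  ultimately show ?thesis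
    using sum_take_sorted sum_take_filter order_trans by blast
qed

lemma list_eqI_sum_take:
  assumes "length c = length d" "\<And>i. sum_list (take i c) = sum_list (take i (d :: nat list))"
  shows "c = d"
proof (rule nth_equalityI[OF assms(1)])
  fix i assume "i < length c"
  then show "c ! i = d ! i"
    using assms(2)[of i] assms(2)[of "Suc i"] assms(1) by (simp add: take_Suc_conv_app_nth)
qed

lemma complete_sym_prod_perm: "mset c = mset d \<Longrightarrow> h_prod c = h_prod d"
  unfolding h_prod_def by (metis mset_map prod_mset_prod_list)

lemma h_prod_sort_part: "h_prod (sort_part (mset c)) = h_prod c"
proof -
  have "h_prod (sort_part (mset c)) = h_prod (filter (\<lambda>k. k \<noteq> 0) c)"
    by (rule complete_sym_prod_perm) (simp add: mset_sort_part)
  also have "\<dots> = h_prod c" by (induction c) auto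
  finally show ?thesis .
qed

lemma dominates_refl [simp]: "dominates \<mu> \<mu>"
  by (simp add: dominates_def)

lemma dominates_trans: "dominates \<mu> \<nu> \<Longrightarrow> dominates \<nu> \<kappa> \<Longrightarrow> dominates \<mu> \<kappa>"
  unfolding dominates_def by (metis order_trans)

lemma sum_take_partition_lt:
  assumes "is_partition \<mu>" "i < length \<mu>"
  shows "sum_list (take i \<mu>) < sum_list \<mu>"
proof -
  have "\<mu> ! i > 0" using assms by (metis bot_nat_0.not_eq_extremum is_partition_def nth_mem)
  then have "sum_list (take i \<mu>) < sum_list (take (Suc i) \<mu>)"
    using assms by (simp add: take_Suc_conv_app_nth)
  also have "\<dots> \<le> sum_list (take (max (Suc i) (length \<mu>)) \<mu>)" by (rule sum_take_mono) simp
  also have "\<dots> = sum_list \<mu>" by simp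
  finally show ?thesis .
qed

lemma dominates_length:
  assumes "is_partition \<nu>" "dominates \<nu> \<mu>"
  shows "length \<nu> \<le> length \<mu>"
proof (rule ccontr)
  assume "\<not> length \<nu> \<le> length \<mu>"
  then have "sum_list (take (length \<mu>) \<nu>) < sum_list \<nu>"
    using assms by (intro sum_take_partition_lt) auto
  moreover have "sum_list (take (length \<mu>) \<mu>) \<le> sum_list (take (length \<mu>) \<nu>)"
    using assms(2) unfolding dominates_def by blast
  ultimately show False using assms(2) by (simp add: dominates_def)
qed

lemma dominates_antisym:
  assumes "is_partition \<mu>" "is_partition \<nu>" "dominates \<mu> \<nu>" "dominates \<nu> \<mu>"
  shows "\<mu> = \<nu>"
proof (rule list_eqI_sum_take)
  show "length \<mu> = length \<nu>" using dominates_length assms by (simp add: le_antisym)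
  show "sum_list (take i \<mu>) = sum_list (take i \<nu>)" for i
    using assms(3,4) unfolding dominates_def by (simp add: le_antisym)
qed

definition dom_up :: "nat list \<Rightarrow> nat list set" where
  "dom_up \<mu> = {\<nu>. is_partition \<nu> \<and> dominates \<nu> \<mu>}"

text \<open>Sorting can only raise partial sums, so the sorted vector still dominates \<mu>. If it
  equals \<mu>, the partial sums of c are squeezed to those of \<mu>, so c is \<mu> itself; this
  keeps strictness when vectors are sorted into partitions.\<close>

lemma above_sort_part:
  assumes "is_partition \<mu>" "c \<in> above 0 \<mu>"
  shows "sort_part (mset c) \<in> dom_up \<mu>" "sort_part (mset c) = \<mu> \<Longrightarrow> c = \<mu>"
proof -
  have c: "length c = length \<mu>" "sum_list c = sum_list \<mu>" "\<And>i. sum_list (take i \<mu>) \<le> sum_list (take i c)"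
    using assms by (auto simp: above_def)
  show "sort_part (mset c) \<in> dom_up \<mu>"
    unfolding dom_up_def dominates_def
    using c order_trans[OF c(3) sum_take_sort_part] by (simp add: sum_list_sort_part sum_mset_sum_list)
  assume *: "sort_part (mset c) = \<mu>"
  show "c = \<mu>"
  proof (rule list_eqI_sum_take[OF c(1)])
    fix i show "sum_list (take i c) = sum_list (take i \<mu>)"
      using c(3)[of i] sum_take_sort_part[of i c] * by simp
  qed
qed

lemma strict_upset_subset:
  assumes "is_partition \<mu>"
  shows "strict_upset \<mu> \<subseteq> (symf.span (h_prod ` (dom_up \<mu> - {\<mu>})) :: 'a :: field_char_0 symf set)"
  unfolding strict_upset_def
proof (rule symf.span_minimal)
  show "h_prod ` (above 0 \<mu> - {\<mu>}) \<subseteq> (symf.span (h_prod ` (dom_up \<mu> - {\<mu>})) :: 'a symf set)"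
  proof
    fix f :: "'a symf" assume "f \<in> h_prod ` (above 0 \<mu> - {\<mu>})"
    then obtain c where "c \<in> above 0 \<mu>" "c \<noteq> \<mu>" and f: "f = h_prod c" by auto
    then have "sort_part (mset c) \<in> dom_up \<mu> - {\<mu>}"
      using above_sort_part[OF assms, of c] by auto
    then show "f \<in> symf.span (h_prod ` (dom_up \<mu> - {\<mu>}))"
      unfolding f by (metis h_prod_sort_part image_eqI symf.span_base)
  qed
qed simp


subsection \<open>Conjugate partitions\<close>

lemma conjugate_Nil [simp]: "conjugate [] = []"
  by (simp add: conjugate_def)

lemma partition_le_hd: "is_partition \<mu> \<Longrightarrow> x \<in> set \<mu> \<Longrightarrow> x \<le> hd \<mu>"
  by (cases \<mu>) (auto simp: is_partition_def)

lemma less_length_filter_iff: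
  assumes "sorted_wrt (\<ge>) (\<mu> :: nat list)"
  shows "i < length (filter (\<lambda>r. j < r) \<mu>) \<longleftrightarrow> i < length \<mu> \<and> j < \<mu> ! i"
  using assms
proof (induction \<mu> arbitrary: i)
  case (Cons a \<mu>)
  show ?case
  proof (cases "j < a")
    case True
    then show ?thesis using Cons by (cases i) auto
  next
    case False
    then have "filter (\<lambda>r. j < r) (a # \<mu>) = []" using Cons.prems by (auto simp: filter_empty_conv)
    moreover have "\<not> (i < length (a # \<mu>) \<and> j < (a # \<mu>) ! i)"
      using False Cons.prems by (metis filter_empty_conv calculation nth_mem)
    ultimately show ?thesis by simp
  qed
qed simp

lemma length_conjugate: "length (conjugate \<mu>) = (if \<mu> = [] then 0 else hd \<mu>)"
  by (simp add: conjugate_def)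

lemma nth_conjugate: "j < length (conjugate \<mu>) \<Longrightarrow> conjugate \<mu> ! j = length (filter (\<lambda>r. j < r) \<mu>)"
  by (auto simp: conjugate_def split: if_splits)

text \<open>Transposition of cells. The index bounds are part of both sides, so that the equivalence
  determines lengths as well as entries.\<close>

lemma conjugate_cells:
  assumes "is_partition \<mu>"
  shows "j < length (conjugate \<mu>) \<and> i < conjugate \<mu> ! j \<longleftrightarrow> i < length \<mu> \<and> j < \<mu> ! i"
proof -
  have s: "sorted_wrt (\<ge>) \<mu>" using assms by (simp add: is_partition_def)
  have "j < length (conjugate \<mu>)" if "i < length \<mu>" "j < \<mu> ! i"
    using partition_le_hd[OF assms, of "\<mu> ! i"] that by (auto simp: length_conjugate)
  then show ?thesis using less_length_filter_iff[OF s, of i j] nth_conjugate[of j \<mu>] by auto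
qed

lemma is_partition_conjugate:
  assumes "is_partition \<mu>"
  shows "is_partition (conjugate \<mu>)"
proof -
  have "sorted_wrt (\<ge>) (conjugate \<mu>)"
    unfolding sorted_wrt_iff_nth_less
  proof (intro allI impI)
    fix i j assume ij: "i < j" "j < length (conjugate \<mu>)"
    show "conjugate \<mu> ! i \<ge> conjugate \<mu> ! j"
    proof (rule ccontr)
      assume "\<not> conjugate \<mu> ! i \<ge> conjugate \<mu> ! j"
      then have "conjugate \<mu> ! i < length \<mu> \<and> j < \<mu> ! (conjugate \<mu> ! i)"
        using conjugate_cells[OF assms, of j "conjugate \<mu> ! i"] ij by auto
      then show False using conjugate_cells[OF assms, of i "conjugate \<mu> ! i"] ij by auto
    qed
  qed
  moreover have "conjugate \<mu> ! j > 0" if "j < length (conjugate \<mu>)" for j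
  proof -
    have ne: "\<mu> \<noteq> []" using that by auto
    then have "0 < length \<mu> \<and> j < \<mu> ! 0"
      using that by (auto simp: length_conjugate hd_conv_nth)
    then show ?thesis using conjugate_cells[OF assms, of j 0] by blast
  qed
  ultimately show ?thesis unfolding is_partition_def by (metis in_set_conv_nth less_irrefl)
qed

lemma conjugate_conjugate:
  assumes "is_partition \<mu>"
  shows "conjugate (conjugate \<mu>) = \<mu>"
proof -
  note c = conjugate_cells[OF assms] conjugate_cells[OF is_partition_conjugate[OF assms]]
  have pos: "\<mu> ! i > 0" if "i < length \<mu>" for i
    using that assms by (metis bot_nat_0.not_eq_extremum is_partition_def nth_mem)
  have pos': "conjugate (conjugate \<mu>) ! i > 0" if "i < length (conjugate (conjugate \<mu>))" for i
    using that is_partition_conjugate[OF is_partition_conjugate[OF assms]]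
    by (metis bot_nat_0.not_eq_extremum is_partition_def nth_mem)
  have cell: "i < length (conjugate (conjugate \<mu>)) \<and> j < conjugate (conjugate \<mu>) ! i \<longleftrightarrow> i < length \<mu> \<and> j < \<mu> ! i" for i j
    using c(1)[of j i] c(2)[of i j] by blast
  have "i < length (conjugate (conjugate \<mu>)) \<longleftrightarrow> i < length \<mu>" for i
    using cell[of i 0] pos[of i] pos'[of i] by blast
  then have len: "length (conjugate (conjugate \<mu>)) = length \<mu>"
    by (meson linorder_neqE_nat less_irrefl)
  then show ?thesis
  proof (rule nth_equalityI)
    fix i assume "i < length (conjugate (conjugate \<mu>))"
    then have "j < conjugate (conjugate \<mu>) ! i \<longleftrightarrow> j < \<mu> ! i" for j
      using cell[of i j] len by auto
    then show "conjugate (conjugate \<mu>) ! i = \<mu> ! i"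
      by (meson linorder_neqE_nat less_irrefl)
  qed
qed

text \<open>Both sides count the cells in the first k columns, once by columns and once by
  rows.\<close>

lemma sum_length_filter: "(\<Sum>j<k. length (filter (\<lambda>r. j < r) \<mu>)) = sum_list (map (\<lambda>r. min r k) (\<mu> :: nat list))"
proof (induction \<mu>)
  case (Cons a \<mu>)
  have "(\<Sum>j<k. if j < a then 1 else 0 :: nat) = (\<Sum>j\<in>{..<min a k}. 1)"
    by (rule sum.mono_neutral_cong_right) auto
  moreover have "(\<Sum>j<k. length (filter (\<lambda>r. j < r) (a # \<mu>))) =
      (\<Sum>j<k. (if j < a then 1 else 0) + length (filter (\<lambda>r. j < r) \<mu>))"
    by (intro sum.cong) auto
  ultimately show ?case using Cons by (simp add: sum.distrib)
qed simp

lemma sum_take_conjugate: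
  assumes "is_partition \<mu>"
  shows "sum_list (take k (conjugate \<mu>)) = sum_list (map (\<lambda>r. min r k) \<mu>)"
proof -
  define h where "h = length (conjugate \<mu>)"
  define f where "f = (\<lambda>j. length (filter (\<lambda>r. j < r) \<mu>))"
  have "conjugate \<mu> = map f [0..<h]" by (simp add: conjugate_def h_def f_def)
  then have "sum_list (take k (conjugate \<mu>)) = sum_list (map f [0..<min k h])"
    by (cases "k \<le> h") (simp_all add: take_map take_upt min_def)
  also have "\<dots> = (\<Sum>j<min k h. f j)"
    by (simp add: interv_sum_list_conv_sum_set_nat lessThan_atLeast0)
  also have "\<dots> = (\<Sum>j<k. f j)"
  proof (rule sum.mono_neutral_left)
    show "\<forall>j\<in>{..<k} - {..<min k h}. f j = 0"
    proof
      fix j assume "j \<in> {..<k} - {..<min k h}"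
      then have "h \<le> j" by auto
      then have "filter (\<lambda>r. j < r) \<mu> = []"
        using partition_le_hd[OF assms] by (cases "\<mu> = []") (fastforce simp: filter_empty_conv h_def length_conjugate)+
      then show "f j = 0" by (simp add: f_def)
    qed
  qed auto
  finally show ?thesis by (simp add: f_def sum_length_filter)
qed

lemma sum_list_conjugate:
  assumes "is_partition \<mu>"
  shows "sum_list (conjugate \<mu>) = sum_list \<mu>"
proof -
  define k where "k = max (length (conjugate \<mu>)) (sum_list \<mu>)"
  have "sum_list (conjugate \<mu>) = sum_list (take k (conjugate \<mu>))" by (simp add: k_def)
  also have "\<dots> = sum_list (map (\<lambda>r. min r k) \<mu>)" by (rule sum_take_conjugate[OF assms])
  also have "map (\<lambda>r. min r k) \<mu> = map (\<lambda>r. r) \<mu>"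
  proof (rule map_cong[OF refl])
    fix r assume "r \<in> set \<mu>"
    then have "r \<le> sum_list \<mu>" by (simp add: member_le_sum_list)
    then show "min r k = r" by (simp add: k_def)
  qed
  finally show ?thesis by simp
qed

lemma conjugate_in_partitions_of: "\<mu> \<in> partitions_of n \<Longrightarrow> conjugate \<mu> \<in> partitions_of n"
  by (simp add: partitions_of_def is_partition_conjugate sum_list_conjugate)

text \<open>For a sorted list the difference between a prefix sum of length r and r k is largest
  when r is the number of parts exceeding k, and then it is the total excess over k. With
  \<open>sum_excess_bound\<close> the excess becomes a maximum of quantities that dominance can
  compare.\<close>

lemma sum_excess_sorted:
  assumes "sorted_wrt (\<ge>) (\<mu> :: nat list)"
  shows "sum_list (take (length (filter (\<lambda>r. k < r) \<mu>)) \<mu>) =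
    sum_list (map (\<lambda>r. r - k) \<mu>) + length (filter (\<lambda>r. k < r) \<mu>) * k"
  using assms
proof (induction \<mu>)
  case (Cons a \<mu>)
  show ?case
  proof (cases "k < a")
    case False
    then have "filter (\<lambda>r. k < r) (a # \<mu>) = []" using Cons.prems by (auto simp: filter_empty_conv)
    moreover have "map (\<lambda>r. r - k) \<mu> = map (\<lambda>_. 0) \<mu>"
      using False Cons.prems by (intro map_cong) auto
    ultimately show ?thesis using False by (auto simp: sum_list_triv)
  qed (use Cons in auto)
qed simp

lemma sum_excess_bound: "sum_list (take r \<nu>) \<le> sum_list (map (\<lambda>x. x - k) \<nu>) + r * (k :: nat)"
proof (induction \<nu> arbitrary: r)
  case (Cons a \<nu>)
  show ?case
  proof (cases r)
    case (Suc s)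
    then show ?thesis using Cons[of s] by simp
  qed simp
qed simp

text \<open>Dominance raises the excess over k, hence lowers the sum of the parts truncated at k,
  which is a partial sum of the conjugate.\<close>

lemma dominates_conjugate:
  assumes "is_partition \<mu>" "is_partition \<nu>" "dominates \<nu> \<mu>"
  shows "dominates (conjugate \<mu>) (conjugate \<nu>)"
proof -
  have "sum_list (take k (conjugate \<nu>)) \<le> sum_list (take k (conjugate \<mu>))" for k
  proof -
    define r where "r = length (filter (\<lambda>r. k < r) \<mu>)"
    have "sum_list (take r \<mu>) = sum_list (map (\<lambda>r. r - k) \<mu>) + r * k"
      unfolding r_def by (rule sum_excess_sorted) (use assms in \<open>simp add: is_partition_def\<close>)
    moreover have "sum_list (take r \<mu>) \<le> sum_list (take r \<nu>)"
      using assms(3) unfolding dominates_def by blast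
    ultimately have le: "sum_list (map (\<lambda>r. r - k) \<mu>) \<le> sum_list (map (\<lambda>r. r - k) \<nu>)"
      using sum_excess_bound[of r \<nu> k] by linarith
    have "sum_list (map (\<lambda>r. min r k) xs) + sum_list (map (\<lambda>r. r - k) xs) = sum_list xs" for xs :: "nat list"
      by (induction xs) auto
    from this[of \<mu>] this[of \<nu>] show ?thesis
      using le assms(3) by (simp add: sum_take_conjugate[OF assms(1)] sum_take_conjugate[OF assms(2)] dominates_def)
  qed
  then show ?thesis
    using assms by (simp add: dominates_def sum_list_conjugate)
qed

lemma dominates_conjugate_antisym:
  assumes "is_partition \<mu>" "is_partition \<nu>" "dominates \<nu> \<mu>" "dominates (conjugate \<nu>) (conjugate \<mu>)"
  shows "\<nu> = \<mu>"
proof -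
  have "conjugate \<nu> = conjugate \<mu>"
    using assms dominates_conjugate by (intro dominates_antisym is_partition_conjugate) auto
  then show ?thesis using conjugate_conjugate assms(1,2) by metis
qed

section \<open>Eigenvalues as sums over cells\<close>

definition cell_sum :: "'a :: comm_ring_1 \<Rightarrow> 'a \<Rightarrow> nat list \<Rightarrow> 'a" where
  "cell_sum q t \<mu> = (\<Sum>i<length \<mu>. \<Sum>j<\<mu> ! i. q ^ j * t ^ i)"

lemma cell_sum_conjugate:
  assumes "is_partition \<mu>"
  shows "cell_sum t q (conjugate \<mu>) = cell_sum q t \<mu>"
proof -
  have 1: "cell_sum q t \<mu> = (\<Sum>(i, j)\<in>(SIGMA i:{..<length \<mu>}. {..<\<mu> ! i}). q ^ j * t ^ i)" for q t :: 'a and \<mu>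
    unfolding cell_sum_def by (subst sum.Sigma) auto
  define A where "A = (SIGMA i:{..<length \<mu>}. {..<\<mu> ! i})"
  define C where "C = (SIGMA i:{..<length (conjugate \<mu>)}. {..<conjugate \<mu> ! i})"
  have "(j, i) \<in> C \<longleftrightarrow> (i, j) \<in> A" for i j
    using conjugate_cells[OF assms, of j i] unfolding A_def C_def mem_Sigma_iff lessThan_iff by blast
  then have "C = prod.swap ` A" by force
  then have "(\<Sum>(i, j)\<in>C. t ^ j * q ^ i) = (\<Sum>(i, j)\<in>A. q ^ j * t ^ i)"
    by (simp add: sum.reindex split_beta mult.commute)
  then show ?thesis unfolding 1 A_def C_def .
qed

lemma cell_sum_Cons: "cell_sum q t (a # \<mu>) = (\<Sum>j<a. q ^ j) + t * cell_sum q t \<mu>"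
  by (simp add: cell_sum_def sum.lessThan_Suc_shift sum_distrib_left mult_ac del: sum.lessThan_Suc)

lemma eigenval_cell_sum: "eigenval q t \<mu> = 1 - (1 - q) * (1 - t) * cell_sum q t \<mu>"
proof (induction \<mu>)
  case (Cons a \<mu>)
  have g: "(1 - q) * (\<Sum>j<a. q ^ j) = 1 - q ^ a"
  proof (induction a)
    case (Suc a)
    then show ?case by (simp add: distrib_left) (simp add: algebra_simps)
  qed simp
  have "(1 - q) * (1 - t) * cell_sum q t (a # \<mu>) =
      (1 - t) * ((1 - q) * (\<Sum>j<a. q ^ j)) + t * ((1 - q) * (1 - t) * cell_sum q t \<mu>)"
    by (simp add: cell_sum_Cons algebra_simps)
  moreover have "eigenval q t (a # \<mu>) = t * (1 - (1 - q) * (1 - t) * cell_sum q t \<mu>) + (1 - t) * q ^ a"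
    using Cons by simp
  moreover have "\<dots> = 1 - ((1 - t) * (1 - q ^ a) + t * ((1 - q) * (1 - t) * cell_sum q t \<mu>))"
    by (simp add: algebra_simps)
  ultimately show ?case unfolding g by simp
qed (simp add: cell_sum_def)

lemma eigenval_conjugate: "is_partition \<mu> \<Longrightarrow> eigenval t q (conjugate \<mu>) = eigenval q t \<mu>"
  by (simp add: eigenval_cell_sum cell_sum_conjugate mult.commute mult.left_commute)

subsection \<open>Triangular operators with simple spectrum\<close>

text \<open>The Lagrange polynomial \<Prod> (T - l_\<nu>)/(l_\<mu> - l_\<nu>) applied to f. It is a
  finite recipe in T and the eigenvalues, hence compatible with specialization as long as the
  differences stay nonzero.\<close>

definition spectral_proj :: "('a :: field symf \<Rightarrow> 'a symf) \<Rightarrow> ('i \<Rightarrow> 'a) \<Rightarrow> 'i list \<Rightarrow> 'i \<Rightarrow> 'a symf \<Rightarrow> 'a symf" where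
  "spectral_proj T l xs \<mu> f =
    foldr (\<lambda>\<nu> g. scale_symf (inverse (l \<mu> - l \<nu>)) (T g - scale_symf (l \<nu>) g)) xs f"

locale linear_op =
  fixes T :: "'a :: field symf \<Rightarrow> 'a symf"
  assumes T_add: "T (f + g) = T f + T g" and T_scale: "T (scale_symf c f) = scale_symf c (T f)"
begin

lemma T_0 [simp]: "T 0 = 0"
  using T_scale[of 0 0] by simp

lemma T_diff: "T (f - g) = T f - T g"
  using T_add[of "f - g" g] by simp

lemma spectral_proj_add: "spectral_proj T l xs \<mu> (f + g) = spectral_proj T l xs \<mu> f + spectral_proj T l xs \<mu> g"
  by (induction xs) (simp_all add: spectral_proj_def T_add symf.scale_right_distrib symf.scale_right_diff_distrib algebra_simps)

lemma spectral_proj_scale: "spectral_proj T l xs \<mu> (scale_symf c f) = scale_symf c (spectral_proj T l xs \<mu> f)"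
  by (induction xs) (simp_all add: spectral_proj_def T_scale symf.scale_right_diff_distrib mult_ac)

lemma spectral_proj_0 [simp]: "spectral_proj T l xs \<mu> 0 = 0"
  using spectral_proj_scale[of l xs \<mu> 0 0] by simp

lemma spectral_proj_sum: "spectral_proj T l xs \<mu> (sum f A) = (\<Sum>x\<in>A. spectral_proj T l xs \<mu> (f x))"
  by (induction A rule: infinite_finite_induct) (auto simp: spectral_proj_add)

lemma spectral_proj_eigen:
  assumes "T f = scale_symf (l \<kappa>) f"
  shows "spectral_proj T l xs \<mu> f = scale_symf (\<Prod>\<nu>\<leftarrow>xs. (l \<kappa> - l \<nu>) / (l \<mu> - l \<nu>)) f"
proof (induction xs)
  case (Cons \<kappa>' xs)
  let ?c = "\<Prod>\<nu>\<leftarrow>xs. (l \<kappa> - l \<nu>) / (l \<mu> - l \<nu>)"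
  have "spectral_proj T l (\<kappa>' # xs) \<mu> f =
      scale_symf (inverse (l \<mu> - l \<kappa>')) (T (scale_symf ?c f) - scale_symf (l \<kappa>') (scale_symf ?c f))"
    using Cons by (simp add: spectral_proj_def)
  also have "T (scale_symf ?c f) - scale_symf (l \<kappa>') (scale_symf ?c f) = scale_symf ((l \<kappa> - l \<kappa>') * ?c) f"
    by (simp add: T_scale assms symf.scale_left_diff_distrib right_diff_distrib mult.commute[of _ ?c])
  finally show ?case by (simp add: divide_inverse mult_ac)
qed (simp add: spectral_proj_def)

lemma spectral_proj_eigen_same:
  assumes "T f = scale_symf (l \<mu>) f" "\<And>\<nu>. \<nu> \<in> set xs \<Longrightarrow> l \<nu> \<noteq> l \<mu>"
  shows "spectral_proj T l xs \<mu> f = f"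
proof -
  have "\<forall>\<nu>\<in>set xs. l \<mu> - l \<nu> \<noteq> 0" using assms(2) by force
  then have "(\<Prod>\<nu>\<leftarrow>xs. (l \<mu> - l \<nu>) / (l \<mu> - l \<nu>)) = 1"
    by (induction xs) auto
  then show ?thesis by (simp add: spectral_proj_eigen[where \<kappa> = \<mu> and l = l, OF assms(1)])
qed

lemma spectral_proj_eigen_other:
  assumes "T f = scale_symf (l \<kappa>) f" "\<kappa> \<in> set xs"
  shows "spectral_proj T l xs \<mu> f = 0"
proof -
  have "(\<Prod>\<nu>\<leftarrow>xs. (l \<kappa> - l \<nu>) / (l \<mu> - l \<nu>)) = 0"
    using assms(2) by (induction xs) auto
  then show ?thesis by (simp add: spectral_proj_eigen[where \<kappa> = \<kappa> and l = l, OF assms(1)])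
qed

end

text \<open>The order on the index set is encoded by its strict up-sets \<open>up \<mu>\<close>
  alone; since the index set is finite, \<open>up_induct\<close> can descend on their size.\<close>

locale triangular_op = linear_op T for T :: "'a :: field symf \<Rightarrow> 'a symf" +
  fixes P :: "'i set" and up :: "'i \<Rightarrow> 'i set" and b :: "'i \<Rightarrow> 'a symf" and l :: "'i \<Rightarrow> 'a"
  assumes finite_P: "finite P"
    and up_P: "\<mu> \<in> P \<Longrightarrow> up \<mu> \<subseteq> P" and up_irrefl: "\<mu> \<notin> up \<mu>"
    and up_trans: "\<mu> \<in> P \<Longrightarrow> \<nu> \<in> up \<mu> \<Longrightarrow> up \<nu> \<subseteq> up \<mu>"
    and T_b: "\<mu> \<in> P \<Longrightarrow> T (b \<mu>) - scale_symf (l \<mu>) (b \<mu>) \<in> symf.span (b ` up \<mu>)"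
    and inj_l: "inj_on l P"
begin

lemma up_induct [consumes 1, case_names step]:
  assumes "\<mu> \<in> P" "\<And>\<mu>. \<mu> \<in> P \<Longrightarrow> (\<And>\<nu>. \<nu> \<in> up \<mu> \<Longrightarrow> Q \<nu>) \<Longrightarrow> Q \<mu>"
  shows "Q \<mu>"
  using assms(1)
proof (induction "card (up \<mu>)" arbitrary: \<mu> rule: less_induct)
  case less
  show ?case
  proof (rule assms(2)[OF less.prems])
    fix \<nu> assume nu: "\<nu> \<in> up \<mu>"
    have "up \<nu> \<subset> up \<mu>" using up_trans[OF less.prems nu] nu up_irrefl by blast
    moreover have "finite (up \<mu>)" using finite_P up_P[OF less.prems] finite_subset by blast
    ultimately have "card (up \<nu>) < card (up \<mu>)" by (meson psubset_card_mono)
    then show "Q \<nu>" using less.hyps nu up_P[OF less.prems] by blast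
  qed
qed

text \<open>Above \<mu> the eigenvectors span the same space as the b_\<nu>, and on that space T -
  l_\<mu> is diagonal with nonzero entries l_\<nu> - l_\<mu>. So the equation (T - l_\<mu>) w = (T -
  l_\<mu>) b_\<mu> has a solution w there, and b_\<mu> - w is the eigenvector.\<close>

lemma eigenvector_exists:
  assumes "\<mu> \<in> P"
  shows "\<exists>v. T v = scale_symf (l \<mu>) v \<and> v - b \<mu> \<in> symf.span (b ` up \<mu>)"
  using assms
proof (induction rule: up_induct)
  case (step \<mu>)
  then obtain v where v: "\<And>\<nu>. \<nu> \<in> up \<mu> \<Longrightarrow> T (v \<nu>) = scale_symf (l \<nu>) (v \<nu>) \<and> v \<nu> - b \<nu> \<in> symf.span (b ` up \<nu>)"
    by metis
  have bv: "\<nu> \<in> up \<mu> \<longrightarrow> b \<nu> \<in> symf.span (v ` up \<mu>)" if "\<nu> \<in> P" for \<nu>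
    using that
  proof (induction rule: up_induct)
    case (step \<nu>)
    show ?case
    proof
      assume nu: "\<nu> \<in> up \<mu>"
      then have "up \<nu> \<subseteq> up \<mu>" using up_trans \<open>\<mu> \<in> P\<close> by blast
      then have "b ` up \<nu> \<subseteq> symf.span (v ` up \<mu>)" using step.IH by blast
      then have "symf.span (b ` up \<nu>) \<subseteq> symf.span (v ` up \<mu>)"
        by (rule symf.span_minimal) simp
      then have 1: "v \<nu> - b \<nu> \<in> symf.span (v ` up \<mu>)" using v[OF nu] by blast
      have 2: "v \<nu> \<in> symf.span (v ` up \<mu>)" using nu by (simp add: symf.span_base)
      have "v \<nu> - (v \<nu> - b \<nu>) \<in> symf.span (v ` up \<mu>)" by (rule symf.span_diff[OF 2 1])
      then show "b \<nu> \<in> symf.span (v ` up \<mu>)" by simp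
    qed
  qed
  have vb: "symf.span (v ` up \<mu>) \<subseteq> symf.span (b ` up \<mu>)"
  proof (rule symf.span_minimal)
    show "v ` up \<mu> \<subseteq> symf.span (b ` up \<mu>)"
    proof clarify
      fix \<nu> assume nu: "\<nu> \<in> up \<mu>"
      have "symf.span (b ` up \<nu>) \<subseteq> symf.span (b ` up \<mu>)"
        using up_trans[OF step.hyps nu] by (intro symf.span_mono) auto
      then have "v \<nu> - b \<nu> \<in> symf.span (b ` up \<mu>)" using v[OF nu] by blast
      moreover have "b \<nu> \<in> symf.span (b ` up \<mu>)" using nu by (simp add: symf.span_base)
      ultimately have "(v \<nu> - b \<nu>) + b \<nu> \<in> symf.span (b ` up \<mu>)" by (rule symf.span_add)
      then show "v \<nu> \<in> symf.span (b ` up \<mu>)" by simp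
    qed
  qed simp
  have solve: "\<exists>w\<in>symf.span (v ` up \<mu>). T w - scale_symf (l \<mu>) w = u" if "u \<in> symf.span (v ` up \<mu>)" for u
    using that
  proof (induction rule: symf.span_induct_alt)
    case base
    show ?case by (intro bexI[of _ 0]) (auto simp: symf.span_zero)
  next
    case (step c x y)
    then obtain \<nu> w where nu: "\<nu> \<in> up \<mu>" "x = v \<nu>" and w: "w \<in> symf.span (v ` up \<mu>)" "T w - scale_symf (l \<mu>) w = y"
      by blast
    define d where "d = l \<nu> - l \<mu>"
    have "d \<noteq> 0"
      using inj_l nu up_P[OF \<open>\<mu> \<in> P\<close>] up_irrefl \<open>\<mu> \<in> P\<close> unfolding d_def inj_on_def
      by (metis eq_iff_diff_eq_0 subsetD)
    define k where "k = c / d"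
    have "T (scale_symf k x) - scale_symf (l \<mu>) (scale_symf k x) = scale_symf (k * d) x"
      using v[OF nu(1)] nu(2)
      by (simp add: T_scale d_def right_diff_distrib symf.scale_left_diff_distrib mult.commute)
    then have "T (scale_symf k x + w) - scale_symf (l \<mu>) (scale_symf k x + w) = scale_symf (k * d) x + y"
      using w(2) unfolding T_add symf.scale_right_distrib by (metis add_diff_add)
    then show ?case
      using \<open>d \<noteq> 0\<close> symf.span_add[OF symf.span_scale[OF symf.span_base] w(1), of x k] nu
      by (intro bexI[of _ "scale_symf k x + w"]) (auto simp: k_def)
  qed
  define u where "u = T (b \<mu>) - scale_symf (l \<mu>) (b \<mu>)"
  have "b ` up \<mu> \<subseteq> symf.span (v ` up \<mu>)" using bv up_P[OF step.hyps] by blast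
  then have "symf.span (b ` up \<mu>) \<subseteq> symf.span (v ` up \<mu>)" by (rule symf.span_minimal) simp
  then have "u \<in> symf.span (v ` up \<mu>)" using T_b[OF step.hyps] by (auto simp: u_def)
  then obtain w where w: "w \<in> symf.span (v ` up \<mu>)" "T w - scale_symf (l \<mu>) w = u"
    using solve by blast
  have "T (b \<mu> - w) = scale_symf (l \<mu>) (b \<mu> - w)"
    using w(2) unfolding u_def T_diff symf.scale_right_diff_distrib by (simp add: algebra_simps)
  moreover have "b \<mu> - w - b \<mu> \<in> symf.span (b ` up \<mu>)"
    using w(1) vb by (auto intro: symf.span_neg)
  ultimately show ?case by blast
qed

definition eigvec :: "'i \<Rightarrow> 'a symf" where
  "eigvec \<mu> = (SOME v. T v = scale_symf (l \<mu>) v \<and> v - b \<mu> \<in> symf.span (b ` up \<mu>))"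

lemma eigvec:
  assumes "\<mu> \<in> P"
  shows T_eigvec: "T (eigvec \<mu>) = scale_symf (l \<mu>) (eigvec \<mu>)"
    and eigvec_diff: "eigvec \<mu> - b \<mu> \<in> symf.span (b ` up \<mu>)"
  using someI_ex[OF eigenvector_exists[OF assms]] unfolding eigvec_def by blast+

lemma b_span_eigvec:
  assumes "\<mu> \<in> P"
  shows "b \<mu> - eigvec \<mu> \<in> symf.span (eigvec ` up \<mu>) \<and> symf.span (b ` insert \<mu> (up \<mu>)) \<subseteq> symf.span (eigvec ` insert \<mu> (up \<mu>))"
  using assms
proof (induction rule: up_induct)
  case (step \<mu>)
  have "b ` up \<mu> \<subseteq> symf.span (eigvec ` up \<mu>)"
  proof clarify
    fix \<nu> assume nu: "\<nu> \<in> up \<mu>"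
    have "b \<nu> \<in> symf.span (eigvec ` insert \<nu> (up \<nu>))"
      using step.IH[OF nu] symf.span_base[of "b \<nu>" "b ` insert \<nu> (up \<nu>)"] by blast
    moreover have "insert \<nu> (up \<nu>) \<subseteq> up \<mu>" using up_trans[OF step.hyps nu] nu by blast
    ultimately show "b \<nu> \<in> symf.span (eigvec ` up \<mu>)" by (meson image_mono subsetD symf.span_mono)
  qed
  note bsub = this
  then have sub: "symf.span (b ` up \<mu>) \<subseteq> symf.span (eigvec ` up \<mu>)" by (rule symf.span_minimal) simp
  then have "- (eigvec \<mu> - b \<mu>) \<in> symf.span (eigvec ` up \<mu>)"
    using eigvec_diff[OF step.hyps] by (intro symf.span_neg) blast
  then have 1: "b \<mu> - eigvec \<mu> \<in> symf.span (eigvec ` up \<mu>)" by simp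
  have sub2: "symf.span (eigvec ` up \<mu>) \<subseteq> symf.span (eigvec ` insert \<mu> (up \<mu>))"
    by (rule symf.span_mono) auto
  have "(b \<mu> - eigvec \<mu>) + eigvec \<mu> \<in> symf.span (eigvec ` insert \<mu> (up \<mu>))"
    using 1 sub2 by (intro symf.span_add) (auto intro: symf.span_base)
  then have "symf.span (b ` insert \<mu> (up \<mu>)) \<subseteq> symf.span (eigvec ` insert \<mu> (up \<mu>))"
    using bsub sub2 by (intro symf.span_minimal) auto
  with 1 show ?case by blast
qed

lemma eigvec_in_span:
  assumes "\<mu> \<in> P"
  shows "eigvec \<mu> \<in> symf.span (b ` insert \<mu> (up \<mu>))"
proof -
  have "(eigvec \<mu> - b \<mu>) + b \<mu> \<in> symf.span (b ` insert \<mu> (up \<mu>))"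
    using eigvec_diff[OF assms] symf.span_mono[of "b ` up \<mu>" "b ` insert \<mu> (up \<mu>)"]
    by (intro symf.span_add) (auto intro: symf.span_base)
  then show ?thesis by simp
qed

lemma span_b_eq: "symf.span (b ` P) = symf.span (eigvec ` P)"
proof
  show "symf.span (b ` P) \<subseteq> symf.span (eigvec ` P)"
  proof (rule symf.span_minimal)
    show "b ` P \<subseteq> symf.span (eigvec ` P)"
    proof clarify
      fix \<mu> assume mu: "\<mu> \<in> P"
      have "b \<mu> \<in> symf.span (eigvec ` insert \<mu> (up \<mu>))"
        using b_span_eigvec[OF mu] symf.span_base[of "b \<mu>" "b ` insert \<mu> (up \<mu>)"] by blast
      then show "b \<mu> \<in> symf.span (eigvec ` P)"
        using mu up_P[OF mu] symf.span_mono[of "eigvec ` insert \<mu> (up \<mu>)" "eigvec ` P"] by blast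
    qed
  qed simp
  show "symf.span (eigvec ` P) \<subseteq> symf.span (b ` P)"
  proof (rule symf.span_minimal)
    show "eigvec ` P \<subseteq> symf.span (b ` P)"
    proof clarify
      fix \<mu> assume mu: "\<mu> \<in> P"
      show "eigvec \<mu> \<in> symf.span (b ` P)"
        using eigvec_in_span[OF mu] mu up_P[OF mu] symf.span_mono[of "b ` insert \<mu> (up \<mu>)" "b ` P"] by blast
    qed
  qed simp
qed

definition index_list :: "'i \<Rightarrow> 'i list" where
  "index_list \<mu> = (SOME xs. set xs = P - {\<mu>})"

lemma set_index_list: "set (index_list \<mu>) = P - {\<mu>}"
  unfolding index_list_def using finite_P by (intro someI_ex[of "\<lambda>xs. set xs = P - {\<mu>}"]) (simp add: finite_list)

definition proj :: "'i \<Rightarrow> 'a symf \<Rightarrow> 'a symf" where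
  "proj \<mu> = spectral_proj T l (index_list \<mu>) \<mu>"

lemma proj_eigen:
  assumes "\<mu> \<in> P" "\<kappa> \<in> P" "T f = scale_symf (l \<kappa>) f"
  shows "proj \<mu> f = (if \<kappa> = \<mu> then f else 0)"
proof (cases "\<kappa> = \<mu>")
  case True
  then show ?thesis using assms inj_l unfolding proj_def
    by (auto simp: set_index_list inj_on_def intro!: spectral_proj_eigen_same)
next
  case False
  then show ?thesis using assms unfolding proj_def
    by (auto simp: set_index_list intro!: spectral_proj_eigen_other[where \<kappa> = \<kappa>])
qed

lemma proj_eigvec: "\<mu> \<in> P \<Longrightarrow> \<kappa> \<in> P \<Longrightarrow> proj \<mu> (eigvec \<kappa>) = (if \<kappa> = \<mu> then eigvec \<mu> else 0)"
  using proj_eigen[OF _ _ T_eigvec] by auto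

lemma proj_add: "proj \<mu> (f + g) = proj \<mu> f + proj \<mu> g"
  by (simp add: proj_def spectral_proj_add)

lemma proj_scale: "proj \<mu> (scale_symf c f) = scale_symf c (proj \<mu> f)"
  by (simp add: proj_def spectral_proj_scale)

lemma proj_0 [simp]: "proj \<mu> 0 = 0"
  by (simp add: proj_def)

lemma proj_span_eigvec:
  assumes "f \<in> symf.span (eigvec ` S)" "S \<subseteq> P" "\<mu> \<in> P"
  shows "(\<exists>a. proj \<mu> f = scale_symf a (eigvec \<mu>)) \<and> (\<mu> \<notin> S \<longrightarrow> proj \<mu> f = 0)"
  using assms(1)
proof (induction rule: symf.span_induct_alt)
  case base
  then show ?case by (auto intro: exI[of _ 0])
next
  case (step c x y)
  then obtain a \<kappa> where a: "proj \<mu> y = scale_symf a (eigvec \<mu>)" and k: "\<kappa> \<in> S" "x = eigvec \<kappa>" by blast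
  then have px: "proj \<mu> x = scale_symf (if \<kappa> = \<mu> then 1 else 0) (eigvec \<mu>)"
    using assms proj_eigvec[of \<mu> \<kappa>] by auto
  have "proj \<mu> (scale_symf c x + y) = scale_symf (c * (if \<kappa> = \<mu> then 1 else 0) + a) (eigvec \<mu>)"
    by (simp only: proj_add proj_scale px a symf.scale_left_distrib symf.scale_scale)
  moreover have "proj \<mu> (scale_symf c x + y) = 0" if "\<mu> \<notin> S"
    using that step k px by (auto simp: proj_add proj_scale)
  ultimately show ?case by blast
qed

lemma proj_span: "f \<in> symf.span (b ` P) \<Longrightarrow> \<mu> \<in> P \<Longrightarrow> \<exists>a. proj \<mu> f = scale_symf a (eigvec \<mu>)"
  using proj_span_eigvec[of f P \<mu>] by (simp add: span_b_eq)

lemma sum_proj: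
  assumes "f \<in> symf.span (b ` P)"
  shows "f = (\<Sum>\<mu>\<in>P. proj \<mu> f)"
  using assms unfolding span_b_eq
proof (induction rule: symf.span_induct_alt)
  case (step c x y)
  then obtain \<kappa> where k: "\<kappa> \<in> P" "x = eigvec \<kappa>" by blast
  have "(\<Sum>\<mu>\<in>P. proj \<mu> x) = (\<Sum>\<mu>\<in>P. if \<mu> = \<kappa> then x else 0)"
    using k by (intro sum.cong) (auto simp: proj_eigvec)
  then have "(\<Sum>\<mu>\<in>P. proj \<mu> x) = x" using k finite_P by simp
  moreover have "(\<Sum>\<mu>\<in>P. proj \<mu> (scale_symf c x + y)) = scale_symf c (\<Sum>\<mu>\<in>P. proj \<mu> x) + (\<Sum>\<mu>\<in>P. proj \<mu> y)"
    by (simp add: proj_add proj_scale sum.distrib scale_symf_sum_right)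
  ultimately show ?case using step by simp
qed simp

lemma eigen_multiple:
  assumes "f \<in> symf.span (b ` P)" "\<mu> \<in> P" "T f = scale_symf (l \<mu>) f"
  shows "\<exists>a. f = scale_symf a (eigvec \<mu>)"
  using proj_span[OF assms(1,2)] proj_eigen[OF assms(2,2,3)] by simp

text \<open>The difference between b_\<mu> and its eigenvector lies in eigenlines above \<mu>, which
  the projection kills. This replaces the choice made in \<open>eigvec\<close> by a formula, and it
  is the formula that specializes.\<close>

lemma proj_b: "\<mu> \<in> P \<Longrightarrow> proj \<mu> (b \<mu>) = eigvec \<mu>"
proof -
  assume mu: "\<mu> \<in> P"
  have "proj \<mu> (b \<mu> - eigvec \<mu>) = 0"
    using proj_span_eigvec[of "b \<mu> - eigvec \<mu>" "up \<mu>" \<mu>] b_span_eigvec[OF mu] mu up_P up_irrefl by blast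
  then have "proj \<mu> (b \<mu> - eigvec \<mu>) + proj \<mu> (eigvec \<mu>) = eigvec \<mu>" using mu by (simp add: proj_eigvec)
  then show ?thesis by (simp flip: proj_add)
qed

lemma proj_span_up:
  assumes "\<mu> \<in> P" "\<nu> \<in> P" "f \<in> symf.span (b ` insert \<mu> (up \<mu>))" "\<nu> \<notin> insert \<mu> (up \<mu>)"
  shows "proj \<nu> f = 0"
  using proj_span_eigvec[of f "insert \<mu> (up \<mu>)" \<nu>] b_span_eigvec[OF assms(1)] assms up_P[OF assms(1)] by blast

end


subsection \<open>Homogeneous symmetric functions\<close>

lemma homogeneous_power_sum_part:
  "0 \<notin> set \<mu> \<Longrightarrow> sum_list \<mu> = n \<Longrightarrow> homogeneous_symf n (power_sum_part \<mu> :: 'a :: field_char_0 symf)"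
  unfolding homogeneous_symf_def using power_sum_count_nonzero by (auto simp: coeff_power_sum_part)

lemma homogeneous_add: "homogeneous_symf n f \<Longrightarrow> homogeneous_symf n g \<Longrightarrow> homogeneous_symf n (f + g)"
  unfolding homogeneous_symf_def by (metis add_0 coeff_symf_add)

lemma homogeneous_scale: "homogeneous_symf n f \<Longrightarrow> homogeneous_symf n (scale_symf c f)"
  unfolding homogeneous_symf_def by (metis coeff_symf_scale mult_zero_right)

lemma homogeneous_zero [simp]: "homogeneous_symf n 0"
  by (simp add: homogeneous_symf_def)

lemma homogeneous_sum: "(\<And>x. x \<in> A \<Longrightarrow> homogeneous_symf n (f x)) \<Longrightarrow> homogeneous_symf n (sum f A)"
  by (induction A rule: infinite_finite_induct) (auto intro: homogeneous_add)

lemma homogeneous_mult: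
  assumes "homogeneous_symf n f" "homogeneous_symf k g"
  shows "homogeneous_symf (n + k) (f * g)"
  unfolding homogeneous_symf_def
proof (intro allI impI)
  fix m assume "coeff_symf (f * g) m \<noteq> 0"
  then obtain a b where "(a, b) \<in> splittings m" "coeff_symf f a * coeff_symf g b \<noteq> 0"
    unfolding coeff_symf_mult by (force elim: sum.not_neutral_contains_not_neutral)
  moreover from this have "coeff_symf f a \<noteq> 0" "coeff_symf g b \<noteq> 0" by auto
  then have "size a = n" "size b = k" using assms unfolding homogeneous_symf_def by blast+
  ultimately show "size m = n + k" by (auto simp: splittings_def)
qed

lemma homogeneous_one: "homogeneous_symf 0 1"
  by (simp add: homogeneous_symf_def coeff_symf_one)

lemma homogeneous_h_prod: "homogeneous_symf (sum_list c) (h_prod c)"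
proof (induction c)
  case (Cons a c)
  have "homogeneous_symf a (complete_sym a)"
    by (simp add: homogeneous_symf_def complete_sym.rep_eq)
  then show ?case using Cons by (auto intro: homogeneous_mult)
qed (simp add: homogeneous_one)

text \<open>Cutting the expansion down to partitions of n does not change the function: at monomials
  of degree n the other terms vanish, and elsewhere both sides do. Uniqueness of the coefficients
  then rules the other terms out.\<close>

lemma power_sum_coeffs_homogeneous:
  fixes f :: "'a :: field_char_0 symf"
  assumes "homogeneous_symf n f" "power_sum_coeffs f \<mu> \<noteq> 0"
  shows "\<mu> \<in> partitions_of n"
proof -
  let ?c = "power_sum_coeffs f"
  define S where "S = {\<mu>. ?c \<mu> \<noteq> 0} \<inter> partitions_of n"
  define g where "g = (\<Sum>\<mu>\<in>S. scale_symf (?c \<mu>) (power_sum_part \<mu>))"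
  have S: "finite S" "\<And>\<mu>. \<mu> \<in> S \<Longrightarrow> is_partition \<mu>"
    by (simp add: S_def) (simp add: S_def partitions_of_def)
  have nz: "0 \<notin> set \<mu>" if "?c \<mu> \<noteq> 0" for \<mu>
    using power_sum_coeffs_partition[OF that] by (simp add: is_partition_def)
  have hg: "homogeneous_symf n g"
    unfolding g_def by (intro homogeneous_sum homogeneous_scale homogeneous_power_sum_part)
      (use S in \<open>auto simp: S_def is_partition_def partitions_of_def\<close>)
  have "f = g"
  proof (rule symf_eqI)
    fix m
    show "coeff_symf f m = coeff_symf g m"
    proof (cases "size m = n")
      case True
      have "coeff_symf f m = (\<Sum>\<mu> | ?c \<mu> \<noteq> 0. ?c \<mu> * coeff_symf (power_sum_part \<mu>) m)"
        by (subst (1) power_sum_expansion[of f, symmetric]) (simp only: coeff_symf_sum coeff_symf_scale)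
      also have "\<dots> = (\<Sum>\<mu>\<in>S. ?c \<mu> * coeff_symf (power_sum_part \<mu>) m)"
      proof (rule sum.mono_neutral_right)
        show "\<forall>\<mu>\<in>{\<mu>. ?c \<mu> \<noteq> 0} - S. ?c \<mu> * coeff_symf (power_sum_part \<mu>) m = 0"
        proof
          fix \<mu> assume mu: "\<mu> \<in> {\<mu>. ?c \<mu> \<noteq> 0} - S"
          then have "sum_list \<mu> \<noteq> n"
            using power_sum_coeffs_partition[of f \<mu>] by (auto simp: S_def partitions_of_def)
          then have "power_sum_count \<mu> m = 0"
            using power_sum_count_nonzero[of \<mu> m] nz[of \<mu>] mu True by auto
          then show "?c \<mu> * coeff_symf (power_sum_part \<mu>) m = 0"
            using nz[of \<mu>] mu by (simp add: coeff_power_sum_part)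
        qed
      qed (auto simp: finite_power_sum_coeffs S_def)
      also have "\<dots> = coeff_symf g m" by (simp add: g_def coeff_symf_sum)
      finally show ?thesis .
    next
      case False
      then show ?thesis using assms(1) hg unfolding homogeneous_symf_def by metis
    qed
  qed
  then have "?c = (\<lambda>\<mu>. if \<mu> \<in> S then ?c \<mu> else 0)"
    using power_sum_coeffs_sum[OF S, of ?c] by (simp add: g_def)
  then have "\<mu> \<in> S" using assms(2) by metis
  then show ?thesis by (simp add: S_def)
qed

lemma homogeneous_iff_span:
  "homogeneous_symf n f \<longleftrightarrow> f \<in> symf.span (power_sum_part ` partitions_of n)"
  for f :: "'a :: field_char_0 symf"
proof
  assume f: "homogeneous_symf n f"
  have "(\<Sum>\<mu> | power_sum_coeffs f \<mu> \<noteq> 0. scale_symf (power_sum_coeffs f \<mu>) (power_sum_part \<mu>))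
      \<in> symf.span (power_sum_part ` partitions_of n)"
    by (intro symf.span_sum symf.span_scale symf.span_base)
       (use power_sum_coeffs_homogeneous[OF f] in auto)
  then show "f \<in> symf.span (power_sum_part ` partitions_of n)" by (simp only: power_sum_expansion)
next
  assume "f \<in> symf.span (power_sum_part ` partitions_of n)"
  then show "homogeneous_symf n f"
    by (induction rule: symf.span_induct_alt)
       (auto intro!: homogeneous_add homogeneous_scale homogeneous_power_sum_part
         simp: partitions_of_def is_partition_def)
qed

section \<open>Products of complete functions span each degree\<close>

definition h_span :: "nat \<Rightarrow> 'a :: field_char_0 symf set" where
  "h_span n = symf.span (h_prod ` {c. sum_list c = n})"

lemma h_span_mult: "f \<in> h_span a \<Longrightarrow> g \<in> h_span b \<Longrightarrow> f * g \<in> h_span (a + b)"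
proof -
  assume f: "f \<in> h_span a" and g: "g \<in> h_span b"
  have "h_prod c * g \<in> h_span (a + b)" if "sum_list c = a" for c
    using g unfolding h_span_def
  proof (rule span_times)
    fix x :: "'a symf" assume "x \<in> h_prod ` {c. sum_list c = b}"
    then obtain d where d: "x = h_prod d" "sum_list d = b" by auto
    show "h_prod c * x \<in> symf.span (h_prod ` {c. sum_list c = a + b})"
      by (rule symf.span_base, rule image_eqI[of _ _ "c @ d"]) (use d that in \<open>auto simp: h_prod_def\<close>)
  qed
  then have "g * x \<in> h_span (a + b)" if "x \<in> h_prod ` {c. sum_list c = a}" for x
    using that by (auto simp: mult.commute)
  then have "g * f \<in> h_span (a + b)"
    using f span_times[of f "h_prod ` {c. sum_list c = a}" g] unfolding h_span_def by blast
  then show ?thesis by (simp add: mult.commute)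
qed

lemma h_prod_in_h_span: "sum_list c = n \<Longrightarrow> h_prod c \<in> h_span n"
  unfolding h_span_def by (intro symf.span_base) auto

text \<open>Newton's identity solved for p_n: the term k = n is p_n itself because h_0 = 1, and the
  remaining terms involve smaller power sums.\<close>

lemma power_sum_in_h_span: "n > 0 \<Longrightarrow> power_sum n \<in> (h_span n :: 'a :: field_char_0 symf set)"
proof (induction n rule: less_induct)
  case (less n)
  have h: "complete_sym k \<in> h_span k" for k
    using h_prod_in_h_span[of "[k]" k] by simp
  have "of_nat n * complete_sym n = (\<Sum>k=1..n. power_sum k * complete_sym (n - k) :: 'a symf)"
    using newton_complete_sym unfolding newton_iff fps_nth_Abs_fps by blast
  also have "{1..n} = insert n {1..<n}" using less.prems by auto
  finally have "power_sum n = of_nat n * complete_sym n - (\<Sum>k\<in>{1..<n}. power_sum k * complete_sym (n - k) :: 'a symf)"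
    by simp
  also have "of_nat n * complete_sym n = scale_symf (of_nat n) (complete_sym n)"
    by (simp add: scale_symf_def const_symf_of_nat)
  also have "scale_symf (of_nat n) (complete_sym n) - (\<Sum>k\<in>{1..<n}. power_sum k * complete_sym (n - k)) \<in> (h_span n :: 'a symf set)"
  proof -
    have "power_sum k * complete_sym (n - k) \<in> (h_span n :: 'a symf set)" if "k \<in> {1..<n}" for k
      using h_span_mult[OF less.IH[of k] h[of "n - k"]] that by auto
    then show ?thesis
      using h[of n] unfolding h_span_def by (intro symf.span_diff symf.span_scale symf.span_sum) auto
  qed
  finally show ?case .
qed

lemma power_sum_part_in_h_span: "0 \<notin> set \<mu> \<Longrightarrow> power_sum_part \<mu> \<in> h_span (sum_list \<mu>)"
proof (induction \<mu>)
  case Nil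
  then show ?case using h_prod_in_h_span[of "[]" 0] by simp
next
  case (Cons k \<mu>)
  then show ?case by (auto intro!: h_span_mult power_sum_in_h_span)
qed

lemma homogeneous_iff_h_span:
  "homogeneous_symf n f \<longleftrightarrow> f \<in> symf.span (h_prod ` partitions_of n)"
  for f :: "'a :: field_char_0 symf"
proof
  assume "homogeneous_symf n f"
  then have "f \<in> symf.span (power_sum_part ` partitions_of n)" by (simp add: homogeneous_iff_span)
  moreover have "symf.span (power_sum_part ` partitions_of n) \<subseteq> (h_span n :: 'a symf set)"
  proof -
    have "power_sum_part ` partitions_of n \<subseteq> (h_span n :: 'a symf set)"
      using power_sum_part_in_h_span by (auto simp: partitions_of_def is_partition_def)
    then show ?thesis unfolding h_span_def by (rule symf.span_minimal) simp
  qed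
  moreover have "h_span n \<subseteq> (symf.span (h_prod ` partitions_of n) :: 'a symf set)"
    unfolding h_span_def
  proof (rule symf.span_minimal)
    show "h_prod ` {c. sum_list c = n} \<subseteq> (symf.span (h_prod ` partitions_of n) :: 'a symf set)"
    proof
      fix x :: "'a symf" assume "x \<in> h_prod ` {c. sum_list c = n}"
      then obtain c where c: "x = h_prod c" "sum_list c = n" by auto
      have "sort_part (mset c) \<in> partitions_of n"
        using c by (simp add: partitions_of_def sum_list_sort_part sum_mset_sum_list)
      then show "x \<in> symf.span (h_prod ` partitions_of n)"
        unfolding c(1) by (metis h_prod_sort_part image_eqI symf.span_base)
    qed
  qed simp
  ultimately show "f \<in> symf.span (h_prod ` partitions_of n)" by blast
next
  assume "f \<in> symf.span (h_prod ` partitions_of n)"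
  then show "homogeneous_symf n f"
    by (induction rule: symf.span_induct_alt)
       (auto intro!: homogeneous_add homogeneous_scale homogeneous_h_prod simp: partitions_of_def)
qed

lemma dilate_span: "f \<in> symf.span S \<Longrightarrow> dilate a f \<in> symf.span (dilate a ` S)"
proof (induction rule: symf.span_induct_alt)
  case (step c x y)
  then show ?case
    using symf.span_add[OF symf.span_scale[OF symf.span_base], of "dilate a x" "dilate a ` S" "dilate a y" c]
    by (simp add: dilate.hom_add dilate_scale)
qed (simp add: symf.span_zero)

lemma dilate_power_sum_part:
  "0 \<notin> set \<mu> \<Longrightarrow> dilate a (power_sum_part \<mu>) = scale_symf (prod_list (map a \<mu>)) (power_sum_part \<mu>)"
  by (induction \<mu>) (auto simp: dilate.hom_one dilate.hom_mult dilate_power_sum scale_symf_def const_symf_mult mult_ac)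

lemma homogeneous_dilate: "homogeneous_symf n f \<Longrightarrow> homogeneous_symf n (dilate a f)"
proof -
  assume "homogeneous_symf n f"
  then have "dilate a f \<in> symf.span (dilate a ` power_sum_part ` partitions_of n)"
    unfolding homogeneous_iff_span by (rule dilate_span)
  then show ?thesis
    by (induction rule: symf.span_induct_alt)
       (auto intro!: homogeneous_add homogeneous_scale homogeneous_power_sum_part
         simp: partitions_of_def is_partition_def dilate_power_sum_part)
qed

lemma power_sum_part_inj: "inj_on (power_sum_part :: _ \<Rightarrow> 'a :: field_char_0 symf) (partitions_of n)"
  unfolding inj_on_def using power_sum_coeffs_part[where 'a = 'a]
  by (metis (no_types, lifting) mem_Collect_eq partitions_of_def zero_neq_one)

lemma power_sum_part_independent_set:
  "symf.independent (power_sum_part ` partitions_of n :: 'a :: field_char_0 symf set)"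
proof
  assume "symf.dependent (power_sum_part ` partitions_of n :: 'a symf set)"
  then obtain u where u: "\<exists>v\<in>power_sum_part ` partitions_of n. u v \<noteq> (0 :: 'a)"
    "(\<Sum>v\<in>power_sum_part ` partitions_of n. scale_symf (u v) v) = 0"
    by (auto simp: symf.dependent_finite)
  have z: "(\<Sum>\<mu>\<in>partitions_of n. scale_symf (u (power_sum_part \<mu>)) (power_sum_part \<mu>)) = 0"
    using u(2) by (simp add: sum.reindex[OF power_sum_part_inj])
  have "u (power_sum_part \<mu>) = 0" if "\<mu> \<in> partitions_of n" for \<mu>
    by (rule power_sum_part_independent[OF finite_partitions_of _ z that]) (simp add: partitions_of_def)
  then show False using u(1) by blast
qed

text \<open>As many spanning vectors as there are partitions of \<open>n\<close>, so none of them is redundant.\<close>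

lemma spanning_family_minimal:
  fixes b :: "nat list \<Rightarrow> 'a :: field_char_0 symf"
  assumes span: "\<And>f. homogeneous_symf n f \<Longrightarrow> f \<in> symf.span (b ` partitions_of n)"
    and mu: "\<mu> \<in> partitions_of n"
  shows "b \<mu> \<notin> symf.span (b ` (partitions_of n - {\<mu>}))"
proof
  let ?P = "partitions_of n"
  assume "b \<mu> \<in> symf.span (b ` (?P - {\<mu>}))"
  then have "b ` ?P \<subseteq> symf.span (b ` (?P - {\<mu>}))"
    by (metis DiffI image_subsetI imageI singletonD symf.span_base)
  then have "symf.span (b ` ?P) \<subseteq> symf.span (b ` (?P - {\<mu>}))" by (rule symf.span_minimal) simp
  then have "power_sum_part ` ?P \<subseteq> symf.span (b ` (?P - {\<mu>}))"
  proof (intro image_subsetI)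
    fix \<nu> assume "\<nu> \<in> ?P"
    then have "homogeneous_symf n (power_sum_part \<nu> :: 'a symf)"
      by (intro homogeneous_power_sum_part) (auto simp: partitions_of_def is_partition_def)
    then have "power_sum_part \<nu> \<in> symf.span (b ` ?P)" by (rule span)
    then show "power_sum_part \<nu> \<in> symf.span (b ` (?P - {\<mu>}))"
      using \<open>symf.span (b ` ?P) \<subseteq> _\<close> by blast
  qed
  from symf.independent_span_bound[OF _ power_sum_part_independent_set this]
  have "card (power_sum_part ` ?P :: 'a symf set) \<le> card (b ` (?P - {\<mu>}))" by simp
  also have "\<dots> \<le> card (?P - {\<mu>})" by (rule card_image_le) simp
  also have "\<dots> < card ?P" by (rule psubset_card_mono) (use mu in auto)
  finally show False by (simp add: card_image[OF power_sum_part_inj])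
qed

subsection \<open>The Macdonald operator\<close>

lemma comm_ring_hom_map_poly:
  assumes "comm_ring_hom h"
  shows "comm_ring_hom (map_poly h)"
proof -
  interpret comm_ring_hom h by fact
  show ?thesis
  proof (rule comm_ring_homI)
    show "map_poly h 1 = 1" by (simp add: one_pCons map_poly_pCons hom_one)
    show "map_poly h (x + y) = map_poly h x + map_poly h y" for x y
      by (rule poly_eqI) (simp add: coeff_map_poly hom_add)
    show "map_poly h (x * y) = map_poly h x * map_poly h y" for x y
      by (rule poly_eqI) (simp add: coeff_map_poly coeff_mult hom_sum hom_mult)
  qed
qed

lemma hom_pair:
  assumes "comm_ring_hom h"
  shows "h (pair P w) = pair (map_poly h P) (\<lambda>i. h (w i))"
proof -
  interpret comm_ring_hom h by fact
  have "degree (map_poly h P) \<le> degree P" 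
    by (rule degree_le) (simp add: coeff_map_poly coeff_eq_0)
  then have "pair (map_poly h P) (\<lambda>i. h (w i)) = (\<Sum>i\<le>degree P. coeff (map_poly h P) i * h (w i))"
    by (rule pair_bound)
  then show ?thesis by (simp add: pair_def hom_sum hom_mult coeff_map_poly)
qed

text \<open>Both sides are f[A(X + Vw)].\<close>

lemma trans_dilate: "map_poly (dilate a) (trans (\<lambda>k. a k * v k) f) = trans v (dilate a f)"
proof (rule symf_hom_eqI[where \<phi> = "\<lambda>f. map_poly (dilate a) (trans (\<lambda>k. a k * v k) f)"
      and \<psi> = "\<lambda>f. trans v (dilate a f)"])
  interpret m: comm_ring_hom "map_poly (dilate a)"
    by (rule comm_ring_hom_map_poly[OF comm_ring_hom_dilate])
  show "comm_ring_hom (\<lambda>f. map_poly (dilate a) (trans (\<lambda>k. a k * v k) f))"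
    by (rule comm_ring_hom_comp[OF comm_ring_hom_map_poly[OF comm_ring_hom_dilate] comm_ring_hom_trans])
  show "comm_ring_hom (\<lambda>f. trans v (dilate a f))"
    by (rule comm_ring_hom_comp[OF comm_ring_hom_trans comm_ring_hom_dilate])
  show "map_poly (dilate a) (trans (\<lambda>k. a k * v k) (const_symf c)) = trans v (dilate a (const_symf c))" for c
    by (simp add: map_poly_pCons)
  show "map_poly (dilate a) (trans (\<lambda>k. a k * v k) (power_sum k)) = trans v (dilate a (power_sum k))" if "k > 0" for k
  proof -
    have "map_poly (dilate a) (monom (const_symf (a k * v k)) k) = monom (const_symf (a k * v k)) k"
      by (simp add: map_poly_monom)
    then show ?thesis
      using that by (simp add: trans_power_sum m.hom_add map_poly_pCons dilate_power_sum trans.hom_mult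
          smult_add_right smult_monom const_symf_mult)
  qed
qed

definition D0 :: "'a :: field_char_0 \<Rightarrow> 'a \<Rightarrow> 'a symf \<Rightarrow> 'a symf" where
  "D0 q t f = pair (trans (\<lambda>k. (1 - q ^ k) * (1 - t ^ k)) f) (\<lambda>i. (- 1) ^ i * elem_sym i)"

lemma D0_commute: "D0 q t = D0 t q"
  by (simp add: D0_def fun_eq_iff mult.commute)

text \<open>In the alphabet X(1 - q) the shift (1 - q)(1 - t)/z becomes (1 - t)/z, and (-1)^i e_i
  becomes \<open>geo q i\<close>.\<close>

lemma dilate_D0: "dilate (\<lambda>k. 1 - q ^ k) (D0 q t f) = lower q t 0 (dilate (\<lambda>k. 1 - q ^ k) f)"
  unfolding D0_def hom_pair[OF comm_ring_hom_dilate] trans_dilate lower_def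
  by (simp add: geo_def)

lemma linear_op_D0: "linear_op (D0 q t)"
  by unfold_locales (simp_all add: D0_def trans.hom_add pair_add trans_scale pair_smult scale_symf_def[of _ "pair _ _"])

section \<open>The operator in the basis h_\<mu>[X/(1 - q)]\<close>

definition h_dil :: "'a :: field_char_0 \<Rightarrow> nat list \<Rightarrow> 'a symf" where
  "h_dil q \<mu> = dilate (\<lambda>k. inverse (1 - q ^ k)) (h_prod \<mu>)"

lemma dilate_inverse:
  assumes "\<And>k. k > 0 \<Longrightarrow> q ^ k \<noteq> 1"
  shows "dilate (\<lambda>k. 1 - q ^ k) (dilate (\<lambda>k. inverse (1 - q ^ k)) f) = f"
    and "dilate (\<lambda>k. inverse (1 - q ^ k)) (dilate (\<lambda>k. 1 - q ^ k) f) = f"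
  by (rule dilate_dilate; use assms in force)+

lemma D0_h_dil:
  assumes q: "\<And>k. k > 0 \<Longrightarrow> q ^ k \<noteq> 1" and mu: "is_partition \<mu>"
  shows "D0 q t (h_dil q \<mu>) - scale_symf (eigenval q t \<mu>) (h_dil q \<mu>) \<in> symf.span (h_dil q ` (dom_up \<mu> - {\<mu>}))"
    (is "?X \<in> _")
proof -
  have "dilate (\<lambda>k. 1 - q ^ k) ?X = lower q t 0 (h_prod \<mu>) - scale_symf (eigenval q t \<mu>) (h_prod \<mu>)"
    by (simp add: dilate.hom_minus dilate_D0 dilate_scale h_dil_def dilate_inverse[OF q])
  also have "\<dots> \<in> symf.span (h_prod ` (dom_up \<mu> - {\<mu>}))"
    using lower_h_prod_diag strict_upset_subset[OF mu] by blast
  finally have "dilate (\<lambda>k. inverse (1 - q ^ k)) (dilate (\<lambda>k. 1 - q ^ k) ?X) \<in>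
      symf.span (dilate (\<lambda>k. inverse (1 - q ^ k)) ` h_prod ` (dom_up \<mu> - {\<mu>}))"
    by (rule dilate_span)
  then show ?thesis by (simp add: dilate_inverse[OF q] image_image h_dil_def)
qed

lemma dom_up_partitions_of: "\<mu> \<in> partitions_of n \<Longrightarrow> dom_up \<mu> \<subseteq> partitions_of n"
  by (auto simp: partitions_of_def dom_up_def dominates_def)

lemma homogeneous_h_dil_span:
  assumes q: "\<And>k. k > 0 \<Longrightarrow> q ^ k \<noteq> 1"
  shows "homogeneous_symf n f \<longleftrightarrow> f \<in> symf.span (h_dil q ` partitions_of n)"
proof
  assume "homogeneous_symf n f"
  then have "dilate (\<lambda>k. 1 - q ^ k) f \<in> symf.span (h_prod ` partitions_of n)"
    using homogeneous_dilate homogeneous_iff_h_span by blast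
  then have "dilate (\<lambda>k. inverse (1 - q ^ k)) (dilate (\<lambda>k. 1 - q ^ k) f) \<in>
      symf.span (dilate (\<lambda>k. inverse (1 - q ^ k)) ` h_prod ` partitions_of n)"
    by (rule dilate_span)
  then show "f \<in> symf.span (h_dil q ` partitions_of n)"
    by (simp add: dilate_inverse[OF q] image_image h_dil_def)
next
  assume "f \<in> symf.span (h_dil q ` partitions_of n)"
  then show "homogeneous_symf n f"
    by (induction rule: symf.span_induct_alt)
       (auto intro!: homogeneous_add homogeneous_scale homogeneous_dilate
         simp: partitions_of_def h_dil_def homogeneous_h_prod)
qed

lemma h_dil_span_iff:
  assumes q: "\<And>k. k > 0 \<Longrightarrow> q ^ k \<noteq> 1"
  shows "f \<in> symf.span (h_dil q ` S) \<longleftrightarrow> dilate (\<lambda>k. 1 - q ^ k) f \<in> symf.span (h_prod ` S)"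
proof
  assume "f \<in> symf.span (h_dil q ` S)"
  from dilate_span[OF this, of "\<lambda>k. 1 - q ^ k"]
  show "dilate (\<lambda>k. 1 - q ^ k) f \<in> symf.span (h_prod ` S)"
    by (simp add: image_image h_dil_def dilate_inverse[OF q])
next
  assume "dilate (\<lambda>k. 1 - q ^ k) f \<in> symf.span (h_prod ` S)"
  from dilate_span[OF this, of "\<lambda>k. inverse (1 - q ^ k)"]
  show "f \<in> symf.span (h_dil q ` S)"
    by (simp add: image_image dilate_inverse[OF q] flip: h_dil_def)
qed

text \<open>Kept abstract in its two parameters because it serves three pairs: (q, t), the swapped
  pair, and (q, 1/q).\<close>

locale macdonald =
  fixes q t :: "'a :: field_char_0"
  assumes q_generic: "k > 0 \<Longrightarrow> q ^ k \<noteq> 1" and t_generic: "k > 0 \<Longrightarrow> t ^ k \<noteq> 1"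
    and inj_eigenval: "inj_on (eigenval q t) (partitions_of n)"

lemma triangular_op_D0:
  assumes "\<And>k. k > 0 \<Longrightarrow> q ^ k \<noteq> (1 :: 'a :: field_char_0)" "inj_on (eigenval q t) (partitions_of n)"
  shows "triangular_op (D0 q t) (partitions_of n) (\<lambda>\<mu>. dom_up \<mu> - {\<mu>}) (h_dil q) (eigenval q t)"
proof (intro triangular_op.intro linear_op_D0 triangular_op_axioms.intro)
  fix \<mu> \<nu> assume mu: "\<mu> \<in> partitions_of n"
  show "dom_up \<mu> - {\<mu>} \<subseteq> partitions_of n" using dom_up_partitions_of[OF mu] by blast
  assume nu: "\<nu> \<in> dom_up \<mu> - {\<mu>}"
  then have "\<kappa> \<noteq> \<mu>" if "\<kappa> \<in> dom_up \<nu>" for \<kappa>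
    using that mu dominates_antisym[of \<mu> \<nu>] by (auto simp: dom_up_def partitions_of_def)
  then show "dom_up \<nu> - {\<nu>} \<subseteq> dom_up \<mu> - {\<mu>}"
    using nu dominates_trans by (auto simp: dom_up_def)
next
  fix \<mu> assume "\<mu> \<in> partitions_of n"
  then show "D0 q t (h_dil q \<mu>) - scale_symf (eigenval q t \<mu>) (h_dil q \<mu>) \<in> symf.span (h_dil q ` (dom_up \<mu> - {\<mu>}))"
    using D0_h_dil[OF assms(1), of \<mu> t] unfolding partitions_of_def by blast
qed (use assms in auto)

lemma dom_up_insert: "\<mu> \<in> partitions_of n \<Longrightarrow> insert \<mu> (dom_up \<mu> - {\<mu>}) = dom_up \<mu>"
  by (auto simp: dom_up_def partitions_of_def)

context macdonald
begin

sublocale tri: triangular_op "D0 q t" "partitions_of n" "\<lambda>\<mu>. dom_up \<mu> - {\<mu>}" "h_dil q" "eigenval q t" for n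
  by (rule triangular_op_D0[OF q_generic inj_eigenval])

text \<open>Exchanging q and t transposes the partition in the eigenvalue, and conjugation is
  injective on partitions.\<close>

lemma swap: "macdonald t q"
proof
  fix n :: nat
  show "inj_on (eigenval t q) (partitions_of n)"
  proof (rule inj_onI)
    fix \<mu> \<nu> assume *: "\<mu> \<in> partitions_of n" "\<nu> \<in> partitions_of n" "eigenval t q \<mu> = eigenval t q \<nu>"
    have p: "is_partition \<mu>" "is_partition \<nu>" using * by (auto simp: partitions_of_def)
    have "eigenval q t (conjugate \<mu>) = eigenval q t (conjugate \<nu>)"
      using * eigenval_conjugate[OF p(1), of q t] eigenval_conjugate[OF p(2), of q t] by simp
    then have "conjugate \<mu> = conjugate \<nu>"
      using * inj_eigenval[of n] conjugate_in_partitions_of by (meson inj_onD)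
    then show "\<mu> = \<nu>" using conjugate_conjugate p by metis
  qed
qed (use q_generic t_generic in auto)

lemma homogeneous_span: "homogeneous_symf n f \<longleftrightarrow> f \<in> symf.span (h_dil q ` partitions_of n)"
  by (rule homogeneous_h_dil_span[OF q_generic])

text \<open>A zero eigenvector would put its leading term in the span of the other members of a
  spanning family that has none to spare.\<close>

lemma eigvec_nonzero:
  assumes "\<mu> \<in> partitions_of n"
  shows "tri.eigvec \<mu> \<noteq> 0"
proof
  assume "tri.eigvec \<mu> = 0"
  then have "h_dil q \<mu> \<in> symf.span (h_dil q ` (dom_up \<mu> - {\<mu>}))"
    using symf.span_neg[OF tri.eigvec_diff[OF assms]] by simp
  moreover have "symf.span (h_dil q ` (dom_up \<mu> - {\<mu>})) \<subseteq> symf.span (h_dil q ` (partitions_of n - {\<mu>}))"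
    using dom_up_partitions_of[OF assms] by (intro symf.span_mono) auto
  ultimately show False
    using spanning_family_minimal[of n "h_dil q" \<mu>] homogeneous_span assms by auto
qed

text \<open>The eigenvector built for the swapped pair at \<mu>' has the same eigenvalue under the
  same operator. Eigenspaces in degree n are lines, so the two vectors are proportional.\<close>

lemma eigvec_dual_span:
  assumes mu: "\<mu> \<in> partitions_of n"
  shows "tri.eigvec \<mu> \<in> symf.span (h_dil t ` dom_up (conjugate \<mu>))"
proof -
  interpret d: macdonald t q by (rule swap)
  have cmu: "conjugate \<mu> \<in> partitions_of n" using mu by (rule conjugate_in_partitions_of)
  let ?v = "d.tri.eigvec (conjugate \<mu>)"
  have v: "?v \<in> symf.span (h_dil t ` dom_up (conjugate \<mu>))"
    using d.tri.eigvec_in_span[OF cmu] unfolding dom_up_insert[OF cmu] .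
  have "?v \<in> symf.span (h_dil t ` partitions_of n)"
    using v dom_up_partitions_of[OF cmu] symf.span_mono[of "h_dil t ` dom_up (conjugate \<mu>)"] by blast
  then have "?v \<in> symf.span (h_dil q ` partitions_of n)"
    using homogeneous_span d.homogeneous_span by blast
  moreover have "D0 q t ?v = scale_symf (eigenval q t \<mu>) ?v"
    using d.tri.T_eigvec[OF cmu] mu by (simp add: D0_commute[of t q] eigenval_conjugate partitions_of_def)
  ultimately obtain a where a: "?v = scale_symf a (tri.eigvec \<mu>)"
    using tri.eigen_multiple mu by blast
  have "a \<noteq> 0" using a d.eigvec_nonzero[OF cmu] by auto
  then have "tri.eigvec \<mu> = scale_symf (inverse a) ?v" using a by simp
  then show ?thesis using v by (simp add: symf.span_scale)
qed

text \<open>A component of f along \<nu> forces \<nu> \<ge> \<mu> by the first condition and \<nu>'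
  \<ge> \<mu>' by the second. Conjugation reverses dominance, so only \<nu> = \<mu>
  survives.\<close>

lemma macdonald_characterization:
  assumes mu: "\<mu> \<in> partitions_of n"
  shows "f \<in> symf.span (h_dil q ` dom_up \<mu>) \<and> f \<in> symf.span (h_dil t ` dom_up (conjugate \<mu>)) \<longleftrightarrow>
    (\<exists>a. f = scale_symf a (tri.eigvec \<mu>))"
proof
  assume "\<exists>a. f = scale_symf a (tri.eigvec \<mu>)"
  then show "f \<in> symf.span (h_dil q ` dom_up \<mu>) \<and> f \<in> symf.span (h_dil t ` dom_up (conjugate \<mu>))"
    using tri.eigvec_in_span[OF mu] eigvec_dual_span[OF mu]
    unfolding dom_up_insert[OF mu] by (auto intro: symf.span_scale)
next
  interpret d: macdonald t q by (rule swap)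
  have cmu: "conjugate \<mu> \<in> partitions_of n" using mu by (rule conjugate_in_partitions_of)
  assume f: "f \<in> symf.span (h_dil q ` dom_up \<mu>) \<and> f \<in> symf.span (h_dil t ` dom_up (conjugate \<mu>))"
  have fP: "f \<in> symf.span (h_dil q ` partitions_of n)"
    using f dom_up_partitions_of[OF mu] symf.span_mono[of "h_dil q ` dom_up \<mu>"] by blast
  have z: "tri.proj n \<nu> f = 0" if nu: "\<nu> \<in> partitions_of n" "\<nu> \<noteq> \<mu>" for \<nu>
  proof (cases "\<nu> \<in> dom_up \<mu>")
    case False
    then show ?thesis
      using f mu nu tri.proj_span_up[OF mu nu(1)] unfolding dom_up_insert[OF mu] by blast
  next
    case True
    have c: "\<kappa> = \<nu>" if "\<kappa> \<in> partitions_of n" "conjugate \<kappa> = conjugate \<nu>" for \<kappa>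
      using that nu conjugate_conjugate by (metis mem_Collect_eq partitions_of_def)
    have cnu: "conjugate \<nu> \<in> partitions_of n" using nu by (simp add: conjugate_in_partitions_of)
    have "\<not> dominates (conjugate \<nu>) (conjugate \<mu>)"
      using dominates_conjugate_antisym[of \<mu> \<nu>] True mu nu by (auto simp: dom_up_def partitions_of_def)
    then have "conjugate \<nu> \<notin> dom_up (conjugate \<mu>)" by (simp add: dom_up_def)
    \<comment> \<open>The projection of the swapped pair onto \<nu>' kills f; expanding f in
      eigenvectors of the original pair shows that it agrees on f with the projection onto
      \<nu>.\<close>
    then have "0 = d.tri.proj n (conjugate \<nu>) f"
      using f d.tri.proj_span_up[OF cmu cnu] unfolding dom_up_insert[OF cmu] by simp
    also have "f = (\<Sum>\<kappa>\<in>partitions_of n. tri.proj n \<kappa> f)" by (rule tri.sum_proj[OF fP])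
    also have "d.tri.proj n (conjugate \<nu>) \<dots> = (\<Sum>\<kappa>\<in>partitions_of n. d.tri.proj n (conjugate \<nu>) (tri.proj n \<kappa> f))"
      unfolding d.tri.proj_def by (rule d.tri.spectral_proj_sum)
    also have "\<dots> = (\<Sum>\<kappa>\<in>partitions_of n. if \<kappa> = \<nu> then tri.proj n \<nu> f else 0)"
    proof (intro sum.cong refl)
      fix \<kappa> assume k: "\<kappa> \<in> partitions_of n"
      obtain a where a: "tri.proj n \<kappa> f = scale_symf a (tri.eigvec \<kappa>)" using tri.proj_span[OF fP k] by blast
      have "D0 t q (tri.eigvec \<kappa>) = scale_symf (eigenval t q (conjugate \<kappa>)) (tri.eigvec \<kappa>)"
        using tri.T_eigvec[OF k] k by (simp add: D0_commute[of t q] eigenval_conjugate partitions_of_def)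
      then have "d.tri.proj n (conjugate \<nu>) (tri.eigvec \<kappa>) = (if conjugate \<kappa> = conjugate \<nu> then tri.eigvec \<kappa> else 0)"
        using d.tri.proj_eigen[OF cnu conjugate_in_partitions_of[OF k]] by blast
      then show "d.tri.proj n (conjugate \<nu>) (tri.proj n \<kappa> f) = (if \<kappa> = \<nu> then tri.proj n \<nu> f else 0)"
        using c[OF k] a by (auto simp: d.tri.proj_scale)
    qed
    also have "\<dots> = tri.proj n \<nu> f" using nu by simp
    finally show ?thesis ..
  qed
  have "f = (\<Sum>\<kappa>\<in>partitions_of n. tri.proj n \<kappa> f)" by (rule tri.sum_proj[OF fP])
  also have "\<dots> = tri.proj n \<mu> f" using z mu by (subst sum.remove[of _ \<mu>]) auto
  finally show "\<exists>a. f = scale_symf a (tri.eigvec \<mu>)" using tri.proj_span[OF fP mu] by metis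
qed

end


subsection \<open>Bernstein operators\<close>

text \<open>Scaling V by x amounts to replacing w by xw.\<close>

lemma trans_variable_scale:
  "coeff (trans (\<lambda>k. x ^ k * v k) f) m = scale_symf (x ^ m) (coeff (trans v f) m)"
proof (induction f arbitrary: m rule: symf_induct)
  case (const c)
  show ?case by (cases m) (auto simp: coeff_pCons)
next
  case (power_sum k)
  then show ?case
    by (cases m) (auto simp: trans_power_sum coeff_pCons scale_symf_def const_symf_mult)
next
  case (add f g)
  then show ?case by (simp add: trans.hom_add symf.scale_right_distrib)
next
  case (mult f g)
  have t: "scale_symf (x ^ i) A * scale_symf (x ^ j) B = scale_symf (x ^ (i + j)) (A * B)" for i j and A B :: "'a symf"
    by (simp add: scale_symf_def power_add const_symf_mult mult_ac)
  have "coeff (trans (\<lambda>k. x ^ k * v k) (f * g)) m =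
      (\<Sum>i\<le>m. scale_symf (x ^ m) (coeff (trans v f) i * coeff (trans v g) (m - i)))"
    unfolding trans.hom_mult coeff_mult mult t by (intro sum.cong) auto
  then show ?case by (simp add: trans.hom_mult coeff_mult scale_symf_sum_right)
qed

text \<open>Either way this is a coefficient of f[X + Uw + Vw'], with separate variables for the two
  shifts.\<close>

lemma trans_commute:
  "coeff (trans u (coeff (trans v f) i)) k = coeff (trans v (coeff (trans u f) k)) i"
proof (induction f arbitrary: i k rule: symf_induct)
  case (const c)
  show ?case by (cases i; cases k) (auto simp: coeff_pCons)
next
  case (power_sum \<kappa>)
  have c0: "trans w 0 = 0" for w :: "nat \<Rightarrow> 'a" by (rule trans.hom_zero)
  show ?case
    using power_sum by (cases i; cases k)
     (auto simp: trans_power_sum coeff_pCons trans.hom_add c0)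
next
  case (add f g)
  then show ?case by (simp add: trans.hom_add)
next
  case (mult f g)
  have "coeff (trans u (coeff (trans v (f * g)) i)) k =
     (\<Sum>j\<le>i. \<Sum>l\<le>k. coeff (trans u (coeff (trans v f) j)) l * coeff (trans u (coeff (trans v g) (i - j))) (k - l))"
    by (simp add: trans.hom_mult coeff_mult trans.hom_sum coeff_sum)
  also have "\<dots> = (\<Sum>l\<le>k. \<Sum>j\<le>i. coeff (trans u (coeff (trans v f) j)) l * coeff (trans u (coeff (trans v g) (i - j))) (k - l))"
    by (rule sum.swap)
  also have "\<dots> = (\<Sum>l\<le>k. \<Sum>j\<le>i. coeff (trans v (coeff (trans u f) l)) j * coeff (trans v (coeff (trans u g) (k - l))) (i - j))"
    by (simp add: mult)
  also have "\<dots> = coeff (trans v (coeff (trans u (f * g)) k)) i"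
    by (simp add: trans.hom_mult coeff_mult trans.hom_sum coeff_sum)
  finally show ?case .
qed

lemma comm_ring_hom_poly: "comm_ring_hom (\<lambda>p. poly p x)"
  by (rule comm_ring_homI) auto

text \<open>Translating the coefficients by Uw and then setting the outer variable to the same w
  produces X + (U + V)w.\<close>

lemma trans_trans: "poly (map_poly (trans u) (trans v f)) (monom 1 1) = trans (\<lambda>k. u k + v k) f"
proof (rule symf_hom_eqI[where \<phi> = "\<lambda>f. poly (map_poly (trans u) (trans v f)) (monom 1 1)"])
  interpret m: comm_ring_hom "map_poly (trans u)"
    by (rule comm_ring_hom_map_poly[OF comm_ring_hom_trans])
  show "comm_ring_hom (\<lambda>f. poly (map_poly (trans u) (trans v f)) (monom 1 1))"
    by (rule comm_ring_hom_comp[OF comm_ring_hom_poly comm_ring_hom_comp[OF comm_ring_hom_map_poly[OF comm_ring_hom_trans] comm_ring_hom_trans]])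
  show "poly (map_poly (trans u) (trans v (const_symf c))) (monom 1 1) = trans (\<lambda>k. u k + v k) (const_symf c)" for c
    by (simp add: map_poly_pCons)
  show "poly (map_poly (trans u) (trans v (power_sum k))) (monom 1 1) = trans (\<lambda>k. u k + v k) (power_sum k)" if "k > 0" for k
  proof -
    have "poly (map_poly (trans u) (trans v (power_sum k))) (monom 1 1) =
        trans u (power_sum k) + [:const_symf (v k):] * monom 1 1 ^ k"
      using that by (simp add: trans_power_sum m.hom_add map_poly_pCons map_poly_monom poly_monom)
    also have "[:const_symf (v k):] * monom 1 1 ^ k = monom (const_symf (v k)) k"
      by (simp add: monom_power smult_monom)
    finally show ?thesis
      using that by (simp add: trans_power_sum const_symf_add add_monom add.assoc)
  qed
qed (rule comm_ring_hom_trans)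

lemma pair_monom: "pair (monom a k) w = a * w k"
proof -
  have "pair (monom a k) w = (\<Sum>i\<le>k. coeff (monom a k) i * w i)"
    by (rule pair_bound) (rule degree_monom_le)
  also have "\<dots> = (\<Sum>i\<in>{k}. coeff (monom a k) i * w i)"
    by (rule sum.mono_neutral_right) auto
  finally show ?thesis by simp
qed

lemma pair_sum_left: "pair (sum P A) w = (\<Sum>x\<in>A. pair (P x) w)"
  by (induction A rule: infinite_finite_induct) (auto simp: pair_add)

lemma pair_trans_trans:
  assumes "degree (trans v f) \<le> N"
  shows "pair (trans (\<lambda>k. u k + v k) f) w = (\<Sum>i\<le>N. pair (trans u (coeff (trans v f) i)) (\<lambda>k. w (k + i)))"
proof -
  let ?Q = "map_poly (trans u) (trans v f)"
  have d: "degree ?Q \<le> N"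
    using assms by (intro degree_le) (simp add: coeff_map_poly coeff_eq_0)
  have "trans (\<lambda>k. u k + v k) f = (\<Sum>i\<le>N. coeff ?Q i * monom 1 1 ^ i)"
    unfolding trans_trans[symmetric] poly_altdef
    by (rule sum.mono_neutral_left) (use d in \<open>auto simp: coeff_eq_0\<close>)
  then show ?thesis
    by (simp add: pair_sum_left pair_mult monom_power pair_monom coeff_map_poly)
qed

text \<open>Bernstein's operator: the coefficient of z^a in f[X - 1/z] \<Sum> z^m h_m. It prepends a
  row a to a Schur function (\<open>schur_Cons\<close>).\<close>

definition bern :: "nat \<Rightarrow> 'a :: field_char_0 symf \<Rightarrow> 'a symf" where
  "bern a f = pair (trans (\<lambda>_. - 1) f) (\<lambda>k. complete_sym (a + k))"

lemma bern_add: "bern a (f + g) = bern a f + bern a g"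
  by (simp add: bern_def trans.hom_add pair_add)

lemma bern_scale: "bern a (scale_symf c f) = scale_symf c (bern a f)"
  by (simp add: bern_def trans_scale pair_smult scale_symf_def[of _ "pair _ _"])

lemma newton_linear_1: "newton (\<lambda>k. - 1) (1 - fps_X :: 'a :: comm_ring_1 fps)"
  using newton_linear[of "1 :: 'a"] by simp

lemma pair_trans_geo:
  "pair (trans (\<lambda>_. - 1) (geo q i)) w =
    (\<Sum>r\<le>i. scale_symf (if r = 0 then 1 else 1 - q) (geo q (i - r)) * w r)"
proof -
  have c: "coeff (trans (\<lambda>_. - 1) (geo q i)) k =
      (if k \<le> i then scale_symf (Abs_fps (\<lambda>k. if k = 0 then 1 else 1 - q) $ k) (geo q (i - k)) else 0)" for k
    by (rule coeff_trans_newton[OF newton_geo]) (use newton_one_minus[of q] in simp)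
  have "degree (trans (\<lambda>_. - 1) (geo q i)) \<le> i"
    by (rule degree_le) (simp only: c, simp)
  then show ?thesis by (simp add: pair_bound c)
qed

text \<open>The commutation only closes up at \<open>t = 1/q\<close>; this is where the specialization enters.\<close>

lemma lower_bern:
  fixes q t :: "'a :: field_char_0"
  assumes qt: "q * t = 1"
  shows "lower q t 0 (bern a f) =
    scale_symf t (bern a (lower q t 0 f)) + scale_symf ((1 - t) * q ^ a) (bern a f)"
proof -
  define c :: "nat \<Rightarrow> 'a" where "c = (\<lambda>k. 1 - t ^ k)"
  define u :: "nat \<Rightarrow> 'a" where "u = (\<lambda>_. - 1)"
  define P where "P = trans c f"
  define R where "R = trans u f"
  define F where "F = (\<lambda>i k. coeff (trans u (coeff P i)) k)"
  have F': "F i k = coeff (trans c (coeff R k)) i" for i k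
    unfolding F_def P_def R_def by (rule trans_commute)
  define N K where "N = degree P" and "K = degree R"
  have dK: "degree (trans u (coeff P i)) \<le> K" for i
  proof (rule degree_le, intro allI impI)
    fix k assume "K < k"
    then show "coeff (trans u (coeff P i)) k = 0"
      using F'[of i k] by (simp add: F_def K_def coeff_eq_0 trans.hom_zero)
  qed
  have dN: "degree (trans c (coeff R k)) \<le> N" for k
  proof (rule degree_le, intro allI impI)
    fix i assume "N < i"
    then show "coeff (trans c (coeff R k)) i = 0"
      using F'[of i k] by (simp add: F_def N_def coeff_eq_0 trans.hom_zero)
  qed
  \<comment> \<open>Comparison of the two orders of composition at fixed exponents i and k of the
    two shift variables: \<open>lower_key\<close> governs the left side, the expansion of
    \<open>geo\<close> under X - w the right.\<close>
  have key: "(\<Sum>s\<le>a + k. scale_symf (if s = 0 then 1 else 1 - t) (complete_sym (a + k - s)) * geo q (i + s)) =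
      scale_symf t (\<Sum>r\<le>i. scale_symf (if r = 0 then 1 else 1 - q) (geo q (i - r)) * complete_sym (a + (k + r)))
      + scale_symf ((1 - t) * q ^ a) (scale_symf (q ^ (k + i)) (complete_sym (a + (k + i))))" for i k
  proof -
    have "(\<Sum>r\<le>i. scale_symf (if r = 0 then 1 else 1 - q) (geo q (i - r)) * complete_sym (a + (k + r))) =
        geo q i * complete_sym (a + k) +
        (\<Sum>r=1..i. scale_symf (1 - q) (geo q (i - r) * complete_sym (a + (k + r))))"
    proof -
      have "{..i} = insert 0 {1..i}" by auto
      then show ?thesis by (simp add: scale_symf_mult_left)
    qed
    then have e: "scale_symf t (\<Sum>r\<le>i. scale_symf (if r = 0 then 1 else 1 - q) (geo q (i - r)) * complete_sym (a + (k + r))) =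
        scale_symf t (geo q i * complete_sym (a + k)) +
        scale_symf (t * (1 - q)) (\<Sum>r=1..i. geo q (i - r) * complete_sym (a + (k + r)))"
      by (simp add: symf.scale_right_distrib scale_symf_sum_right)
    \<comment> \<open>Here q t = 1 enters: the tail that \<open>lower_key\<close> leaves with
      coefficient -(1 - t) is the tail with coefficient t (1 - q) on the other side.\<close>
    have "t * (1 - q) = - (1 - t)" using qt by (simp add: algebra_simps)
    then show ?thesis
      using lower_key[OF order_refl[of i], where t = t and a = "a + k" and q = q and j = 0] unfolding e
      by (simp add: symf.scale_right_diff_distrib algebra_simps power_add symf.scale_minus_left
          symf.scale_left_distrib symf.scale_left_diff_distrib)
  qed
  have lhs: "lower q t 0 (bern a f) = (\<Sum>k\<le>K. \<Sum>i\<le>N. F i k *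
      (\<Sum>s\<le>a + k. scale_symf (if s = 0 then 1 else 1 - t) (complete_sym (a + k - s)) * geo q (i + s)))"
  proof -
    have "trans c (bern a f) = (\<Sum>k\<le>K. trans c (coeff R k) * trans c (complete_sym (a + k)))"
      by (simp add: bern_def pair_def R_def u_def K_def trans.hom_sum trans.hom_mult)
    moreover have "pair (trans c (complete_sym m)) w =
        (\<Sum>k\<le>m. scale_symf (if k = 0 then 1 else 1 - t) (complete_sym (m - k)) * w k)" for m w
      unfolding c_def by (subst pair_trans_complete[OF newton_one_minus]) simp
    ultimately show ?thesis
      by (simp add: lower_def c_def[symmetric] pair_sum_left pair_mult pair_bound[OF dN] F')
  qed
  have rhs: "bern a (lower q t 0 f) = (\<Sum>i\<le>N. \<Sum>k\<le>K. F i k *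
      (\<Sum>r\<le>i. scale_symf (if r = 0 then 1 else 1 - q) (geo q (i - r)) * complete_sym (a + (k + r))))"
  proof -
    have "trans u (lower q t 0 f) = (\<Sum>i\<le>N. trans u (coeff P i) * trans u (geo q i))"
      by (simp add: lower_def pair_def P_def c_def N_def trans.hom_sum trans.hom_mult)
    moreover have "pair (trans u (geo q m)) w =
        (\<Sum>r\<le>m. scale_symf (if r = 0 then 1 else 1 - q) (geo q (m - r)) * w r)" for m w
      unfolding u_def by (rule pair_trans_geo)
    ultimately show ?thesis
      by (simp add: bern_def u_def[symmetric] pair_sum_left pair_mult pair_bound[OF dK] F_def)
  qed
  have mid: "(\<Sum>i\<le>N. \<Sum>k\<le>K. F i k * scale_symf (q ^ (k + i)) (complete_sym (a + (k + i)))) = bern a f"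
  proof -
    \<comment> \<open>The combined shift has power sums -1 + (1 - t^k) = -t^k, which is the
      Bernstein shift with w rescaled by t. The weights q^m then cancel the factors t^m.\<close>
    have uc: "(\<lambda>k. u k + c k) = (\<lambda>k. t ^ k * u k)"
      by (simp add: u_def c_def)
    have "(\<Sum>i\<le>N. \<Sum>k\<le>K. F i k * scale_symf (q ^ (k + i)) (complete_sym (a + (k + i)))) =
        pair (trans (\<lambda>k. u k + c k) f) (\<lambda>m. scale_symf (q ^ m) (complete_sym (a + m)))"
      by (subst pair_trans_trans[of _ _ N]) (simp_all add: P_def[symmetric] N_def pair_bound[OF dK] F_def)
    also have "\<dots> = pair R (\<lambda>m. complete_sym (a + m))"
    proof -
      have c: "coeff (trans (\<lambda>k. t ^ k * u k) f) m = scale_symf (t ^ m) (coeff R m)" for m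
        unfolding R_def by (rule trans_variable_scale)
      have "degree (trans (\<lambda>k. t ^ k * u k) f) \<le> K"
        by (rule degree_le) (simp add: c K_def coeff_eq_0)
      then have "pair (trans (\<lambda>k. t ^ k * u k) f) (\<lambda>m. scale_symf (q ^ m) (complete_sym (a + m))) =
          (\<Sum>m\<le>K. scale_symf (t ^ m) (coeff R m) * scale_symf (q ^ m) (complete_sym (a + m)))"
        by (simp add: pair_bound c)
      also have "\<dots> = (\<Sum>m\<le>K. coeff R m * complete_sym (a + m))"
      proof (intro sum.cong refl)
        fix m
        have "q ^ m * t ^ m = 1" using qt by (metis power_mult_distrib power_one)
        then show "scale_symf (t ^ m) (coeff R m) * scale_symf (q ^ m) (complete_sym (a + m)) =
            coeff R m * complete_sym (a + m)"
          by (simp add: scale_symf_mult_left scale_symf_mult_right)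
      qed
      finally show ?thesis by (simp add: uc pair_def K_def)
    qed
    finally show ?thesis by (simp add: bern_def R_def u_def)
  qed
  have "lower q t 0 (bern a f) = (\<Sum>i\<le>N. \<Sum>k\<le>K. F i k *
      (scale_symf t (\<Sum>r\<le>i. scale_symf (if r = 0 then 1 else 1 - q) (geo q (i - r)) * complete_sym (a + (k + r)))
      + scale_symf ((1 - t) * q ^ a) (scale_symf (q ^ (k + i)) (complete_sym (a + (k + i))))))"
    unfolding lhs key by (rule sum.swap)
  also have "\<dots> = scale_symf t (bern a (lower q t 0 f)) + scale_symf ((1 - t) * q ^ a)
      (\<Sum>i\<le>N. \<Sum>k\<le>K. F i k * scale_symf (q ^ (k + i)) (complete_sym (a + (k + i))))"
  proof -
    have "(\<Sum>i\<le>N. \<Sum>k\<le>K. F i k * (scale_symf x (S i k) + scale_symf y (W i k))) =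
        scale_symf x (\<Sum>i\<le>N. \<Sum>k\<le>K. F i k * S i k) + scale_symf y (\<Sum>i\<le>N. \<Sum>k\<le>K. F i k * W i k)" for x y S W
      unfolding distrib_left sum.distrib scale_symf_mult_right scale_symf_sum_right ..
    then show ?thesis unfolding rhs .
  qed
  finally show ?thesis unfolding mid .
qed

text \<open>The two terms of \<open>lower_bern\<close> are the two terms in the recursion of
  \<open>eigenval\<close>.\<close>

lemma bern_eigen:
  assumes "q * t = 1" "lower q t 0 f = scale_symf (eigenval q t \<mu>) f"
  shows "lower q t 0 (bern a f) = scale_symf (eigenval q t (a # \<mu>)) (bern a f)"
  using lower_bern[OF assms(1), of a f] by (simp add: assms(2) bern_scale symf.scale_left_distrib)

lemma bern_h_prod: "bern a (h_prod c) \<in> upset 0 (a # c)"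
proof -
  have "coeff (trans (\<lambda>_. - 1) (h_prod c)) i * complete_sym (a + i) \<in> upset 0 (a # c)" for i
    by (subst mult.commute) (rule upset_Cons[OF coeff_trans_h_prod[OF newton_linear_1]], simp)
  then show ?thesis unfolding bern_def pair_def upset_def by (intro symf.span_sum) auto
qed

lemma bern_h_prod_diag: "bern a (h_prod c) - h_prod (a # c) \<in> (strict_upset (a # c) :: 'a :: field_char_0 symf set)"
proof -
  let ?P = "trans (\<lambda>_. - 1) (h_prod c :: 'a symf)"
  have "coeff ?P i * complete_sym (a + i) \<in> strict_upset (a # c)" if "i > 0" for i
    using strict_upset_Cons'[OF coeff_trans_h_prod[OF newton_linear_1] that] by (simp add: mult.commute)
  then have "(\<Sum>i=1..degree ?P. coeff ?P i * complete_sym (a + i)) \<in> strict_upset (a # c)"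
    unfolding strict_upset_def by (intro symf.span_sum) (auto simp: Suc_le_eq)
  moreover have "{..degree ?P} = insert 0 {1..degree ?P}" by auto
  then have "bern a (h_prod c) = h_prod (a # c) + (\<Sum>i=1..degree ?P. coeff ?P i * complete_sym (a + i))"
    by (simp add: bern_def pair_def coeff_trans_0 mult.commute)
  ultimately show ?thesis by simp
qed

lemma above_trans:
  assumes "d \<in> above 0 c" "c \<in> above 0 b"
  shows "d \<in> above 0 b"
  using assms unfolding above_def by (auto intro: order_trans)

lemma above_antisym:
  assumes "d \<in> above 0 c" "c \<in> above 0 d"
  shows "c = d"
  using assms unfolding above_def by (intro list_eqI_sum_take) (auto intro: le_antisym)

subsection \<open>Schur functions\<close>

text \<open>Replace the first row of the Jacobi-Trudi matrix by 1, w, w^2, ... and subtract from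
  each column w times the preceding one. The first row becomes a unit vector and every other entry
  h_m becomes h_m - w h_(m-1) = h_m[X - w], so the determinant is s_\<nu>[X - w]. Expanding it along
  the first row instead and replacing w^j by h_(a+j) gives the determinant for the partition with a
  in front.\<close>

lemma schur_Cons: "schur (a # \<nu>) = bern a (schur \<nu> :: 'a :: field_char_0 symf)"
proof -
  define l where "l = length \<nu>"
  \<comment> \<open>An integer index makes all entries uniform, including the convention that h
    vanishes at negative index.\<close>
  define H where "H = (\<lambda>(z :: int). if z < 0 then 0 else complete_sym (nat z) :: 'a symf)"
  define M where "M = mat (Suc l) (Suc l) (\<lambda>(i, j). H (int ((a # \<nu>) ! i) + int j - int i))"
  define N where "N = mat l l (\<lambda>(i, j). H (int (\<nu> ! i) + int j - int i))"
  have Hc: "(if i \<le> m + j then complete_sym (m + j - i) else 0) = H (int m + int j - int i)" for i j m :: nat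
    by (auto simp: H_def nat_diff_distrib' intro!: arg_cong[of _ _ complete_sym])
  have M: "schur (a # \<nu>) = det M" and N: "schur \<nu> = det N"
    by (simp_all add: schur_def M_def N_def l_def Hc)
  define w :: "'a symf poly" where "w = monom 1 1"
  define Q where "Q = mat (Suc l) (Suc l) (\<lambda>(i, j). if i = 0 then w ^ j else [:M $$ (i, j):])"
  \<comment> \<open>The column operation as a unipotent matrix, so that the determinant is
    unchanged.\<close>
  define U where "U = mat (Suc l) (Suc l) (\<lambda>(k, j). if k = j then 1 else if Suc k = j then - w else 0)"
  have Q: "Q \<in> carrier_mat (Suc l) (Suc l)" and U: "U \<in> carrier_mat (Suc l) (Suc l)"
    and Mc: "M \<in> carrier_mat (Suc l) (Suc l)" by (simp_all add: Q_def U_def M_def)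
  have "det U = prod_list (diag_mat U)"
    by (rule det_upper_triangular[OF _ U]) (auto simp: U_def)
  also have "diag_mat U = map (\<lambda>_. 1) [0..<Suc l]"
    unfolding diag_mat_def by (rule map_cong) (auto simp: U_def)
  also have "prod_list \<dots> = 1" by (simp del: upt_Suc add: map_replicate_const)
  finally have dU: "det U = 1" .
  have QU: "(Q * U) $$ (i, j) = (if j = 0 then Q $$ (i, 0) else Q $$ (i, j) - w * Q $$ (i, j - 1))"
    if "i < Suc l" "j < Suc l" for i j
  proof -
    have "(Q * U) $$ (i, j) = (\<Sum>k\<in>{0..<Suc l}. Q $$ (i, k) * (if k = j then 1 else if Suc k = j then - w else 0))"
      using that Q U by (simp add: scalar_prod_def U_def del: sum.op_ivl_Suc)
    also have "\<dots> = (\<Sum>k\<in>(if j = 0 then {0} else {j - 1, j}). Q $$ (i, k) * (if k = j then 1 else if Suc k = j then - w else 0))"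
      by (rule sum.mono_neutral_right) (use that in auto)
    also have "\<dots> = (if j = 0 then Q $$ (i, 0) else Q $$ (i, j) - w * Q $$ (i, j - 1))"
      by (auto simp: mult.commute)
    finally show ?thesis .
  qed
  have row0: "(Q * U) $$ (0, j) = (if j = 0 then 1 else 0)" if "j < Suc l" for j
    using that by (subst QU) (auto simp: Q_def simp flip: power_Suc)
  have trH: "trans (\<lambda>_. - 1) (H z) = [:H z:] - w * [:H (z - 1):]" for z
  proof (cases "z < 0")
    case True
    then show ?thesis by (simp add: H_def trans.hom_zero)
  next
    case False
    have "coeff (trans (\<lambda>_. - 1) (complete_sym (nat z))) k =
        (if k \<le> nat z then scale_symf ((1 - fps_X) $ k) (complete_sym (nat z - k)) else 0 :: 'a symf)" for k
      by (rule coeff_trans_newton[OF newton_complete_sym']) (use newton_linear_1 in simp)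
    then have "coeff (trans (\<lambda>_. - 1) (H z)) k = coeff ([:H z:] - w * [:H (z - 1):]) k" for k
      using False
      by (cases k; cases "k = 1") (auto simp: H_def w_def coeff_pCons smult_monom nat_diff_distrib scale_symf_def const_symf_minus fps_X_def
          split: nat.splits)
    then show ?thesis by (rule poly_eqI)
  qed
  have minor: "mat_delete (Q * U) 0 0 = map_mat (trans (\<lambda>_. - 1)) N"
  proof (rule eq_matI)
    fix i j assume "i < dim_row (map_mat (trans (\<lambda>_. - 1)) N)" "j < dim_col (map_mat (trans (\<lambda>_. - 1)) N)"
    then have ij: "i < l" "j < l" by (simp_all add: N_def)
    have "mat_delete (Q * U) 0 0 $$ (i, j) = (Q * U) $$ (Suc i, Suc j)"
      using ij Q U by (simp add: mat_delete_def)
    also have "\<dots> = [:H (int (\<nu> ! i) + int j - int i):] - w * [:H (int (\<nu> ! i) + int j - int i - 1):]"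
      using ij by (subst QU) (auto simp: Q_def M_def algebra_simps)
    also have "\<dots> = trans (\<lambda>_. - 1) (N $$ (i, j))"
      using ij by (simp add: trH N_def)
    finally show "mat_delete (Q * U) 0 0 $$ (i, j) = map_mat (trans (\<lambda>_. - 1)) N $$ (i, j)"
      using ij by (simp add: N_def)
  qed (simp_all add: N_def Q_def U_def mat_delete_def)
  have "det Q = det (Q * U)" using det_mult[OF Q U] dU by simp
  also have "\<dots> = (\<Sum>j<Suc l. (Q * U) $$ (0, j) * cofactor (Q * U) 0 j)"
    by (rule laplace_expansion_row) (use Q U in auto)
  also have "\<dots> = (\<Sum>j\<in>{0}. (Q * U) $$ (0, j) * cofactor (Q * U) 0 j)"
    by (rule sum.mono_neutral_right) (auto simp: row0)
  also have "\<dots> = det (map_mat (trans (\<lambda>_. - 1)) N)"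
    by (simp add: row0 cofactor_def minor)
  also have "\<dots> = trans (\<lambda>_. - 1) (schur \<nu>)" by (simp add: N trans.hom_det)
  finally have 1: "det Q = trans (\<lambda>_. - 1) (schur \<nu>)" .
  interpret cp: comm_ring_hom "\<lambda>c :: 'a symf. [:c:]" by (rule comm_ring_hom_const_poly)
  have cof: "cofactor Q 0 j = [:cofactor M 0 j:]" if "j < Suc l" for j
  proof -
    have "mat_delete Q 0 j = map_mat (\<lambda>c. [:c:]) (mat_delete M 0 j)"
      by (rule eq_matI) (auto simp: mat_delete_def Q_def M_def)
    then have "det (mat_delete Q 0 j) = [:det (mat_delete M 0 j):]" by (simp add: cp.hom_det)
    then show ?thesis by (simp add: cofactor_def cp.hom_mult cp.hom_power flip: cp.hom_one)
  qed
  have "det Q = (\<Sum>j<Suc l. Q $$ (0, j) * cofactor Q 0 j)"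
    by (rule laplace_expansion_row[OF Q]) simp
  also have "\<dots> = (\<Sum>j<Suc l. monom (cofactor M 0 j) j)"
  proof (intro sum.cong refl)
    fix j assume "j \<in> {..<Suc l}"
    then have "Q $$ (0, j) = w ^ j" "cofactor Q 0 j = [:cofactor M 0 j:]" by (simp_all add: Q_def[symmetric] cof) (simp add: Q_def)
    then show "Q $$ (0, j) * cofactor Q 0 j = monom (cofactor M 0 j) j"
      by (simp add: w_def monom_power smult_monom)
  qed
  finally have "pair (det Q) (\<lambda>k. complete_sym (a + k)) = (\<Sum>j<Suc l. cofactor M 0 j * complete_sym (a + j))"
    by (simp add: pair_sum_left pair_monom del: sum.lessThan_Suc)
  also have "\<dots> = (\<Sum>j<Suc l. M $$ (0, j) * cofactor M 0 j)"
    by (intro sum.cong refl) (auto simp: M_def H_def mult.commute nat_add_distrib)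
  also have "\<dots> = det M" by (rule laplace_expansion_row[symmetric, OF Mc]) simp
  finally show ?thesis unfolding M bern_def 1 ..
qed

lemma schur_Nil [simp]: "schur [] = 1"
  by (simp add: schur_def)

text \<open>\<open>bern\<close> preserves strictness: if c lies strictly above \<nu>, it sends h_c
  into the span above \<open>a # c\<close>, and everything there lies strictly above
  \<open>a # \<nu>\<close>.\<close>

lemma schur_triangular: "schur \<mu> - h_prod \<mu> \<in> (strict_upset \<mu> :: 'a :: field_char_0 symf set)"
proof (induction \<mu>)
  case Nil
  then show ?case by (simp add: strict_upset_def symf.span_zero)
next
  case (Cons a \<nu>)
  define S :: "'a symf" where "S = schur \<nu> - h_prod \<nu>"
  have "bern a f \<in> strict_upset (a # \<nu>)" if "f \<in> strict_upset \<nu>" for f :: "'a symf"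
    using that unfolding strict_upset_def[of \<nu>]
  proof (induction rule: symf.span_induct_alt)
    case base
    then show ?case by (simp add: bern_def trans.hom_zero strict_upset_def symf.span_zero)
  next
    case (step k x y)
    then obtain c where c: "c \<in> above 0 \<nu>" "c \<noteq> \<nu>" "x = h_prod c" by auto
    have "above 0 (a # c) \<subseteq> above 0 (a # \<nu>) - {a # \<nu>}"
    proof
      fix d assume d: "d \<in> above 0 (a # c)"
      have ac: "a # c \<in> above 0 (a # \<nu>)" by (rule above_Cons[OF c(1)]) simp
      then have "d \<in> above 0 (a # \<nu>)" using d above_trans by blast
      moreover have "d \<noteq> a # \<nu>" using above_antisym[OF ac] d c(2) by auto
      ultimately show "d \<in> above 0 (a # \<nu>) - {a # \<nu>}" by blast
    qed
    then have "bern a x \<in> strict_upset (a # \<nu>)"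
      using bern_h_prod[of a c] symf.span_mono[of "h_prod ` above 0 (a # c)"]
      unfolding c(3) upset_def strict_upset_def by blast
    then show ?case
      using step unfolding bern_add bern_scale strict_upset_def by (intro symf.span_add symf.span_scale)
  qed
  then have "bern a S \<in> strict_upset (a # \<nu>)" using Cons.IH unfolding S_def by blast
  moreover have eq: "schur (a # \<nu>) - h_prod (a # \<nu>) = (bern a (h_prod \<nu>) - h_prod (a # \<nu>)) + bern a S"
  proof -
    have "schur \<nu> = h_prod \<nu> + S" by (simp add: S_def)
    then show ?thesis by (simp add: schur_Cons bern_add)
  qed
  ultimately show ?case
    using bern_h_prod_diag[of a \<nu>] unfolding eq strict_upset_def by (intro symf.span_add)
qed

text \<open>The transition is unitriangular; its inversion is by induction on the size of the
  dominance up-set. With this the Schur spans in the definition of \<open>mod_macdonald\<close>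
  become spans of the products on which the operator is triangular.\<close>

lemma schur_span:
  assumes "is_partition \<mu>"
  shows "symf.span (schur ` dom_up \<mu>) = (symf.span (h_prod ` dom_up \<mu>) :: 'a :: field_char_0 symf set)"
proof
  have s: "schur \<nu> - h_prod \<nu> \<in> (symf.span (h_prod ` (dom_up \<nu> - {\<nu>})) :: 'a symf set)" if "is_partition \<nu>" for \<nu>
    using schur_triangular strict_upset_subset[OF that] by blast
  have sub: "dom_up \<nu> \<subseteq> dom_up \<mu>" if "\<nu> \<in> dom_up \<mu>" for \<nu>
    using that dominates_trans by (auto simp: dom_up_def)
  show "symf.span (schur ` dom_up \<mu>) \<subseteq> (symf.span (h_prod ` dom_up \<mu>) :: 'a symf set)"
  proof (rule symf.span_minimal, rule image_subsetI)
    fix \<nu> assume nu: "\<nu> \<in> dom_up \<mu>"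
    have "symf.span (h_prod ` (dom_up \<nu> - {\<nu>})) \<subseteq> (symf.span (h_prod ` dom_up \<mu>) :: 'a symf set)"
      using sub[OF nu] by (intro symf.span_mono) auto
    then have "schur \<nu> - h_prod \<nu> \<in> (symf.span (h_prod ` dom_up \<mu>) :: 'a symf set)"
      using s nu by (auto simp: dom_up_def)
    from symf.span_add[OF this symf.span_base[of "h_prod \<nu>"]] nu
    show "schur \<nu> \<in> (symf.span (h_prod ` dom_up \<mu>) :: 'a symf set)" by simp
  qed simp
  have fin: "finite (dom_up \<nu>)" if "is_partition \<nu>" for \<nu>
  proof (rule finite_subset)
    show "dom_up \<nu> \<subseteq> partitions_of (sum_list \<nu>)"
      by (rule dom_up_partitions_of) (simp add: partitions_of_def that)
  qed simp
  have hs: "h_prod \<nu> \<in> (symf.span (schur ` dom_up \<nu>) :: 'a symf set)" if "is_partition \<nu>" for \<nu>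
    using that
  proof (induction "card (dom_up \<nu>)" arbitrary: \<nu> rule: less_induct)
    case less
    have "h_prod ` (dom_up \<nu> - {\<nu>}) \<subseteq> (symf.span (schur ` dom_up \<nu>) :: 'a symf set)"
    proof (rule image_subsetI)
      fix \<kappa> assume k: "\<kappa> \<in> dom_up \<nu> - {\<nu>}"
      have p: "is_partition \<kappa>" using k by (simp add: dom_up_def)
      have sub: "dom_up \<kappa> \<subseteq> dom_up \<nu>" using k dominates_trans by (auto simp: dom_up_def)
      moreover have "\<nu> \<in> dom_up \<nu>" "\<nu> \<notin> dom_up \<kappa>"
        using less.prems k dominates_antisym p by (auto simp: dom_up_def)
      ultimately have "card (dom_up \<kappa>) < card (dom_up \<nu>)"
        by (intro psubset_card_mono fin[OF less.prems] psubsetI) blast+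
      then have "h_prod \<kappa> \<in> (symf.span (schur ` dom_up \<kappa>) :: 'a symf set)" using less.hyps p by blast
      then show "h_prod \<kappa> \<in> (symf.span (schur ` dom_up \<nu>) :: 'a symf set)"
        using sub by (meson image_mono subsetD symf.span_mono)
    qed
    then have "symf.span (h_prod ` (dom_up \<nu> - {\<nu>})) \<subseteq> (symf.span (schur ` dom_up \<nu>) :: 'a symf set)"
      by (rule symf.span_minimal) simp
    then have 1: "schur \<nu> - h_prod \<nu> \<in> (symf.span (schur ` dom_up \<nu>) :: 'a symf set)"
      using s[OF less.prems] by blast
    have "schur \<nu> \<in> (symf.span (schur ` dom_up \<nu>) :: 'a symf set)"
      using less.prems by (intro symf.span_base) (auto simp: dom_up_def)
    from symf.span_diff[OF this 1] show ?case by simp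
  qed
  show "symf.span (h_prod ` dom_up \<mu>) \<subseteq> (symf.span (schur ` dom_up \<mu>) :: 'a symf set)"
  proof (intro symf.span_minimal image_subsetI)
    fix \<nu> assume nu: "\<nu> \<in> dom_up \<mu>"
    have "symf.span (schur ` dom_up \<nu>) \<subseteq> (symf.span (schur ` dom_up \<mu>) :: 'a symf set)"
      using sub[OF nu] by (intro symf.span_mono image_mono)
    moreover have "h_prod \<nu> \<in> (symf.span (schur ` dom_up \<nu>) :: 'a symf set)"
      using nu hs by (simp add: dom_up_def)
    ultimately show "h_prod \<nu> \<in> (symf.span (schur ` dom_up \<mu>) :: 'a symf set)" by blast
  qed simp
qed

lemma lower_one: "lower q t 0 1 = 1"
  by (simp add: lower_def pair_def trans.hom_one)

lemma schur_eigen: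
  assumes "q * t = 1"
  shows "lower q t 0 (schur \<mu>) = scale_symf (eigenval q t \<mu>) (schur \<mu>)"
proof (induction \<mu>)
  case (Cons a \<mu>)
  show ?case unfolding schur_Cons by (rule bern_eigen[OF assms Cons.IH])
qed (simp add: lower_one)


subsection \<open>Hooks\<close>

lemma pair_trans_elem:
  "pair (trans (\<lambda>_. - 1) (elem_sym r :: 'a :: field_char_0 symf)) w = (\<Sum>k\<le>r. (- 1) ^ k * elem_sym (r - k) * w k)"
proof -
  have F: "newton (\<lambda>k. const_symf (- ((- 1) ^ k)) * power_sum k) (Abs_fps (elem_sym :: nat \<Rightarrow> 'a symf))"
    using newton_elem_sym[where 'a = 'a] by (simp add: const_symf_minus const_symf_power)
  have c: "coeff (trans (\<lambda>_. - 1) (elem_sym r :: 'a symf)) k =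
      (if k \<le> r then scale_symf (Abs_fps (\<lambda>n. (- 1) ^ n) $ k) (elem_sym (r - k)) else 0)" for k
    by (rule coeff_trans_newton[OF F]) (use newton_geometric[of "- 1 :: 'a"] in simp)
  have "degree (trans (\<lambda>_. - 1) (elem_sym r :: 'a symf)) \<le> r"
    by (rule degree_le) (simp only: c, simp)
  then show ?thesis
    by (simp add: pair_bound c scale_symf_def const_symf_power const_symf_minus)
qed

lemma bern_elem_sym: "bern a (elem_sym r) = (\<Sum>k\<le>r. (- 1) ^ k * elem_sym (r - k) * complete_sym (a + k))"
  by (simp add: bern_def pair_trans_elem)

text \<open>At a = 1 the alternating sum is the relation \<Sum> (-1)^i e_i h_(r+1-i) = 0 without its
  last term. So elementary functions arise by stacking rows of length 1.\<close>

lemma bern_1_elem_sym: "bern 1 (elem_sym r) = (elem_sym (Suc r) :: 'a :: field_char_0 symf)"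
proof -
  have "0 = (\<Sum>i\<le>Suc r. (- 1) ^ i * elem_sym i * complete_sym (Suc r - i) :: 'a symf)"
    using sum_elem_complete[of "Suc r", where 'a = 'a] by simp
  also have "\<dots> = (- 1) ^ Suc r * elem_sym (Suc r) + (\<Sum>i\<le>r. (- 1) ^ i * elem_sym i * complete_sym (Suc r - i))"
    by simp
  also have "(\<Sum>i\<le>r. (- 1) ^ i * elem_sym i * complete_sym (Suc r - i)) =
      (\<Sum>k\<le>r. (- 1) ^ (r - k) * elem_sym (r - k) * complete_sym (1 + k) :: 'a symf)"
    by (rule sum.reindex_bij_witness[of _ "\<lambda>k. r - k" "\<lambda>k. r - k"]) (auto simp: Suc_diff_le)
  also have "\<dots> = (\<Sum>k\<le>r. (- 1) ^ r * ((- 1) ^ k * elem_sym (r - k) * complete_sym (1 + k)))"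
  proof (intro sum.cong refl)
    fix k assume "k \<in> {..r}"
    then have "(- 1 :: 'a symf) ^ (r - k) = (- 1) ^ r * (- 1) ^ k"
      by (metis (no_types, opaque_lifting) add_diff_inverse_nat atMost_iff left_minus_one_mult_self
          linorder_not_less mult.commute mult.left_commute power_add)
    then show "(- 1) ^ (r - k) * elem_sym (r - k) * complete_sym (1 + k) =
        (- 1) ^ r * ((- 1) ^ k * elem_sym (r - k) * complete_sym (1 + k) :: 'a symf)"
      by (simp only: mult.assoc)
  qed
  also have "\<dots> = (- 1) ^ r * bern 1 (elem_sym r)"
    unfolding bern_elem_sym sum_distrib_left ..
  finally have "(- 1) ^ r * (bern 1 (elem_sym r) - elem_sym (Suc r)) = (0 :: 'a symf)"
    by (simp add: algebra_simps)
  then have "(- 1) ^ r * ((- 1) ^ r * (bern 1 (elem_sym r) - elem_sym (Suc r))) = (0 :: 'a symf)" by simp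
  then show ?thesis by simp
qed

text \<open>Its Schur function is \<open>bern (n - r) (elem_sym r)\<close>, and this form is used
  throughout because it expands into products of elementary and complete functions.\<close>

definition hook :: "nat \<Rightarrow> nat \<Rightarrow> nat list" where
  "hook n r = (n - r) # replicate r 1"

lemma elem_sym_eigen:
  assumes "q * t = (1 :: 'a :: field_char_0)"
  shows "lower q t 0 (elem_sym r) = scale_symf (eigenval q t (replicate r 1)) (elem_sym r)"
proof (induction r)
  case (Suc r)
  show ?case using bern_eigen[OF assms Suc, of 1] by (simp only: bern_1_elem_sym replicate_Suc)
qed (simp add: lower_one)

lemma hook_eigen:
  assumes "q * t = (1 :: 'a :: field_char_0)"
  shows "lower q t 0 (bern (n - r) (elem_sym r)) =
    scale_symf (eigenval q t (hook n r)) (bern (n - r) (elem_sym r))"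
  unfolding hook_def by (rule bern_eigen[OF assms elem_sym_eigen[OF assms]])

lemma hook_partition: "r < n \<Longrightarrow> hook n r \<in> partitions_of n"
proof -
  assume "r < n"
  moreover have "sorted_wrt (\<ge>) (replicate r (1 :: nat))" by (induction r) auto
  ultimately show ?thesis by (auto simp: hook_def partitions_of_def is_partition_def sum_list_replicate)
qed

text \<open>With j = r - k every hook contributes terms (-1)^j e_j h_(n-j) for j \<le> r, so after
  exchanging the sums the weight of j is the sum of X^r over r \<ge> j.\<close>

lemma sum_hooks:
  fixes X :: "'a :: field_char_0 symf"
  shows "(\<Sum>r<n. (- X) ^ r * bern (n - r) (elem_sym r)) =
    (\<Sum>j<n. (- 1) ^ j * elem_sym j * complete_sym (n - j) * (\<Sum>r\<in>{j..<n}. X ^ r))"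
proof -
  have "(- X) ^ r * bern (n - r) (elem_sym r) =
      (\<Sum>j\<in>{j\<in>{..<n}. j \<le> r}. (- 1) ^ j * elem_sym j * complete_sym (n - j) * X ^ r)" if "r < n" for r
  proof -
    have "(- X) ^ r * bern (n - r) (elem_sym r) =
        (\<Sum>k\<le>r. (- X) ^ r * ((- 1) ^ k * elem_sym (r - k) * complete_sym (n - r + k)))"
      unfolding bern_elem_sym sum_distrib_left ..
    also have "\<dots> = (\<Sum>j\<in>{j\<in>{..<n}. j \<le> r}. (- 1) ^ j * elem_sym j * complete_sym (n - j) * X ^ r)"
    proof (rule sum.reindex_bij_witness[of _ "\<lambda>j. r - j" "\<lambda>k. r - k"])
      fix k assume k: "k \<in> {..r}"
      have "(- X) ^ r = (- 1) ^ (r - k) * (- 1) ^ k * X ^ r"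
        using k by (simp add: power_minus[of X] flip: power_add)
      then have "(- X) ^ r * ((- 1) ^ k * E * C) = (- 1) ^ (r - k) * E * C * X ^ r * ((- 1) ^ k * (- 1) ^ k)" for E C
        by (simp only: mult_ac)
      moreover have "(- 1) ^ k * (- 1) ^ k = (1 :: 'a symf)" by (simp flip: power_mult_distrib)
      moreover have "n - (r - k) = n - r + k" using k that by auto
      ultimately show "(- 1) ^ (r - k) * elem_sym (r - k) * complete_sym (n - (r - k)) * X ^ r =
          (- X) ^ r * ((- 1) ^ k * elem_sym (r - k) * complete_sym (n - r + k))"
        by simp
    qed (use that in auto)
    finally show ?thesis .
  qed
  then have "(\<Sum>r<n. (- X) ^ r * bern (n - r) (elem_sym r)) =
      (\<Sum>r<n. \<Sum>j\<in>{j\<in>{..<n}. j \<le> r}. (- 1) ^ j * elem_sym j * complete_sym (n - j) * X ^ r)"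
    by (intro sum.cong) auto
  also have "\<dots> = (\<Sum>r<n. \<Sum>j<n. if j \<le> r then (- 1) ^ j * elem_sym j * complete_sym (n - j) * X ^ r else 0)"
    by (intro sum.cong refl sum.inter_filter) auto
  also have "\<dots> = (\<Sum>j<n. \<Sum>r<n. if j \<le> r then (- 1) ^ j * elem_sym j * complete_sym (n - j) * X ^ r else 0)"
    by (rule sum.swap)
  also have "\<dots> = (\<Sum>j<n. \<Sum>r\<in>{j..<n}. (- 1) ^ j * elem_sym j * complete_sym (n - j) * X ^ r)"
    by (intro sum.cong refl sum.mono_neutral_cong_right) auto
  finally show ?thesis by (simp only: sum_distrib_left)
qed

text \<open>X(1 - x) = X - xX, and the generating series is the product of those of X and of
  -xX.\<close>

lemma dilate_complete_sym:
  "dilate (\<lambda>k. 1 - x ^ k) (complete_sym n) =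
    (\<Sum>j\<le>n. (- 1) ^ j * elem_sym j * complete_sym (n - j) * const_symf x ^ j)"
proof -
  let ?A = "Abs_fps (\<lambda>n. const_symf x ^ n * ((- 1) ^ n * elem_sym n)) * Abs_fps complete_sym"
  have N: "newton (\<lambda>k. const_symf x ^ k * - power_sum k + power_sum k) ?A"
    using newton_mult[OF newton_scale[OF newton_alt_elem_sym] newton_complete_sym] by simp
  have "dilate (\<lambda>k. 1 - x ^ k) (complete_sym n) = ?A $ n"
    by (rule hom_complete_sym[OF comm_ring_hom_dilate N])
       (simp add: dilate_power_sum const_symf_diff const_symf_power algebra_simps)
  also have "\<dots> = (\<Sum>j\<le>n. const_symf x ^ j * ((- 1) ^ j * elem_sym j) * complete_sym (n - j))"
    by (simp only: fps_mult_nth fps_nth_Abs_fps atMost_atLeast0)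
  also have "\<dots> = (\<Sum>j\<le>n. (- 1) ^ j * elem_sym j * complete_sym (n - j) * const_symf x ^ j)"
    by (intro sum.cong refl) (simp only: mult_ac)
  finally show ?thesis .
qed

text \<open>Multiplication by 1 - x telescopes each geometric sum to x^j - x^n. The range may be
  extended to j = n, where the difference is 0; then the parts with x^n add up to a multiple of
  \<Sum> (-1)^j e_j h_(n-j) = 0.\<close>

lemma sum_hooks_complete:
  assumes "n > 0"
  shows "(1 - const_symf x) * (\<Sum>r<n. (- const_symf x) ^ r * bern (n - r) (elem_sym r)) =
    dilate (\<lambda>k. 1 - x ^ k) (complete_sym n)"
proof -
  let ?X = "const_symf x"
  define g :: "nat \<Rightarrow> 'a symf" where "g = (\<lambda>j. (- 1) ^ j * elem_sym j * complete_sym (n - j))"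
  have geo: "(1 - ?X) * (\<Sum>r\<in>{j..<n}. ?X ^ r) = ?X ^ j - ?X ^ n" if "j \<le> n" for j
    using that
  proof (induction n rule: dec_induct)
    case (step m)
    then show ?case by (simp add: distrib_left sum.atLeastLessThan_Suc) (simp add: algebra_simps)
  qed simp
  have "(1 - ?X) * (\<Sum>r<n. (- ?X) ^ r * bern (n - r) (elem_sym r)) = (\<Sum>j<n. g j * ((1 - ?X) * (\<Sum>r\<in>{j..<n}. ?X ^ r)))"
  proof -
    define S where "S = (\<lambda>j. \<Sum>r\<in>{j..<n}. ?X ^ r)"
    have "(1 - ?X) * (\<Sum>j<n. g j * S j) = (\<Sum>j<n. g j * ((1 - ?X) * S j))"
      unfolding sum_distrib_left by (intro sum.cong refl) (rule mult.left_commute)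
    then show ?thesis unfolding sum_hooks g_def S_def .
  qed
  also have "\<dots> = (\<Sum>j<n. g j * ?X ^ j - g j * ?X ^ n)"
    by (intro sum.cong refl) (simp only: geo lessThan_iff less_imp_le right_diff_distrib)
  also have "\<dots> = (\<Sum>j<Suc n. g j * ?X ^ j) - (\<Sum>j<Suc n. g j) * ?X ^ n"
    by (simp add: sum_subtractf sum_distrib_right distrib_right)
  also have "(\<Sum>j<Suc n. g j) = 0"
    using sum_elem_complete[of n, where 'a = 'a] assms by (simp add: g_def lessThan_Suc_atMost del: sum.lessThan_Suc)
  finally show ?thesis by (simp add: dilate_complete_sym g_def lessThan_Suc_atMost del: sum.lessThan_Suc)
qed

text \<open>The series E with coefficients (-1)^j e_j inverts H, so Newton's equation gives p_n =
  \<Sum> (-1)^j e_j (n - j) h_(n-j). The factor n - j is the weight of j in \<open>sum_hooks\<close>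
  at X = 1.\<close>

lemma power_sum_hooks:
  assumes "n > 0"
  shows "(power_sum n :: 'a :: field_char_0 symf) = (\<Sum>r<n. (- 1) ^ r * bern (n - r) (elem_sym r))"
proof -
  define E H P :: "'a symf fps" where "E = Abs_fps (\<lambda>n. (- 1) ^ n * elem_sym n)"
    and "H = Abs_fps complete_sym" and "P = Abs_fps (\<lambda>k. if k = 0 then 0 else power_sum k)"
  have "newton (\<lambda>_. 0) (E * H)"
    using newton_mult[OF newton_alt_elem_sym newton_complete_sym] by (simp add: E_def H_def)
  then have EH: "E * H = 1" using newton_one by (rule newton_unique)
  have "fps_X * fps_deriv H = P * H"
    using newton_complete_sym[where 'a = 'a] unfolding newton_def H_def P_def by blast
  then have "E * (fps_X * fps_deriv H) = P" using EH by (metis mult.left_commute mult.right_neutral)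
  then have "power_sum n = (E * (fps_X * fps_deriv H)) $ n" using assms by (simp add: P_def)
  also have "\<dots> = (\<Sum>j\<le>n. (- 1) ^ j * elem_sym j * (of_nat (n - j) * complete_sym (n - j)))"
  proof -
    have XH: "(fps_X * fps_deriv H) $ m = of_nat m * complete_sym m" for m
      by (cases m) (auto simp: H_def)
    show ?thesis unfolding fps_mult_nth[of E] XH by (simp add: E_def atMost_atLeast0)
  qed
  also have "\<dots> = (\<Sum>j<n. (- 1) ^ j * elem_sym j * complete_sym (n - j) * (\<Sum>r\<in>{j..<n}. 1 ^ r))"
    by (simp add: lessThan_Suc_atMost[symmetric] mult_ac)
  also have "\<dots> = (\<Sum>r<n. (- 1) ^ r * bern (n - r) (elem_sym r))"
    unfolding sum_hooks[symmetric] ..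
  finally show ?thesis .
qed

subsection \<open>Principal specialization of Schur functions\<close>

text \<open>f[1/(1 - q)], formally f at 1, q, q^2, ...; going through power sums involves no
  convergence.\<close>

definition principal :: "'a :: field_char_0 \<Rightarrow> 'a symf \<Rightarrow> 'a" where
  "principal q = psub (\<lambda>x. x) (\<lambda>k. inverse (1 - q ^ k))"

definition one_var :: "'a :: field_char_0 symf \<Rightarrow> 'a" where
  "one_var = psub (\<lambda>x. x) (\<lambda>_. 1)"

interpretation principal: comm_ring_hom "principal q"
  unfolding principal_def by (rule psub_hom[OF comm_ring_hom_ident])

interpretation one_var: comm_ring_hom "one_var"
  unfolding one_var_def by (rule psub_hom[OF comm_ring_hom_ident])

lemma one_var_const: "one_var (const_symf c) = c"
  unfolding one_var_def by (rule psub_const[OF comm_ring_hom_ident])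

lemma one_var_scale: "one_var (scale_symf c f) = c * one_var f"
  by (simp add: scale_symf_def one_var.hom_mult one_var_const)

lemma one_var_dilate: "one_var (dilate (\<lambda>k. inverse (1 - q ^ k)) f) = principal q f"
proof (rule symf_hom_eqI[OF comm_ring_hom_comp[OF one_var.comm_ring_hom_axioms comm_ring_hom_dilate]
      principal.comm_ring_hom_axioms])
  show "one_var (dilate (\<lambda>k. inverse (1 - q ^ k)) (const_symf c)) = principal q (const_symf c)" for c
    unfolding principal_def by (simp add: one_var_const psub_const[OF comm_ring_hom_ident])
  show "one_var (dilate (\<lambda>k. inverse (1 - q ^ k)) (power_sum k)) = principal q (power_sum k)" if "k > 0" for k
    using that unfolding principal_def
    by (simp add: dilate_power_sum one_var.hom_mult one_var_const psub_power_sum[OF comm_ring_hom_ident])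
       (simp add: one_var_def psub_power_sum[OF comm_ring_hom_ident])
qed

text \<open>1/(1 - q) - 1 = q/(1 - q), so the generating series satisfies B(z)(1 - z) =
  B(qz).\<close>

lemma principal_complete_rec:
  assumes q: "\<And>k. k > 0 \<Longrightarrow> q ^ k \<noteq> (1 :: 'a :: field_char_0)"
  shows "principal q (complete_sym n) = (1 - q ^ Suc n) * principal q (complete_sym (Suc n))"
proof -
  define B where "B = Abs_fps (\<lambda>n. principal q (complete_sym n))"
  have B: "newton (\<lambda>k. inverse (1 - q ^ k)) B"
  proof -
    have "newton (\<lambda>k. principal q (power_sum k)) B"
      using newton_hom[OF principal.comm_ring_hom_axioms newton_complete_sym] by (simp add: B_def)
    then show ?thesis
      by (rule newton_cong) (simp add: principal_def psub_power_sum[OF comm_ring_hom_ident])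
  qed
  have "newton (\<lambda>k. inverse (1 - q ^ k) + - (1 ^ k)) (B * (1 - fps_const 1 * fps_X))"
    by (rule newton_mult[OF B newton_linear])
  then have "newton (\<lambda>k. q ^ k * inverse (1 - q ^ k)) (B * (1 - fps_const 1 * fps_X))"
    by (rule newton_cong) (use q in \<open>auto simp: field_simps\<close>)
  then have "B * (1 - fps_X) = Abs_fps (\<lambda>n. q ^ n * B $ n)"
    using newton_unique[OF _ newton_scale[OF B]] by simp
  then have "(B * (1 - fps_X)) $ Suc n = q ^ Suc n * B $ Suc n" by simp
  then have "B $ Suc n - B $ n = q ^ Suc n * B $ Suc n" by (simp add: right_diff_distrib)
  then show ?thesis by (simp add: B_def algebra_simps)
qed

lemma principal_complete_nonzero:
  assumes q: "\<And>k. k > 0 \<Longrightarrow> q ^ k \<noteq> (1 :: 'a :: field_char_0)"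
  shows "principal q (complete_sym n) \<noteq> 0"
proof (induction n)
  case (Suc n)
  then show ?case using principal_complete_rec[OF q, of n] by auto
qed (simp add: principal.hom_one)

text \<open>Each step of \<open>principal_complete_rec\<close> contributes a factor 1 - q^(m-s). For
  r > m the factor with s = m vanishes, so the zero entries of the Jacobi-Trudi matrix follow the
  same formula.\<close>

lemma principal_complete_drop:
  assumes q: "\<And>k. k > 0 \<Longrightarrow> q ^ k \<noteq> (1 :: 'a :: field_char_0)" and q0: "q \<noteq> 0"
  shows "(if r \<le> m then principal q (complete_sym (m - r)) else 0) =
    principal q (complete_sym m) * (\<Prod>s<r. 1 - q ^ m * inverse q ^ s)"
proof (induction r)
  case (Suc r)
  show ?case
  proof (cases "r \<le> m")
    case True
    have qm: "q ^ m * inverse q ^ r = q ^ (m - r)"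
      using True q0 by (simp add: power_diff divide_inverse power_inverse)
    have "principal q (complete_sym m) * (\<Prod>s<Suc r. 1 - q ^ m * inverse q ^ s) =
        principal q (complete_sym (m - r)) * (1 - q ^ (m - r))"
      using Suc True by (simp add: qm flip: mult.assoc)
    also have "\<dots> = (if Suc r \<le> m then principal q (complete_sym (m - Suc r)) else 0)"
    proof (cases "Suc r \<le> m")
      case True
      then have "m - r = Suc (m - Suc r)" by auto
      then show ?thesis using True principal_complete_rec[OF q, of "m - Suc r"] by (simp add: mult.commute)
    next
      case False
      then show ?thesis using \<open>r \<le> m\<close> by auto
    qed
    finally show ?thesis by simp
  next
    case False
    then show ?thesis using Suc by auto
  qed
qed simp

text \<open>A kernel vector of the evaluated Jacobi-Trudi matrix would give a polynomial of degree less
  than the number of parts with that many roots \<open>q ^ (\<mu> ! i + l - 1 - i)\<close>.\<close>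

lemma principal_schur_nonzero:
  assumes q: "\<And>k. k > 0 \<Longrightarrow> q ^ k \<noteq> (1 :: 'a :: field_char_0)" and q0: "q \<noteq> 0"
    and mu: "is_partition \<mu>"
  shows "principal q (schur \<mu>) \<noteq> 0"
proof
  assume z: "principal q (schur \<mu>) = 0"
  define l where "l = length \<mu>"
  \<comment> \<open>Strictly decreasing shifted parts. The entry in row i and column j has index m_i
    - (l - 1 - j), so by \<open>principal_complete_drop\<close> it is the value of h_(m_i) times a
    polynomial of degree at most l - 1 - j in q^(m_i).\<close>
  define m where "m = (\<lambda>i. \<mu> ! i + (l - 1 - i))"
  define B where "B = (\<lambda>n. principal q (complete_sym n))"
  define \<pi> where "\<pi> = (\<lambda>r. \<Prod>s<r. [:1, - (inverse q ^ s):])"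
  have pi: "poly (\<pi> r) x = (\<Prod>s<r. 1 - x * inverse q ^ s)" for r x
    by (simp add: \<pi>_def poly_prod mult.commute)
  have deg: "degree (\<pi> r) \<le> r" for r
  proof (induction r)
    case (Suc r)
    have "degree (\<pi> (Suc r)) \<le> degree (\<pi> r) + degree [:1, - (inverse q ^ r):]"
      by (simp only: \<pi>_def prod.lessThan_Suc degree_mult_le)
    also have "\<dots> \<le> r + 1" using Suc by (intro add_mono) auto
    finally show ?case by simp
  qed (simp add: \<pi>_def)
  define A where "A = mat l l (\<lambda>(i, j). B (m i) * poly (\<pi> (l - 1 - j)) (q ^ m i))"
  have A: "A \<in> carrier_mat l l" by (simp add: A_def)
  have "schur \<mu> = det (mat l l (\<lambda>(i, j). if i \<le> \<mu> ! i + j then complete_sym (\<mu> ! i + j - i) else (0 :: 'a symf)))"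
    by (simp add: schur_def l_def)
  then have "principal q (schur \<mu>) = det (map_mat (principal q) (mat l l (\<lambda>(i, j). if i \<le> \<mu> ! i + j then complete_sym (\<mu> ! i + j - i) else 0)))"
    by (simp add: principal.hom_det)
  also have "map_mat (principal q) (mat l l (\<lambda>(i, j). if i \<le> \<mu> ! i + j then complete_sym (\<mu> ! i + j - i) else 0)) = A"
  proof (rule eq_matI)
    fix i j assume "i < dim_row A" "j < dim_col A"
    then have ij: "i < l" "j < l" by (simp_all add: A_def)
    have 1: "i \<le> \<mu> ! i + j \<longleftrightarrow> l - 1 - j \<le> m i" and 2: "\<mu> ! i + j - i = m i - (l - 1 - j)"
      using ij by (auto simp: m_def)
    have "principal q (if i \<le> \<mu> ! i + j then complete_sym (\<mu> ! i + j - i) else 0) =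
        (if l - 1 - j \<le> m i then principal q (complete_sym (m i - (l - 1 - j))) else 0)"
      unfolding 1 2 by (simp add: principal.hom_zero)
    also have "\<dots> = B (m i) * poly (\<pi> (l - 1 - j)) (q ^ m i)"
      unfolding B_def pi by (rule principal_complete_drop[OF q q0])
    finally show "map_mat (principal q) (mat l l (\<lambda>(i, j). if i \<le> \<mu> ! i + j then complete_sym (\<mu> ! i + j - i) else 0)) $$ (i, j) = A $$ (i, j)"
      using ij by (simp add: A_def)
  qed (simp_all add: A_def)
  finally have "det A = 0" using z by simp
  then obtain v where v: "v \<in> carrier_vec l" "v \<noteq> 0\<^sub>v l" "A *\<^sub>v v = 0\<^sub>v l"
    using det_0_iff_vec_prod_zero_field[OF A] by blast
  define w where "w = (\<lambda>r. vec_index v (l - 1 - r))"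
  define p where "p = (\<Sum>r<l. smult (w r) (\<pi> r))"
  have root: "poly p (q ^ m i) = 0" if "i < l" for i
  proof -
    have "0 = vec_index (A *\<^sub>v v) i" using v that by simp
    also have "\<dots> = (\<Sum>j<l. B (m i) * poly (\<pi> (l - 1 - j)) (q ^ m i) * vec_index v j)"
      using that v(1) by (simp add: scalar_prod_def A_def lessThan_atLeast0)
    also have "\<dots> = B (m i) * (\<Sum>j<l. poly (\<pi> (l - 1 - j)) (q ^ m i) * vec_index v j)"
      by (simp add: sum_distrib_left mult.assoc)
    also have "(\<Sum>j<l. poly (\<pi> (l - 1 - j)) (q ^ m i) * vec_index v j) = (\<Sum>r<l. poly (\<pi> r) (q ^ m i) * w r)"
      by (rule sum.reindex_bij_witness[of _ "\<lambda>r. l - 1 - r" "\<lambda>j. l - 1 - j"]) (auto simp: w_def)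
    also have "\<dots> = poly p (q ^ m i)" by (simp add: p_def poly_sum mult.commute)
    finally show ?thesis using principal_complete_nonzero[OF q, of "m i"] by (simp add: B_def)
  qed
  have inj_pow: "a = b" if "q ^ a = q ^ b" for a b
  proof -
    have "x = y" if "q ^ x = q ^ y" "x \<le> y" for x y
    proof (rule ccontr)
      assume "x \<noteq> y"
      have "q ^ y = q ^ x * q ^ (y - x)" using that(2) by (metis le_add_diff_inverse power_add)
      then have "q ^ (y - x) = 1" using that q0 by simp
      then show False using q[of "y - x"] that \<open>x \<noteq> y\<close> by simp
    qed
    from this[of a b] this[of b a] show ?thesis using that by (metis nat_le_linear)
  qed
  have mdec: "m i > m j" if "i < j" "j < l" for i j
  proof -
    have "\<mu> ! i \<ge> \<mu> ! j" using mu that by (simp add: is_partition_def sorted_wrt_iff_nth_less l_def)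
    then show ?thesis using that by (simp add: m_def)
  qed
  have "inj_on (\<lambda>i. q ^ m i) {..<l}"
  proof (rule inj_onI)
    fix i j assume ij: "i \<in> {..<l}" "j \<in> {..<l}" "q ^ m i = q ^ m j"
    then have "m i = m j" using inj_pow by blast
    then show "i = j" using mdec[of i j] mdec[of j i] ij by (metis lessThan_iff less_irrefl linorder_neqE_nat)
  qed
  then have card: "card ((\<lambda>i. q ^ m i) ` {..<l}) = l" by (simp add: card_image)
  have "p = 0"
  proof (rule ccontr)
    assume "p \<noteq> 0"
    then have "card ((\<lambda>i. q ^ m i) ` {..<l}) \<le> card {x. poly p x = 0}"
      using root by (intro card_mono poly_roots_finite) auto
    also have "\<dots> \<le> degree p" using \<open>p \<noteq> 0\<close> by (rule card_poly_roots_bound)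
    finally have "l \<le> degree p" using card by simp
    moreover have "degree p < l" if "l > 0"
    proof -
      have "degree p \<le> l - 1" unfolding p_def
        by (rule degree_sum_le) (use deg that in \<open>auto intro!: order_trans[OF degree_smult_le] order_trans[OF deg]\<close>)
      then show ?thesis using that by simp
    qed
    ultimately have "l = 0" by (cases "l = 0") auto
    then show False using \<open>p \<noteq> 0\<close> by (simp add: p_def)
  qed
  \<comment> \<open>At q^r every \<pi>_s with s > r vanishes through its factor of index r, while
    \<pi>_r does not. Evaluating the zero polynomial there makes the coefficients vanish one after
    another.\<close>
  have w0: "r < l \<longrightarrow> w r = 0" for r
  proof (induction r rule: less_induct)
    case (less r)
    show ?case
    proof
      assume r: "r < l"
      have "0 = poly p (q ^ r)" by (simp add: \<open>p = 0\<close>)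
      also have "\<dots> = (\<Sum>s<l. w s * poly (\<pi> s) (q ^ r))" by (simp add: p_def poly_sum)
      also have "\<dots> = (\<Sum>s\<in>{r}. w s * poly (\<pi> s) (q ^ r))"
      proof (rule sum.mono_neutral_right)
        show "\<forall>s\<in>{..<l} - {r}. w s * poly (\<pi> s) (q ^ r) = 0"
        proof
          fix s assume s: "s \<in> {..<l} - {r}"
          show "w s * poly (\<pi> s) (q ^ r) = 0"
          proof (cases "s < r")
            case True
            then show ?thesis using less s by auto
          next
            case False
            then have "r < s" using s by auto
            moreover have "1 - q ^ r * inverse q ^ r = 0" using q0 by (simp add: power_inverse)
            ultimately have "poly (\<pi> s) (q ^ r) = 0" unfolding pi by (intro prod_zero) auto
            then show ?thesis by simp
          qed
        qed
      qed (use r in auto)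
      finally have "w r * poly (\<pi> r) (q ^ r) = 0" by simp
      moreover have "poly (\<pi> r) (q ^ r) \<noteq> 0"
      proof -
        have "1 - q ^ r * inverse q ^ s \<noteq> 0" if "s < r" for s
        proof -
          have "q ^ r * inverse q ^ s = q ^ (r - s)"
            using that q0 by (simp add: power_diff divide_inverse power_inverse)
          then show ?thesis using q[of "r - s"] that by simp
        qed
        then show ?thesis unfolding pi by (simp add: prod_zero_iff)
      qed
      ultimately show "w r = 0" by simp
    qed
  qed
  have "vec_index v j = 0" if "j < l" for j
    using w0[of "l - 1 - j"] that by (simp add: w_def)
  then have "v = 0\<^sub>v l" using v(1) by (intro eq_vecI) auto
  then show False using v(2) by simp
qed

subsection \<open>The Hall product with a complete symmetric function\<close>

lemma power_sum_coeffs_zero [simp]: "power_sum_coeffs (0 :: 'a :: field_char_0 symf) \<mu> = 0"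
  using power_sum_coeffs_sum[of "{}" "\<lambda>_. 0 :: 'a"] by simp

lemma power_sum_coeffs_sum_symf:
  "power_sum_coeffs (sum f A) \<mu> = (\<Sum>x\<in>A. power_sum_coeffs (f x :: 'a :: field_char_0 symf) \<mu>)"
  by (induction A rule: infinite_finite_induct) (auto simp: power_sum_coeffs_add)

lemma mset_sort_part_pos: "0 \<notin># M \<Longrightarrow> mset (sort_part M) = M"
  by (auto simp: mset_sort_part filter_mset_eq_conv intro!: gr0I)

text \<open>Multiplying by p_k inserts a part k, so the only source of \<mu> is \<mu> with one k
  removed.\<close>

lemma power_sum_coeffs_power_sum_mult:
  fixes f :: "'a :: field_char_0 symf"
  assumes "k > 0" "is_partition \<mu>"
  shows "power_sum_coeffs (power_sum k * f) \<mu> =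
    (if k \<in> set \<mu> then power_sum_coeffs f (sort_part (mset \<mu> - {#k#})) else 0)"
proof -
  let ?c = "power_sum_coeffs f" and ?ins = "\<lambda>\<nu>. sort_part (add_mset k (mset \<nu>))"
  have nz: "0 \<notin> set \<nu>" if "is_partition \<nu>" for \<nu> using that by (simp add: is_partition_def)
  have "power_sum k * f = (\<Sum>\<nu> | ?c \<nu> \<noteq> 0. scale_symf (?c \<nu>) (power_sum_part (k # \<nu>)))"
    by (subst power_sum_expansion[of f, symmetric]) (simp add: sum_distrib_left scale_symf_mult_right)
  also have "\<dots> = (\<Sum>\<nu> | ?c \<nu> \<noteq> 0. scale_symf (?c \<nu>) (power_sum_part (?ins \<nu>)))"
  proof (intro sum.cong refl)
    fix \<nu> assume "\<nu> \<in> {\<nu>. ?c \<nu> \<noteq> 0}"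
    then have "0 \<notin> set (k # \<nu>)" using assms nz power_sum_coeffs_partition[of f \<nu>] by auto
    from power_sum_part_sort[OF this, where 'a = 'a]
    show "scale_symf (?c \<nu>) (power_sum_part (k # \<nu>)) = scale_symf (?c \<nu>) (power_sum_part (?ins \<nu>))" by simp
  qed
  finally have "power_sum_coeffs (power_sum k * f) \<mu> = (\<Sum>\<nu> | ?c \<nu> \<noteq> 0. if \<mu> = ?ins \<nu> then ?c \<nu> else 0)"
    by (simp add: power_sum_coeffs_sum_symf power_sum_coeffs_scale power_sum_coeffs_part if_distrib cong: if_cong)
  also have "\<dots> = (if k \<in> set \<mu> then ?c (sort_part (mset \<mu> - {#k#})) else 0)"
  proof (cases "k \<in> set \<mu>")
    case True
    let ?\<nu> = "sort_part (mset \<mu> - {#k#})"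
    have m\<nu>: "mset ?\<nu> = mset \<mu> - {#k#}"
      using nz[OF assms(2)] by (intro mset_sort_part_pos) (auto dest: in_diffD)
    have iff: "\<mu> = ?ins \<nu> \<longleftrightarrow> \<nu> = ?\<nu>" if "?c \<nu> \<noteq> 0" for \<nu>
    proof -
      have p: "is_partition \<nu>" using that by (rule power_sum_coeffs_partition)
      then have mi: "mset (?ins \<nu>) = add_mset k (mset \<nu>)"
        using nz[OF p] assms(1) by (intro mset_sort_part_pos) auto
      have "\<mu> = ?ins \<nu> \<longleftrightarrow> mset \<mu> = add_mset k (mset \<nu>)"
        using mi assms(2) partition_eqI[of \<mu> "?ins \<nu>"] by auto
      also have "\<dots> \<longleftrightarrow> mset \<nu> = mset \<mu> - {#k#}" using True by (auto simp: insert_DiffM)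
      also have "\<dots> \<longleftrightarrow> \<nu> = ?\<nu>" using m\<nu> p partition_eqI[of \<nu> ?\<nu>] by auto
      finally show ?thesis .
    qed
    have "(\<Sum>\<nu> | ?c \<nu> \<noteq> 0. if \<mu> = ?ins \<nu> then ?c \<nu> else 0) = (\<Sum>\<nu> | ?c \<nu> \<noteq> 0. if \<nu> = ?\<nu> then ?c \<nu> else 0)"
      by (intro sum.cong refl) (use iff in auto)
    also have "\<dots> = ?c ?\<nu>" using finite_power_sum_coeffs[of f] by (simp add: sum.delta)
    finally show ?thesis using True by simp
  next
    case False
    have "\<mu> \<noteq> ?ins \<nu>" for \<nu>
    proof
      assume "\<mu> = ?ins \<nu>"
      then have "k \<in># mset \<mu>" using assms(1) by (simp add: mset_sort_part)
      then show False using False by simp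
    qed
    then show ?thesis using False by simp
  qed
  finally show ?thesis .
qed

lemma z_part_remove:
  assumes "k \<in> set \<mu>" "is_partition \<mu>"
  shows "z_part \<mu> = k * count_list \<mu> k * z_part (sort_part (mset \<mu> - {#k#}))"
proof -
  let ?\<nu> = "sort_part (mset \<mu> - {#k#})"
  have m\<nu>: "mset ?\<nu> = mset \<mu> - {#k#}"
    using assms(2) by (intro mset_sort_part_pos) (auto simp: is_partition_def dest: in_diffD)
  have s\<nu>: "set ?\<nu> \<subseteq> set \<mu>" using m\<nu> by (metis in_diffD set_mset_mset subsetI)
  have c\<nu>: "count_list ?\<nu> i = (if i = k then count_list \<mu> k - 1 else count_list \<mu> i)" for i
    by (simp flip: count_mset add: m\<nu>)
  let ?f = "\<lambda>xs i. i ^ count_list xs i * fact (count_list xs i) :: nat"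
  have "z_part ?\<nu> = (\<Prod>i\<in>set \<mu>. ?f ?\<nu> i)"
    unfolding z_part_def by (rule prod.mono_neutral_left) (use s\<nu> in \<open>auto simp: count_list_0_iff\<close>)
  also have "\<dots> = ?f ?\<nu> k * (\<Prod>i\<in>set \<mu> - {k}. ?f ?\<nu> i)"
    using assms(1) by (intro prod.remove) auto
  also have "(\<Prod>i\<in>set \<mu> - {k}. ?f ?\<nu> i) = (\<Prod>i\<in>set \<mu> - {k}. ?f \<mu> i)"
    by (intro prod.cong refl) (simp add: c\<nu>)
  finally have 1: "z_part ?\<nu> = ?f ?\<nu> k * (\<Prod>i\<in>set \<mu> - {k}. ?f \<mu> i)" .
  have 2: "z_part \<mu> = ?f \<mu> k * (\<Prod>i\<in>set \<mu> - {k}. ?f \<mu> i)"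
    unfolding z_part_def using assms(1) by (intro prod.remove) auto
  obtain c where c: "count_list \<mu> k = Suc c" using assms(1) by (metis count_list_0_iff not0_implies_Suc)
  have "?f \<mu> k = k * count_list \<mu> k * ?f ?\<nu> k" by (simp add: c\<nu> c algebra_simps)
  then show ?thesis unfolding 1 2 by (simp only: mult.assoc)
qed

text \<open>The coefficients of h_n are 1/z_\<mu>. In n h_n = \<Sum> p_k h_(n-k), removing one part
  k divides z_\<mu> by k m_k, with m_k its multiplicity, and \<Sum> k m_k = n.\<close>

lemma power_sum_coeffs_complete_sym:
  "\<mu> \<in> partitions_of n \<Longrightarrow> power_sum_coeffs (complete_sym n :: 'a :: field_char_0 symf) \<mu> * of_nat (z_part \<mu>) = 1"
proof (induction n arbitrary: \<mu> rule: less_induct)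
  case (less n)
  have p: "is_partition \<mu>" and s: "sum_list \<mu> = n" using less.prems by (auto simp: partitions_of_def)
  let ?c = "\<lambda>n. power_sum_coeffs (complete_sym n :: 'a symf)"
  show ?case
  proof (cases "n = 0")
    case True
    then have "\<mu> = []" using p s by (cases \<mu>) (auto simp: is_partition_def)
    then show ?thesis using True power_sum_coeffs_part[of "[]" "[]", where 'a = 'a]
      by (simp add: z_part_def is_partition_def)
  next
    case False
    have nz: "k > 0" if "k \<in> set \<mu>" for k using that p by (metis bot_nat_0.not_eq_extremum is_partition_def)
    have kn: "k \<le> n" if "k \<in> set \<mu>" for k using that s by (metis member_le_sum_list zero_le)
    have "scale_symf (of_nat n) (complete_sym n) = (\<Sum>k=1..n. power_sum k * complete_sym (n - k) :: 'a symf)"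
      using newton_complete_sym[where 'a = 'a] by (simp add: newton_iff scale_symf_def const_symf_of_nat)
    then have "of_nat n * ?c n \<mu> = (\<Sum>k=1..n. power_sum_coeffs (power_sum k * complete_sym (n - k)) \<mu>)"
      by (metis power_sum_coeffs_scale power_sum_coeffs_sum_symf)
    also have "\<dots> = (\<Sum>k=1..n. if k \<in> set \<mu> then ?c (n - k) (sort_part (mset \<mu> - {#k#})) else 0)"
      by (intro sum.cong refl power_sum_coeffs_power_sum_mult p) auto
    also have "\<dots> = (\<Sum>k\<in>set \<mu>. ?c (n - k) (sort_part (mset \<mu> - {#k#})))"
      by (rule sum.mono_neutral_cong_right) (use nz kn in \<open>auto simp: Suc_le_eq\<close>)
    finally have "of_nat n * (?c n \<mu> * of_nat (z_part \<mu>)) =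
        (\<Sum>k\<in>set \<mu>. ?c (n - k) (sort_part (mset \<mu> - {#k#})) * of_nat (z_part \<mu>))"
      by (simp add: sum_distrib_right flip: mult.assoc)
    also have "\<dots> = (\<Sum>k\<in>set \<mu>. of_nat (count_list \<mu> k * k))"
    proof (intro sum.cong refl)
      fix k assume k: "k \<in> set \<mu>"
      have "sum_mset (mset \<mu> - {#k#}) = n - k"
        using k s by (simp add: sum_mset_diff sum_mset_sum_list)
      then have "sort_part (mset \<mu> - {#k#}) \<in> partitions_of (n - k)"
        by (simp add: partitions_of_def sum_list_sort_part)
      then have "?c (n - k) (sort_part (mset \<mu> - {#k#})) * of_nat (z_part (sort_part (mset \<mu> - {#k#}))) = 1"
        using less.IH[of "n - k"] nz[OF k] False by auto
      then show "?c (n - k) (sort_part (mset \<mu> - {#k#})) * of_nat (z_part \<mu>) = of_nat (count_list \<mu> k * k)"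
        unfolding z_part_remove[OF k p] by (simp add: mult_ac)
    qed
    also have "\<dots> = of_nat (\<Sum>k\<in>set \<mu>. count_list \<mu> k * k)" by simp
    also have "(\<Sum>k\<in>set \<mu>. count_list \<mu> k * k) = n"
      using s sum_list_map_eq_sum_count[of "\<lambda>x. x" \<mu>] by simp
    finally show ?thesis using False by simp
  qed
qed

text \<open>The coefficient 1/z_\<mu> of h_n cancels the weight z_\<mu>, which leaves the sum of the
  power sum coefficients of f, that is f[1].\<close>

lemma hall_complete_sym:
  fixes f :: "'a :: field_char_0 symf"
  assumes "homogeneous_symf n f"
  shows "hall f (complete_sym n) = one_var f"
proof -
  have "hall f (complete_sym n) = (\<Sum>\<mu> | power_sum_coeffs f \<mu> \<noteq> 0. power_sum_coeffs f \<mu>)"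
    unfolding hall_def
    by (intro sum.cong refl)
       (use power_sum_coeffs_complete_sym power_sum_coeffs_homogeneous[OF assms] in \<open>auto simp: mult.assoc\<close>)
  also have "\<dots> = one_var f" by (simp add: one_var_def psub_def map_replicate_const)
  finally show ?thesis .
qed

lemma schur_singleton: "schur [n] = (complete_sym n :: 'a :: field_char_0 symf)"
  by (simp add: schur_Cons bern_def pair_def trans.hom_one)


subsection \<open>Substitution in rational functions\<close>

lemma comm_ring_hom_of_rat: "comm_ring_hom (of_rat :: rat \<Rightarrow> qt)"
  by (rule comm_ring_homI) (auto simp: of_rat_add of_rat_mult)

lemma comm_ring_hom_qt_eval: "comm_ring_hom (qt_eval x y)"
proof -
  have "comm_ring_hom (\<lambda>a. poly (map_poly of_rat a) x)"
    by (rule comm_ring_hom_comp[OF comm_ring_hom_poly comm_ring_hom_map_poly[OF comm_ring_hom_of_rat]])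
  then have "comm_ring_hom (\<lambda>P. poly (map_poly (\<lambda>a. poly (map_poly of_rat a) x) P) y)"
    by (rule comm_ring_hom_comp[OF comm_ring_hom_poly comm_ring_hom_map_poly])
  then show ?thesis unfolding qt_eval_def[abs_def] .
qed

interpretation qt_eval: comm_ring_hom "qt_eval x y"
  by (rule comm_ring_hom_qt_eval)

text \<open>The graph of \<open>qt_subst\<close> on its domain. The relation carries regularity and
  value together, so an expression is specialized by composing closure rules, and only
  \<open>qt_spec_inverse\<close> asks for a nonzero value.\<close>

definition qt_spec :: "qt \<Rightarrow> qt \<Rightarrow> qt \<Rightarrow> qt \<Rightarrow> bool" where
  "qt_spec x y c r \<longleftrightarrow> (\<exists>P Q. Q \<noteq> 0 \<and> c = Fract P Q \<and> qt_eval x y Q \<noteq> 0 \<and> r = qt_eval x y P / qt_eval x y Q)"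

lemma qt_specI: "Q \<noteq> 0 \<Longrightarrow> c = Fract P Q \<Longrightarrow> qt_eval x y Q \<noteq> 0 \<Longrightarrow> r = qt_eval x y P / qt_eval x y Q \<Longrightarrow> qt_spec x y c r"
  unfolding qt_spec_def by blast

lemma qt_spec_unique:
  assumes "qt_spec x y c r" "qt_spec x y c s"
  shows "r = s"
proof -
  obtain P Q P' Q' where *: "Q \<noteq> 0" "c = Fract P Q" "qt_eval x y Q \<noteq> 0" "r = qt_eval x y P / qt_eval x y Q"
    "Q' \<noteq> 0" "c = Fract P' Q'" "qt_eval x y Q' \<noteq> 0" "s = qt_eval x y P' / qt_eval x y Q'"
    using assms unfolding qt_spec_def by blast
  then have "P * Q' = P' * Q" by (simp add: eq_fract)
  then have "qt_eval x y P * qt_eval x y Q' = qt_eval x y P' * qt_eval x y Q"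
    by (metis qt_eval.hom_mult)
  then show ?thesis using * by (simp add: frac_eq_eq)
qed

lemma qt_spec_subst: "qt_spec x y c r \<Longrightarrow> qt_subst x y c = r"
  unfolding qt_subst_def using qt_spec_unique by (intro the_equality) (auto simp: qt_spec_def[symmetric])

lemma qt_regular_iff: "qt_regular x y c \<longleftrightarrow> (\<exists>r. qt_spec x y c r)"
  unfolding qt_regular_def qt_spec_def by blast

lemma qt_spec_regular: "qt_regular x y c \<Longrightarrow> qt_spec x y c (qt_subst x y c)"
  using qt_regular_iff qt_spec_subst by metis

lemma qt_spec_add:
  assumes "qt_spec x y a r" "qt_spec x y b s"
  shows "qt_spec x y (a + b) (r + s)"
proof -
  obtain P Q P' Q' where *: "Q \<noteq> 0" "a = Fract P Q" "qt_eval x y Q \<noteq> 0" "r = qt_eval x y P / qt_eval x y Q"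
    "Q' \<noteq> 0" "b = Fract P' Q'" "qt_eval x y Q' \<noteq> 0" "s = qt_eval x y P' / qt_eval x y Q'"
    using assms unfolding qt_spec_def by blast
  then show ?thesis
    by (intro qt_specI[of "Q * Q'" _ "P * Q' + P' * Q"])
       (simp_all add: qt_eval.hom_mult qt_eval.hom_add add_frac_eq)
qed

lemma qt_spec_mult:
  assumes "qt_spec x y a r" "qt_spec x y b s"
  shows "qt_spec x y (a * b) (r * s)"
proof -
  obtain P Q P' Q' where *: "Q \<noteq> 0" "a = Fract P Q" "qt_eval x y Q \<noteq> 0" "r = qt_eval x y P / qt_eval x y Q"
    "Q' \<noteq> 0" "b = Fract P' Q'" "qt_eval x y Q' \<noteq> 0" "s = qt_eval x y P' / qt_eval x y Q'"
    using assms unfolding qt_spec_def by blast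
  then show ?thesis
    by (intro qt_specI[of "Q * Q'" _ "P * P'"]) (auto simp: qt_eval.hom_mult)
qed

lemma qt_spec_inverse:
  assumes "qt_spec x y a r" "r \<noteq> 0"
  shows "qt_spec x y (inverse a) (inverse r)"
proof -
  obtain P Q where *: "Q \<noteq> 0" "a = Fract P Q" "qt_eval x y Q \<noteq> 0" "r = qt_eval x y P / qt_eval x y Q"
    using assms unfolding qt_spec_def by blast
  then have "qt_eval x y P \<noteq> 0" using assms(2) by auto
  moreover from this have "P \<noteq> 0" by auto
  ultimately show ?thesis using * by (intro qt_specI[of P _ Q]) auto
qed

lemma qt_spec_poly: "qt_spec x y (Fract P 1) (qt_eval x y P)"
  by (rule qt_specI[of 1 _ P]) auto

lemma qt_spec_0 [simp]: "qt_spec x y 0 0"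
  using qt_spec_poly[of x y 0] by (simp flip: Zero_fract_def)

lemma qt_spec_1 [simp]: "qt_spec x y 1 1"
  using qt_spec_poly[of x y 1] by (simp flip: One_fract_def)

lemma qt_spec_uminus: "qt_spec x y a r \<Longrightarrow> qt_spec x y (- a) (- r)"
proof -
  assume a: "qt_spec x y a r"
  have "qt_spec x y (- 1) (- 1)"
    using qt_spec_poly[of x y "- 1"] by (simp add: qt_eval.hom_uminus flip: One_fract_def minus_fract)
  from qt_spec_mult[OF this a] show ?thesis by simp
qed

lemma qt_spec_diff: "qt_spec x y a r \<Longrightarrow> qt_spec x y b s \<Longrightarrow> qt_spec x y (a - b) (r - s)"
  using qt_spec_add[of x y a r "- b" "- s"] qt_spec_uminus[of x y b s] by simp

lemma qt_spec_power: "qt_spec x y a r \<Longrightarrow> qt_spec x y (a ^ n) (r ^ n)"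
  by (induction n) (auto intro: qt_spec_mult)

lemma qt_spec_sum: "(\<And>i. i \<in> A \<Longrightarrow> qt_spec x y (a i) (r i)) \<Longrightarrow> qt_spec x y (sum a A) (sum r A)"
  by (induction A rule: infinite_finite_induct) (auto intro: qt_spec_add)

lemma qt_spec_of_nat: "qt_spec x y (of_nat n) (of_nat n)"
  by (induction n) (auto intro: qt_spec_add)

lemma qt_spec_q: "qt_spec x y q_var x"
proof -
  have "qt_eval x y [:[:0, 1:]:] = x" by (simp add: qt_eval_def map_poly_pCons)
  then show ?thesis using qt_spec_poly[of x y "[:[:0, 1:]:]"] by (simp add: q_var_def)
qed

lemma qt_spec_t: "qt_spec x y t_var y"
proof -
  have "qt_eval x y [:0, 1:] = y" by (simp add: qt_eval_def map_poly_pCons)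
  then show ?thesis using qt_spec_poly[of x y "[:0, 1:]"] by (simp add: t_var_def)
qed

lemma qt_spec_cell_sum:
  assumes "qt_spec x y a r" "qt_spec x y b s"
  shows "qt_spec x y (cell_sum a b \<mu>) (cell_sum r s \<mu>)"
  unfolding cell_sum_def by (intro qt_spec_sum qt_spec_mult qt_spec_power assms)

lemma qt_spec_eigenval:
  assumes "qt_spec x y a r" "qt_spec x y b s"
  shows "qt_spec x y (eigenval a b \<mu>) (eigenval r s \<mu>)"
  by (induction \<mu>) (auto intro!: qt_spec_add qt_spec_mult qt_spec_diff qt_spec_power assms)

section \<open>Powers of q and distinctness of the eigenvalues\<close>

lemma sum_q_var_power: "(\<Sum>i\<in>A. q_var ^ e i) = Fract [:\<Sum>i\<in>A. monom 1 (e i):] 1"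
proof -
  have p: "q_var ^ n = Fract [:monom 1 n:] 1" for n
  proof (induction n)
    case (Suc n)
    have "q_var ^ Suc n = q_var * Fract [:monom 1 n:] 1" by (simp only: power_Suc Suc)
    also have "\<dots> = Fract ([:[:0, 1:]:] * [:monom 1 n:]) (1 * 1)"
      by (simp only: q_var_def mult_fract)
    also have "[:[:0, 1:]:] * [:monom 1 n:] = [:monom (1 :: rat) (Suc n):]"
      by (simp add: monom_Suc)
    finally show ?case by simp
  qed (simp add: One_fract_def one_pCons)
  show ?thesis
  proof (induction A rule: infinite_finite_induct)
    case (insert a A)
    have "(\<Sum>i\<in>insert a A. q_var ^ e i) = Fract [:monom 1 (e a):] 1 + Fract [:\<Sum>i\<in>A. monom 1 (e i):] 1"
      using insert by (simp add: p)
    also have "\<dots> = Fract ([:monom 1 (e a):] + [:\<Sum>i\<in>A. monom 1 (e i):]) 1" by simp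
    finally show ?case using insert by simp
  qed (auto simp: Zero_fract_def)
qed

lemma q_var_nonzero [simp]: "q_var \<noteq> 0"
  by (simp add: q_var_def Zero_fract_def eq_fract)

lemma q_var_power_inject: "q_var ^ a = q_var ^ b \<longleftrightarrow> a = b"
proof
  assume "q_var ^ a = q_var ^ b"
  then have "Fract [:monom (1 :: rat) a:] 1 = Fract [:monom 1 b:] 1"
    using sum_q_var_power[of "\<lambda>_. a" "{0 :: nat}"] sum_q_var_power[of "\<lambda>_. b" "{0 :: nat}"] by simp
  then have "monom (1 :: rat) a = monom 1 b" by (simp add: eq_fract)
  then show "a = b" by (metis degree_monom_eq one_neq_zero)
qed simp

lemma q_var_generic: "k > 0 \<Longrightarrow> q_var ^ k \<noteq> 1"
  using q_var_power_inject[of k 0] by simp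

text \<open>Substituting q = 1 and t = q turns t^k = 1 into q^k = 1, which is already
  excluded.\<close>

lemma t_var_generic: "k > 0 \<Longrightarrow> t_var ^ k \<noteq> 1"
proof
  assume "k > 0" "t_var ^ k = 1"
  then have "qt_spec 1 q_var 1 (q_var ^ k)" using qt_spec_power[OF qt_spec_t[of 1 q_var], of k] by simp
  then have "q_var ^ k = 1" using qt_spec_unique qt_spec_1 by blast
  then show False using q_var_generic \<open>k > 0\<close> by blast
qed

text \<open>Empty rows leave the eigenvalue unchanged because 1 = t + (1 - t). Padding to N rows
  gives all partitions of n the same constant t^N, so that only the sums have to be
  compared.\<close>

lemma eigenval_padded:
  assumes "length \<mu> \<le> N"
  shows "eigenval q t \<mu> = t ^ N + (1 - t) * (\<Sum>i<N. t ^ i * q ^ (if i < length \<mu> then \<mu> ! i else 0))"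
  using assms
proof (induction \<mu> arbitrary: N)
  case Nil
  have "(1 - t) * (\<Sum>i<N. t ^ i) = 1 - t ^ N"
    by (induction N) (simp_all add: distrib_left, simp add: algebra_simps)
  then show ?case by simp
next
  case (Cons a \<mu>)
  then obtain M where N: "N = Suc M" "length \<mu> \<le> M" by (cases N) auto
  have "(\<Sum>i<N. t ^ i * q ^ (if i < length (a # \<mu>) then (a # \<mu>) ! i else 0)) =
      q ^ a + t * (\<Sum>i<M. t ^ i * q ^ (if i < length \<mu> then \<mu> ! i else 0))"
    unfolding N by (simp add: sum.lessThan_Suc_shift sum_distrib_left mult.assoc del: sum.lessThan_Suc)
      (auto intro!: sum.cong)
  moreover define S where "S = (\<Sum>i<M. t ^ i * q ^ (if i < length \<mu> then \<mu> ! i else 0))"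
  ultimately have sum: "(\<Sum>i<N. t ^ i * q ^ (if i < length (a # \<mu>) then (a # \<mu>) ! i else 0)) = q ^ a + t * S"
    by (simp only:)
  have "eigenval q t \<mu> = t ^ M + (1 - t) * S" using Cons.IH[OF N(2)] by (simp only: S_def)
  then have "eigenval q t (a # \<mu>) = t * (t ^ M + (1 - t) * S) + (1 - t) * q ^ a" by simp
  also have "\<dots> = t ^ Suc M + (1 - t) * (q ^ a + t * S)" by (simp add: algebra_simps)
  finally show ?case unfolding sum unfolding N(1) .
qed

text \<open>At \<open>t = 1/q\<close> the eigenvalue determines the set of shifted parts \<open>\<mu> ! i - i\<close>.\<close>

lemma inj_eigenval_special: "inj_on (eigenval q_var (1 / q_var)) (partitions_of n)"
proof (rule inj_onI)
  fix \<mu> \<nu> assume mu: "\<mu> \<in> partitions_of n" and nu: "\<nu> \<in> partitions_of n"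
    and eq: "eigenval q_var (1 / q_var) \<mu> = eigenval q_var (1 / q_var) \<nu>"
  define part where "part = (\<lambda>(\<kappa> :: nat list) i. if i < length \<kappa> then \<kappa> ! i else 0)"
  \<comment> \<open>Adding n - i clears the negative powers of q that come from t^i = q^(-i) and
    makes the exponents strictly decreasing in i, so the sum of the monomials determines
    them.\<close>
  define e where "e = (\<lambda>\<kappa> i. part \<kappa> i + (n - i))"
  have len: "length \<kappa> \<le> n" if "\<kappa> \<in> partitions_of n" for \<kappa>
    using that length_le_sum_list[of \<kappa>] by (auto simp: partitions_of_def is_partition_def)
  have q1: "1 - 1 / q_var \<noteq> 0" using q_var_generic[of 1] by auto
  have sum: "(\<Sum>i<n. (1 / q_var) ^ i * q_var ^ part \<kappa> i) * q_var ^ n = (\<Sum>i<n. q_var ^ e \<kappa> i)" for \<kappa>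
    unfolding sum_distrib_right
  proof (intro sum.cong refl)
    fix i assume "i \<in> {..<n}"
    then have "q_var ^ n = q_var ^ i * q_var ^ (n - i)" by (simp flip: power_add)
    then show "(1 / q_var) ^ i * q_var ^ part \<kappa> i * q_var ^ n = q_var ^ e \<kappa> i"
      by (simp add: e_def power_add power_one_over)
  qed
  have "(\<Sum>i<n. (1 / q_var) ^ i * q_var ^ part \<mu> i) = (\<Sum>i<n. (1 / q_var) ^ i * q_var ^ part \<nu> i)"
    using eq q1 eigenval_padded[OF len[OF mu], of q_var "1 / q_var"] eigenval_padded[OF len[OF nu], of q_var "1 / q_var"]
    by (simp add: part_def)
  then have "(\<Sum>i<n. q_var ^ e \<mu> i) = (\<Sum>i<n. q_var ^ e \<nu> i)"
    unfolding sum[symmetric] by (rule arg_cong[of _ _ "\<lambda>x. x * q_var ^ n"])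
  then have poly_eq: "(\<Sum>i<n. monom (1 :: rat) (e \<mu> i)) = (\<Sum>i<n. monom 1 (e \<nu> i))"
    by (simp add: sum_q_var_power eq_fract)
  have dec: "e \<kappa> j < e \<kappa> i" if "\<kappa> \<in> partitions_of n" "i < j" "j < n" for \<kappa> i j
  proof -
    have "part \<kappa> j \<le> part \<kappa> i"
      using that by (auto simp: part_def partitions_of_def is_partition_def sorted_wrt_iff_nth_less)
    then show ?thesis using that by (simp add: e_def)
  qed
  have img: "s \<in> e \<kappa> ` {..<n} \<longleftrightarrow> coeff (\<Sum>i<n. monom (1 :: rat) (e \<kappa> i)) s \<noteq> 0" for \<kappa> s
  proof -
    have "coeff (\<Sum>i<n. monom (1 :: rat) (e \<kappa> i)) s = (\<Sum>i\<in>{i\<in>{..<n}. e \<kappa> i = s}. 1)"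
      unfolding coeff_sum by (subst sum.inter_filter) auto
    moreover have "(\<Sum>i\<in>{i\<in>{..<n}. e \<kappa> i = s}. 1 :: rat) = of_nat (card {i\<in>{..<n}. e \<kappa> i = s})" by simp
    moreover have "card {i\<in>{..<n}. e \<kappa> i = s} \<noteq> 0 \<longleftrightarrow> s \<in> e \<kappa> ` {..<n}" by (auto simp: image_iff)
    ultimately show ?thesis by (simp only: of_nat_eq_0_iff)
  qed
  have "e \<mu> ` {..<n} = e \<nu> ` {..<n}" unfolding set_eq_iff img poly_eq by simp
  moreover have "sorted_wrt (<) (rev (map (e \<kappa>) [0..<n]))" if "\<kappa> \<in> partitions_of n" for \<kappa>
    unfolding sorted_wrt_rev sorted_wrt_map by (rule sorted_wrt_mono_rel[OF _ sorted_wrt_upt]) (use dec[OF that] in auto)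
  ultimately have "rev (map (e \<mu>) [0..<n]) = rev (map (e \<nu>) [0..<n])"
    using mu nu by (intro strict_sorted_equal) (auto simp: lessThan_atLeast0)
  then have "e \<mu> i = e \<nu> i" if "i < n" for i using that by simp
  then have "part \<mu> i + (n - i) = part \<nu> i + (n - i)" if "i < n" for i using that by (simp only: e_def)
  then have p: "part \<mu> i = part \<nu> i" if "i < n" for i using that by (metis add_right_cancel)
  have pos: "\<kappa> ! i > 0" if "\<kappa> \<in> partitions_of n" "i < length \<kappa>" for \<kappa> i
  proof (rule gr0I)
    assume "\<kappa> ! i = 0"
    then have "0 \<in> set \<kappa>" using that(2) nth_mem[of i \<kappa>] by simp
    then show False using that(1) by (simp add: partitions_of_def is_partition_def)
  qed
  have "i < length \<mu> \<longleftrightarrow> i < length \<nu>" for i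
    using p[of i] pos[OF mu, of i] pos[OF nu, of i] len[OF mu] len[OF nu] by (auto simp: part_def split: if_splits)
  then have l: "length \<mu> = length \<nu>" by (meson linorder_neqE_nat less_irrefl)
  then show "\<mu> = \<nu>"
  proof (rule nth_equalityI)
    fix i assume "i < length \<mu>"
    then show "\<mu> ! i = \<nu> ! i" using p[of i] l len[OF mu] by (simp add: part_def)
  qed
qed

interpretation spec: macdonald q_var "1 / q_var"
proof
  show "(1 / q_var) ^ k \<noteq> 1" if "k > 0" for k
    using q_var_generic[OF that] by (simp add: power_one_over)
qed (use q_var_generic inj_eigenval_special in auto)

text \<open>Equal eigenvalues would remain equal at t = 1/q, where they are known to be
  distinct.\<close>

interpretation gen: macdonald q_var t_var
proof
  fix n show "inj_on (eigenval q_var t_var) (partitions_of n)"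
  proof (rule inj_onI)
    fix \<mu> \<nu> assume *: "\<mu> \<in> partitions_of n" "\<nu> \<in> partitions_of n" "eigenval q_var t_var \<mu> = eigenval q_var t_var \<nu>"
    have "qt_spec q_var (1 / q_var) (eigenval q_var t_var \<mu>) (eigenval q_var (1 / q_var) \<mu>)" for \<mu>
      by (rule qt_spec_eigenval[OF qt_spec_q qt_spec_t])
    then have "eigenval q_var (1 / q_var) \<mu> = eigenval q_var (1 / q_var) \<nu>"
      using *(3) qt_spec_unique by metis
    then show "\<mu> = \<nu>" using * inj_eigenval_special[of n] by (meson inj_onD)
  qed
qed (use q_var_generic t_var_generic in auto)

subsection \<open>Plethysm\<close>

lemma repeat_mset_inject: "k > 0 \<Longrightarrow> repeat_mset k a = repeat_mset k b \<longleftrightarrow> a = b"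
  by (auto simp: multiset_eq_iff)

lemma adams_coeff:
  assumes "k > 0"
  shows "coeff_symf (adams k A) (repeat_mset k m) = qt_subst (q_var ^ k) (t_var ^ k) (coeff_symf A m)"
proof -
  have "{m'. repeat_mset k m' = repeat_mset k m} = {m}" using repeat_mset_inject[OF assms] by auto
  then show ?thesis by (simp add: adams.rep_eq)
qed

lemma adams_coeff_other:
  assumes "\<And>m'. m = repeat_mset k m' \<Longrightarrow> coeff_symf A m' = 0"
  shows "coeff_symf (adams k A) m = 0"
  unfolding adams.rep_eq by (rule sum.neutral) (use assms in auto)

lemma adams_const:
  assumes "k > 0" "qt_spec (q_var ^ k) (t_var ^ k) c r"
  shows "adams k (const_symf c) = const_symf r"
proof (rule symf_eqI)
  fix m
  show "coeff_symf (adams k (const_symf c)) m = coeff_symf (const_symf r) m"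
  proof (cases "m = {#}")
    case True
    then show ?thesis using adams_coeff[OF assms(1), of "const_symf c" "{#}"] qt_spec_subst[OF assms(2)]
      by (simp add: coeff_symf_const)
  next
    case False
    then have "coeff_symf (adams k (const_symf c)) m = 0"
      by (intro adams_coeff_other) (auto simp: coeff_symf_const)
    then show ?thesis using False by (simp add: coeff_symf_const)
  qed
qed

lemma adams_X_times_const:
  assumes "k > 0" "qt_spec (q_var ^ k) (t_var ^ k) c r"
  shows "adams k (X_alphabet * const_symf c) = const_symf r * power_sum k"
proof (rule symf_eqI)
  fix m
  have c: "coeff_symf (X_alphabet * const_symf c) m = (if \<exists>i. m = {#i#} then c else 0)" for m
    by (simp add: X_alphabet_def mult.commute[of _ "const_symf c"] coeff_const_times power_sum.rep_eq)
  have r: "coeff_symf (const_symf r * power_sum k) m = (if \<exists>i. m = replicate_mset k i then r else 0)"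
    by (simp add: coeff_const_times power_sum.rep_eq)
  have rep: "replicate_mset k i = repeat_mset k {#i#}" for i
    by (simp add: repeat_mset_replicate_mset[of k 1, simplified])
  show "coeff_symf (adams k (X_alphabet * const_symf c)) m = coeff_symf (const_symf r * power_sum k) m"
  proof (cases "\<exists>i. m = replicate_mset k i")
    case True
    then obtain i where i: "m = repeat_mset k {#i#}" using rep by auto
    show ?thesis unfolding r using True adams_coeff[OF assms(1), of "X_alphabet * const_symf c" "{#i#}"] qt_spec_subst[OF assms(2)]
      by (simp add: i c)
  next
    case False
    then have "coeff_symf (adams k (X_alphabet * const_symf c)) m = 0"
      using rep by (intro adams_coeff_other) (auto simp: c)
    then show ?thesis unfolding r using False by simp
  qed
qed

lemma plethysm_psub: "plethysm f A = psub const_symf (\<lambda>k. adams k A) f"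
  by (simp add: plethysm_def psub_def scale_symf_def)

lemma psub_cong: "(\<And>k. k > 0 \<Longrightarrow> v k = v' k) \<Longrightarrow> psub \<iota> v f = psub \<iota> v' f"
  unfolding psub_def
proof (intro sum.cong refl arg_cong[of _ _ "\<lambda>x. _ * x"] arg_cong[of _ _ prod_list] map_cong)
  fix \<mu> k assume v: "\<And>k. k > 0 \<Longrightarrow> v k = v' k" and "\<mu> \<in> {\<mu>. power_sum_coeffs f \<mu> \<noteq> 0}" "k \<in> set \<mu>"
  then have "k > 0" using power_sum_coeffs_partition[of f \<mu>] by (auto simp: is_partition_def intro: gr0I)
  then show "v k = v' k" by (rule v)
qed

lemma plethysm_X_times_const:
  assumes "\<And>k. k > 0 \<Longrightarrow> qt_spec (q_var ^ k) (t_var ^ k) c (r k)"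
  shows "plethysm f (X_alphabet * const_symf c) = dilate r f"
  unfolding plethysm_psub dilate_def by (rule psub_cong) (rule adams_X_times_const[OF _ assms])

lemma const_symf_psub: "const_symf (psub (\<lambda>x. x) v f) = psub const_symf (\<lambda>k. const_symf (v k)) f"
proof -
  interpret c: comm_ring_hom "const_symf :: 'a \<Rightarrow> 'a symf" by (rule comm_ring_hom_const_symf)
  show ?thesis by (simp add: psub_def c.hom_sum c.hom_mult c.hom_prod_list o_def)
qed

lemma plethysm_const:
  assumes "\<And>k. k > 0 \<Longrightarrow> qt_spec (q_var ^ k) (t_var ^ k) c (r k)"
  shows "plethysm f (const_symf c) = const_symf (psub (\<lambda>x. x) r f)"
  unfolding plethysm_psub const_symf_psub by (rule psub_cong) (rule adams_const[OF _ assms])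

lemma plethysm_one_minus_q: "plethysm f (X_alphabet * const_symf (1 - q_var)) = dilate (\<lambda>k. 1 - q_var ^ k) f"
  by (rule plethysm_X_times_const) (intro qt_spec_diff qt_spec_1 qt_spec_q)

lemma plethysm_one_minus_t: "plethysm f (X_alphabet * const_symf (1 - t_var)) = dilate (\<lambda>k. 1 - t_var ^ k) f"
  by (rule plethysm_X_times_const) (intro qt_spec_diff qt_spec_1 qt_spec_t)

lemma B_part_cell_sum: "B_part \<mu> = cell_sum q_var t_var \<mu>"
  by (simp add: B_part_def cell_sum_def)

text \<open>The scalar f[B_\<mu>]: replacing q and t by their k-th powers in B_\<mu> gives a cell
  sum again.\<close>

definition B_eval :: "qt symf \<Rightarrow> nat list \<Rightarrow> qt" where
  "B_eval f \<mu> = psub (\<lambda>x. x) (\<lambda>k. cell_sum (q_var ^ k) (t_var ^ k) \<mu>) f"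

lemma plethysm_B_part: "plethysm f (const_symf (B_part \<mu>)) = const_symf (B_eval f \<mu>)"
  unfolding B_eval_def B_part_cell_sum
  by (rule plethysm_const) (intro qt_spec_cell_sum qt_spec_q qt_spec_t)

subsection \<open>Specialization of symmetric functions at \<open>t = 1/q\<close>\<close>

abbreviation sp :: "qt \<Rightarrow> qt \<Rightarrow> bool" where
  "sp \<equiv> qt_spec q_var (1 / q_var)"

definition symf_spec :: "qt symf \<Rightarrow> qt symf \<Rightarrow> bool" where
  "symf_spec f g \<longleftrightarrow> (\<forall>m. sp (coeff_symf f m) (coeff_symf g m))"

definition poly_spec :: "qt symf poly \<Rightarrow> qt symf poly \<Rightarrow> bool" where
  "poly_spec P Q \<longleftrightarrow> (\<forall>i. symf_spec (coeff P i) (coeff Q i))"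

lemma symf_specD: "symf_spec f g \<Longrightarrow> t_regular f \<and> t_specialize f = g"
  unfolding symf_spec_def t_regular_def
  by (auto simp: qt_regular_iff t_specialize.rep_eq qt_spec_subst intro!: symf_eqI)

lemma symf_spec_t_specialize: "t_regular f \<Longrightarrow> symf_spec f (t_specialize f)"
  unfolding symf_spec_def t_regular_def by (simp add: t_specialize.rep_eq qt_spec_regular)

lemma symf_spec_add: "symf_spec f g \<Longrightarrow> symf_spec f' g' \<Longrightarrow> symf_spec (f + f') (g + g')"
  by (simp add: symf_spec_def qt_spec_add)

lemma symf_spec_diff: "symf_spec f g \<Longrightarrow> symf_spec f' g' \<Longrightarrow> symf_spec (f - f') (g - g')"
  by (simp add: symf_spec_def qt_spec_diff)

lemma symf_spec_mult: "symf_spec f g \<Longrightarrow> symf_spec f' g' \<Longrightarrow> symf_spec (f * f') (g * g')"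
  unfolding symf_spec_def coeff_symf_mult by (auto intro!: qt_spec_sum qt_spec_mult)

lemma symf_spec_const: "sp c d \<Longrightarrow> symf_spec (const_symf c) (const_symf d)"
  by (simp add: symf_spec_def coeff_symf_const)

lemma symf_spec_0 [simp]: "symf_spec 0 0"
  by (simp add: symf_spec_def)

lemma symf_spec_1 [simp]: "symf_spec 1 1"
  by (simp add: symf_spec_def coeff_symf_one)

lemma symf_spec_scale: "sp c d \<Longrightarrow> symf_spec f g \<Longrightarrow> symf_spec (scale_symf c f) (scale_symf d g)"
  unfolding scale_symf_def by (intro symf_spec_mult symf_spec_const)

lemma symf_spec_power_sum: "symf_spec (power_sum k) (power_sum k)"
  by (simp add: symf_spec_def power_sum.rep_eq)

lemma symf_spec_sum: "(\<And>i. i \<in> A \<Longrightarrow> symf_spec (f i) (g i)) \<Longrightarrow> symf_spec (sum f A) (sum g A)"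
  by (induction A rule: infinite_finite_induct) (auto intro: symf_spec_add)

lemma symf_spec_uminus: "symf_spec f g \<Longrightarrow> symf_spec (- f) (- g)"
  using symf_spec_diff[of 0 0 f g] by simp

lemma symf_spec_power: "symf_spec f g \<Longrightarrow> symf_spec (f ^ n) (g ^ n)"
  by (induction n) (auto intro: symf_spec_mult)

lemma symf_spec_elem_sym: "symf_spec (elem_sym k) (elem_sym k)"
  by (simp add: symf_spec_def elem_sym.rep_eq)

lemma symf_spec_complete_sym: "symf_spec (complete_sym k) (complete_sym k)"
  by (simp add: symf_spec_def complete_sym.rep_eq)

lemma poly_spec_add: "poly_spec P Q \<Longrightarrow> poly_spec P' Q' \<Longrightarrow> poly_spec (P + P') (Q + Q')"
  by (simp add: poly_spec_def symf_spec_add)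

lemma poly_spec_mult: "poly_spec P Q \<Longrightarrow> poly_spec P' Q' \<Longrightarrow> poly_spec (P * P') (Q * Q')"
  unfolding poly_spec_def coeff_mult by (auto intro!: symf_spec_sum symf_spec_mult)

lemma poly_spec_const: "symf_spec f g \<Longrightarrow> poly_spec [:f:] [:g:]"
  by (simp add: poly_spec_def coeff_pCons split: nat.split)

lemma poly_spec_monom: "symf_spec f g \<Longrightarrow> poly_spec (monom f k) (monom g k)"
  by (simp add: poly_spec_def)

lemma pair_spec:
  assumes "poly_spec P Q" "\<And>i. symf_spec (w i) (u i)"
  shows "symf_spec (pair P w) (pair Q u)"
proof -
  let ?N = "max (degree P) (degree Q)"
  have "pair P w = (\<Sum>i\<le>?N. coeff P i * w i)" "pair Q u = (\<Sum>i\<le>?N. coeff Q i * u i)"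
    by (simp_all add: pair_bound)
  then show ?thesis
    using assms by (auto simp: poly_spec_def intro!: symf_spec_sum symf_spec_mult)
qed

text \<open>Regular rational functions form a ring closed under division by positive integers, so
  \<open>power_sum_expansion_exists\<close> applies with regularity as its predicate; specializing
  the coefficients then gives an expansion of g.\<close>

lemma symf_spec_expansion:
  assumes "symf_spec f g"
  shows "\<exists>S c d. finite S \<and> (\<forall>\<mu>\<in>S. is_partition \<mu> \<and> sp (c \<mu>) (d \<mu>)) \<and>
    f = (\<Sum>\<mu>\<in>S. scale_symf (c \<mu>) (power_sum_part \<mu>)) \<and> g = (\<Sum>\<mu>\<in>S. scale_symf (d \<mu>) (power_sum_part \<mu>))"
proof -
  define R where "R = qt_regular q_var (1 / q_var)"
  have R: "R a \<longleftrightarrow> (\<exists>r. sp a r)" for a by (simp add: R_def qt_regular_iff)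
  have "\<exists>c. finite {\<mu>. c \<mu> \<noteq> 0} \<and> (\<forall>\<mu>. c \<mu> \<noteq> 0 \<longrightarrow> is_partition \<mu>) \<and> (\<forall>\<mu>. R (c \<mu>)) \<and>
      f = (\<Sum>\<mu> | c \<mu> \<noteq> 0. scale_symf (c \<mu>) (power_sum_part \<mu>))"
  proof (rule power_sum_expansion_exists)
    show "R (of_nat n)" for n using qt_spec_of_nat R by blast
    show "R (a - b)" if "R a" "R b" for a b using that qt_spec_diff unfolding R by blast
    show "R (a * b)" if "R a" "R b" for a b using that qt_spec_mult unfolding R by blast
    show "R (a / of_nat n)" if "R a" "n > 0" for a n
    proof -
      have "sp (inverse (of_nat n)) (inverse (of_nat n))" using that(2) by (intro qt_spec_inverse qt_spec_of_nat) simp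
      then show ?thesis using that(1) qt_spec_mult unfolding R divide_inverse by blast
    qed
    show "R (coeff_symf f m)" for m using assms by (auto simp: R symf_spec_def)
  qed
  then obtain c where c: "finite {\<mu>. c \<mu> \<noteq> 0}" "\<And>\<mu>. c \<mu> \<noteq> 0 \<Longrightarrow> is_partition \<mu>" "\<And>\<mu>. R (c \<mu>)"
    "f = (\<Sum>\<mu> | c \<mu> \<noteq> 0. scale_symf (c \<mu>) (power_sum_part \<mu>))" by blast
  obtain d where d: "\<And>\<mu>. sp (c \<mu>) (d \<mu>)" using c(3) unfolding R by metis
  define g' where "g' = (\<Sum>\<mu> | c \<mu> \<noteq> 0. scale_symf (d \<mu>) (power_sum_part \<mu>))"
  have part: "symf_spec (power_sum_part \<mu>) (power_sum_part \<mu>)" for \<mu>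
    by (induction \<mu>) (auto intro: symf_spec_mult symf_spec_power_sum)
  have "symf_spec f g'"
    unfolding g'_def c(4) by (intro symf_spec_sum symf_spec_scale d part)
  then have "g' = g" using assms symf_specD by metis
  then show ?thesis
    using c(1,2,4) d unfolding g'_def
    by (intro exI[of _ "{\<mu>. c \<mu> \<noteq> 0}"] exI[of _ c] exI[of _ d]) (simp only: mem_Collect_eq, simp)
qed

text \<open>Abstract in the relation \<open>Rel\<close> because the values may be scalars, symmetric
  functions or polynomials over these. By \<open>symf_spec_expansion\<close> both sides can be
  computed over the same set of partitions.\<close>

lemma psub_spec:
  assumes fg: "symf_spec f g" and hom: "comm_ring_hom \<iota>"
    and Rel: "Rel 0 0" "Rel 1 1" "\<And>a b a' b'. Rel a b \<Longrightarrow> Rel a' b' \<Longrightarrow> Rel (a + a') (b + b')"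
      "\<And>a b a' b'. Rel a b \<Longrightarrow> Rel a' b' \<Longrightarrow> Rel (a * a') (b * b')"
    and c: "\<And>c d. sp c d \<Longrightarrow> Rel (\<iota> c) (\<iota> d)" and v: "\<And>k. k > 0 \<Longrightarrow> Rel (v k) (v' k)"
  shows "Rel (psub \<iota> v f) (psub \<iota> v' g)"
proof -
  obtain S c d where S: "finite S" "\<And>\<mu>. \<mu> \<in> S \<Longrightarrow> is_partition \<mu>" "\<And>\<mu>. \<mu> \<in> S \<Longrightarrow> sp (c \<mu>) (d \<mu>)"
    and f: "f = (\<Sum>\<mu>\<in>S. scale_symf (c \<mu>) (power_sum_part \<mu>))" and g: "g = (\<Sum>\<mu>\<in>S. scale_symf (d \<mu>) (power_sum_part \<mu>))"
    using symf_spec_expansion[OF fg] by blast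
  have nz: "0 \<notin> set \<mu>" if "\<mu> \<in> S" for \<mu> using S(2)[OF that] by (simp add: is_partition_def)
  have e: "psub \<iota> w (\<Sum>\<mu>\<in>S. scale_symf (c \<mu>) (power_sum_part \<mu>)) = (\<Sum>\<mu>\<in>S. \<iota> (c \<mu>) * prod_list (map w \<mu>))" for w c
    unfolding psub_sum[OF hom] by (intro sum.cong refl psub_scale_part[OF hom] nz)
  have prod: "0 \<notin> set \<mu> \<Longrightarrow> Rel (prod_list (map v \<mu>)) (prod_list (map v' \<mu>))" for \<mu>
    by (induction \<mu>) (auto intro: Rel v)
  have sum: "Rel (sum a S) (sum b S)" if "\<And>\<mu>. \<mu> \<in> S \<Longrightarrow> Rel (a \<mu>) (b \<mu>)" for a b
    using S(1) that by (induction S rule: finite_induct) (auto intro: Rel)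
  show ?thesis unfolding f g e
    by (rule sum) (intro Rel c S prod nz)
qed

lemma trans_spec:
  assumes "symf_spec f g" "\<And>k. sp (v k) (v' k)"
  shows "poly_spec (trans v f) (trans v' g)"
  unfolding trans_def
  by (rule psub_spec[OF assms(1) comm_ring_hom_const_symf_poly])
     (auto intro!: poly_spec_add poly_spec_mult poly_spec_const poly_spec_monom symf_spec_const
       symf_spec_power_sum assms(2) simp: poly_spec_const[of 1 1, folded one_pCons] poly_spec_const[of 0 0, simplified])

lemma dilate_spec:
  assumes "symf_spec f g" "\<And>k. k > 0 \<Longrightarrow> sp (a k) (a' k)"
  shows "symf_spec (dilate a f) (dilate a' g)"
  unfolding dilate_def
  by (rule psub_spec[OF assms(1) comm_ring_hom_const_symf])
     (auto intro!: symf_spec_add symf_spec_mult symf_spec_const symf_spec_power_sum assms(2))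

lemma psub_ident_spec:
  assumes "symf_spec f g" "\<And>k. k > 0 \<Longrightarrow> sp (a k) (a' k)"
  shows "sp (psub (\<lambda>x. x) a f) (psub (\<lambda>x. x) a' g)"
  by (rule psub_spec[OF assms(1) comm_ring_hom_ident])
     (auto intro!: qt_spec_add qt_spec_mult assms(2))

lemma D0_spec:
  assumes "symf_spec f g"
  shows "symf_spec (D0 q_var t_var f) (D0 q_var (1 / q_var) g)"
  unfolding D0_def
  by (intro pair_spec trans_spec assms qt_spec_mult qt_spec_diff qt_spec_1 qt_spec_power qt_spec_q qt_spec_t
      symf_spec_mult symf_spec_power symf_spec_uminus symf_spec_1 symf_spec_elem_sym)

text \<open>The only denominators are differences of eigenvalues, which stay nonzero at t =
  1/q.\<close>

lemma proj_spec:
  assumes "symf_spec f g" "\<mu> \<in> partitions_of n"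
  shows "symf_spec (gen.tri.proj n \<mu> f) (spec.tri.proj n \<mu> g)"
proof -
  let ?l = "eigenval q_var t_var" and ?l' = "eigenval q_var (1 / q_var)"
  have l: "sp (?l \<nu>) (?l' \<nu>)" for \<nu> by (rule qt_spec_eigenval[OF qt_spec_q qt_spec_t])
  have "symf_spec (spectral_proj (D0 q_var t_var) ?l xs \<mu> f) (spectral_proj (D0 q_var (1 / q_var)) ?l' xs \<mu> g)"
    if "set xs \<subseteq> partitions_of n - {\<mu>}" for xs
    using that
  proof (induction xs)
    case (Cons \<nu> xs)
    have "?l' \<mu> - ?l' \<nu> \<noteq> 0" using Cons.prems assms(2) inj_eigenval_special[of n] by (auto simp: inj_on_def)
    then have "sp (inverse (?l \<mu> - ?l \<nu>)) (inverse (?l' \<mu> - ?l' \<nu>))" by (intro qt_spec_inverse qt_spec_diff l)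
    then show ?case
      using Cons unfolding spectral_proj_def
      by (auto intro!: symf_spec_scale symf_spec_diff D0_spec l)
  qed (use assms in \<open>simp add: spectral_proj_def\<close>)
  then show ?thesis
    unfolding gen.tri.proj_def spec.tri.proj_def using gen.tri.set_index_list[of n \<mu>] by simp
qed


subsection \<open>Modified Macdonald polynomials\<close>

lemma dilate_inverse_q:
  "dilate (\<lambda>k. 1 - q_var ^ k) (dilate (\<lambda>k. inverse (1 - q_var ^ k)) f) = f"
  "dilate (\<lambda>k. inverse (1 - q_var ^ k)) (dilate (\<lambda>k. 1 - q_var ^ k) f) = f"
  by (rule dilate_inverse, erule q_var_generic)+

lemma h_dil_span_q: "f \<in> symf.span (h_dil q_var ` S) \<longleftrightarrow> dilate (\<lambda>k. 1 - q_var ^ k) f \<in> symf.span (h_prod ` S)"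
  by (rule h_dil_span_iff) (erule q_var_generic)

lemma h_dil_span_t: "f \<in> symf.span (h_dil t_var ` S) \<longleftrightarrow> dilate (\<lambda>k. 1 - t_var ^ k) f \<in> symf.span (h_prod ` S)"
  by (rule h_dil_span_iff) (erule t_var_generic)

lemma homogeneous_dom_span:
  assumes "\<mu> \<in> partitions_of n" "f \<in> symf.span (h_dil q ` dom_up \<mu>)"
  shows "homogeneous_symf n (f :: 'a :: field_char_0 symf)"
  using assms(2)
proof (induction rule: symf.span_induct_alt)
  case (step c x y)
  then obtain \<nu> where "\<nu> \<in> dom_up \<mu>" "x = h_dil q \<nu>" by blast
  then have "homogeneous_symf n x"
    using dom_up_partitions_of[OF assms(1)] homogeneous_dilate[OF homogeneous_h_prod[of \<nu>]]
    by (auto simp: h_dil_def partitions_of_def)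
  then show ?case using step by (intro homogeneous_add homogeneous_scale)
qed simp

text \<open>At t = 1/q the eigenvector is proportional to s_\<mu>[X/(1 - q)], whose value at X = 1
  is the principal specialization of s_\<mu>.\<close>

lemma one_var_spec_eigvec:
  assumes mu: "\<mu> \<in> partitions_of n"
  shows "one_var (spec.tri.eigvec \<mu>) \<noteq> 0"
proof -
  have p: "is_partition \<mu>" using mu by (simp add: partitions_of_def)
  define u :: "qt symf" where "u = dilate (\<lambda>k. inverse (1 - q_var ^ k)) (schur \<mu>)"
  note inv = dilate_inverse_q
  have du: "dilate (\<lambda>k. 1 - q_var ^ k) u = schur \<mu>" by (simp add: u_def inv)
  have "dilate (\<lambda>k. 1 - q_var ^ k) (D0 q_var (1 / q_var) u) = scale_symf (eigenval q_var (1 / q_var) \<mu>) (schur \<mu>)"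
    unfolding dilate_D0 du by (rule schur_eigen) simp
  then have "dilate (\<lambda>k. inverse (1 - q_var ^ k)) (dilate (\<lambda>k. 1 - q_var ^ k) (D0 q_var (1 / q_var) u)) =
      scale_symf (eigenval q_var (1 / q_var) \<mu>) u"
    by (simp only: dilate_scale u_def)
  then have eig: "D0 q_var (1 / q_var) u = scale_symf (eigenval q_var (1 / q_var) \<mu>) u"
    by (simp only: inv)
  have "(schur \<mu> :: qt symf) \<in> symf.span (schur ` dom_up \<mu>)"
    using p by (intro symf.span_base) (simp add: dom_up_def)
  then have "u \<in> symf.span (h_dil q_var ` dom_up \<mu>)"
    unfolding schur_span[OF p] h_dil_span_q du .
  then have "u \<in> symf.span (h_dil q_var ` partitions_of n)"
    using homogeneous_dom_span[OF mu] spec.homogeneous_span by blast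
  then obtain a where a: "u = scale_symf a (spec.tri.eigvec \<mu>)"
    using spec.tri.eigen_multiple[OF _ mu eig] by blast
  have "one_var u \<noteq> 0"
    unfolding u_def one_var_dilate by (rule principal_schur_nonzero[OF q_var_generic q_var_nonzero p])
  then show ?thesis unfolding a one_var_scale by simp
qed

text \<open>Both eigenvectors are projections of the same h_\<mu>[X/(1 - q)], which does not involve
  t.\<close>

lemma gen_eigvec_spec:
  assumes "\<mu> \<in> partitions_of n"
  shows "symf_spec (gen.tri.eigvec \<mu>) (spec.tri.eigvec \<mu>)"
proof -
  have "symf_spec (h_prod \<mu>) (h_prod \<mu>)"
    by (induction \<mu>) (auto intro: symf_spec_mult symf_spec_complete_sym)
  then have "symf_spec (h_dil q_var \<mu>) (h_dil q_var \<mu>)"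
    unfolding h_dil_def
  proof (rule dilate_spec)
    fix k :: nat assume "k > 0"
    then have "1 - q_var ^ k \<noteq> 0" using q_var_generic[of k] by auto
    then show "sp (inverse (1 - q_var ^ k)) (inverse (1 - q_var ^ k))"
      by (intro qt_spec_inverse qt_spec_diff qt_spec_1 qt_spec_power qt_spec_q)
  qed
  from proj_spec[OF this assms] show ?thesis
    by (simp add: gen.tri.proj_b[OF assms] spec.tri.proj_b[OF assms])
qed

lemma one_var_gen_eigvec:
  assumes "\<mu> \<in> partitions_of n"
  shows "one_var (gen.tri.eigvec \<mu>) \<noteq> 0"
proof
  assume "one_var (gen.tri.eigvec \<mu>) = 0"
  moreover have "sp (one_var (gen.tri.eigvec \<mu>)) (one_var (spec.tri.eigvec \<mu>))"
    unfolding one_var_def by (rule psub_ident_spec[OF gen_eigvec_spec[OF assms]]) simp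
  ultimately have "sp 0 (one_var (spec.tri.eigvec \<mu>))" by simp
  then have "one_var (spec.tri.eigvec \<mu>) = 0" by (rule qt_spec_unique[OF _ qt_spec_0])
  then show False using one_var_spec_eigvec[OF assms] by simp
qed

text \<open>The two span conditions cut out the eigenline, and the Hall condition reads off the
  value at X = 1. That value is nonzero on the eigenvector, so exactly one multiple is
  normalized.\<close>

lemma mod_macdonald_eigvec:
  assumes mu: "\<mu> \<in> partitions_of n"
  shows "mod_macdonald \<mu> = scale_symf (inverse (one_var (gen.tri.eigvec \<mu>))) (gen.tri.eigvec \<mu>)"
proof -
  let ?v = "gen.tri.eigvec \<mu>"
  have p: "is_partition \<mu>" and s: "sum_list \<mu> = n" using mu by (auto simp: partitions_of_def)
  have pc: "is_partition (conjugate \<mu>)" using p by (rule is_partition_conjugate)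
  have char: "dilate (\<lambda>k. 1 - q_var ^ k) H \<in> symf.span (schur ` dom_up \<mu>) \<and>
      dilate (\<lambda>k. 1 - t_var ^ k) H \<in> symf.span (schur ` dom_up (conjugate \<mu>)) \<longleftrightarrow>
      (\<exists>a. H = scale_symf a ?v)" for H
    unfolding schur_span[OF p] schur_span[OF pc]
      h_dil_span_q[symmetric] h_dil_span_t[symmetric]
    by (rule gen.macdonald_characterization[OF mu])
  have hom: "homogeneous_symf n (scale_symf a ?v)" for a
  proof (intro homogeneous_scale homogeneous_dom_span[OF mu])
    show "?v \<in> symf.span (h_dil q_var ` dom_up \<mu>)"
      using gen.tri.eigvec_in_span[OF mu] unfolding dom_up_insert[OF mu] .
  qed
  have hall: "hall (scale_symf a ?v) (schur [n]) = a * one_var ?v" for a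
    unfolding schur_singleton hall_complete_sym[OF hom] one_var_scale ..
  note nz = one_var_gen_eigvec[OF mu]
  have iff: "homogeneous_symf n H \<and> plethysm H (X_alphabet * const_symf (1 - q_var)) \<in> symf.span (schur ` dom_up \<mu>) \<and>
      plethysm H (X_alphabet * const_symf (1 - t_var)) \<in> symf.span (schur ` dom_up (conjugate \<mu>)) \<and>
      hall H (schur [n]) = 1 \<longleftrightarrow> H = scale_symf (inverse (one_var ?v)) ?v" for H
    unfolding plethysm_one_minus_q plethysm_one_minus_t
  proof
    assume H: "homogeneous_symf n H \<and> dilate (\<lambda>k. 1 - q_var ^ k) H \<in> symf.span (schur ` dom_up \<mu>) \<and>
      dilate (\<lambda>k. 1 - t_var ^ k) H \<in> symf.span (schur ` dom_up (conjugate \<mu>)) \<and> hall H (schur [n]) = 1"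
    then obtain a where a: "H = scale_symf a ?v" using char by blast
    then have "a * one_var ?v = 1" using H hall by simp
    then have "a = inverse (one_var ?v)" using nz by (simp add: field_simps)
    then show "H = scale_symf (inverse (one_var ?v)) ?v" using a by simp
  next
    assume H: "H = scale_symf (inverse (one_var ?v)) ?v"
    then show "homogeneous_symf n H \<and> dilate (\<lambda>k. 1 - q_var ^ k) H \<in> symf.span (schur ` dom_up \<mu>) \<and>
      dilate (\<lambda>k. 1 - t_var ^ k) H \<in> symf.span (schur ` dom_up (conjugate \<mu>)) \<and> hall H (schur [n]) = 1"
      using char[of H] hom hall nz by auto
  qed
  show ?thesis
    unfolding mod_macdonald_def s dom_up_def[symmetric] iff by (rule the_eq_trivial)
qed

subsection \<open>The Delta operator\<close>

text \<open>\<open>Delta\<close> has to be linear on all symmetric functions, whereas the spectral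
  formula works in one degree at a time. Prescribing values on the p_\<mu> glues the degrees
  together.\<close>

definition linear_ext :: "(nat list \<Rightarrow> 'a :: field_char_0 symf) \<Rightarrow> 'a symf \<Rightarrow> 'a symf" where
  "linear_ext g f = (\<Sum>\<mu> | power_sum_coeffs f \<mu> \<noteq> 0. scale_symf (power_sum_coeffs f \<mu>) (g \<mu>))"

lemma linear_ext_superset:
  assumes "finite S" "{\<mu>. power_sum_coeffs f \<mu> \<noteq> 0} \<subseteq> S"
  shows "linear_ext g f = (\<Sum>\<mu>\<in>S. scale_symf (power_sum_coeffs f \<mu>) (g \<mu>))"
  unfolding linear_ext_def by (rule sum.mono_neutral_left) (use assms in auto)

lemma linear_linear_ext: "Vector_Spaces.linear scale_symf scale_symf (linear_ext g)"
proof -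
  have add: "linear_ext g (f + h) = linear_ext g f + linear_ext g h" for f h
  proof -
    define S where "S = {\<mu>. power_sum_coeffs f \<mu> \<noteq> 0} \<union> {\<mu>. power_sum_coeffs h \<mu> \<noteq> 0}"
    have "finite S" using finite_power_sum_coeffs by (auto simp: S_def)
    note e = linear_ext_superset[OF this, where g = g]
    have "linear_ext g (f + h) = (\<Sum>\<mu>\<in>S. scale_symf (power_sum_coeffs (f + h) \<mu>) (g \<mu>))"
      by (rule e) (auto simp: S_def power_sum_coeffs_add)
    then show ?thesis
      using e[of f] e[of h] by (simp add: S_def power_sum_coeffs_add symf.scale_left_distrib sum.distrib)
  qed
  have scale: "linear_ext g (scale_symf c f) = scale_symf c (linear_ext g f)" for c f
  proof -
    have "linear_ext g (scale_symf c f) =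
        (\<Sum>\<mu> | power_sum_coeffs f \<mu> \<noteq> 0. scale_symf (power_sum_coeffs (scale_symf c f) \<mu>) (g \<mu>))"
      by (rule linear_ext_superset) (auto simp: finite_power_sum_coeffs power_sum_coeffs_scale)
    then show ?thesis by (simp add: linear_ext_def power_sum_coeffs_scale scale_symf_sum_right)
  qed
  show ?thesis by unfold_locales (simp_all add: add scale)
qed

text \<open>Any operator meeting the description of \<open>Delta\<close> multiplies each eigenline
  by \<open>B_eval\<close>, so it obeys the formula in every degree. Hence two such operators agree
  on the homogeneous p_\<mu>, and then everywhere; existence is shown by \<open>D1\<close>.\<close>

lemma Delta_homogeneous:
  assumes F: "homogeneous_symf n F"
  shows "Delta f F = (\<Sum>\<mu>\<in>partitions_of n. scale_symf (B_eval f \<mu>) (gen.tri.proj n \<mu> F))"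
proof -
  define is_Delta where "is_Delta = (\<lambda>D. Vector_Spaces.linear scale_symf scale_symf D \<and>
     (\<forall>\<mu>. is_partition \<mu> \<longrightarrow> D (mod_macdonald \<mu>) = plethysm f (const_symf (B_part \<mu>)) * mod_macdonald \<mu>))"
  have span: "homogeneous_symf n G \<Longrightarrow> G \<in> symf.span (h_dil q_var ` partitions_of n)" for n G
    using gen.homogeneous_span by blast
  have formula: "D G = (\<Sum>\<mu>\<in>partitions_of n. scale_symf (B_eval f \<mu>) (gen.tri.proj n \<mu> G))"
    if D: "is_Delta D" and G: "homogeneous_symf n G" for D n G
  proof -
    interpret D: Vector_Spaces.linear scale_symf scale_symf D using D by (simp add: is_Delta_def)
    have "D G = D (\<Sum>\<mu>\<in>partitions_of n. gen.tri.proj n \<mu> G)"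
      using gen.tri.sum_proj[OF span[OF G]] by simp
    also have "\<dots> = (\<Sum>\<mu>\<in>partitions_of n. D (gen.tri.proj n \<mu> G))" by (rule D.sum)
    also have "\<dots> = (\<Sum>\<mu>\<in>partitions_of n. scale_symf (B_eval f \<mu>) (gen.tri.proj n \<mu> G))"
    proof (intro sum.cong refl)
      fix \<mu> assume mu: "\<mu> \<in> partitions_of n"
      obtain a where "gen.tri.proj n \<mu> G = scale_symf a (gen.tri.eigvec \<mu>)"
        using gen.tri.proj_span[OF span[OF G] mu] by blast
      then have a: "gen.tri.proj n \<mu> G = scale_symf (a * one_var (gen.tri.eigvec \<mu>)) (mod_macdonald \<mu>)"
        using one_var_gen_eigvec[OF mu] by (simp add: mod_macdonald_eigvec[OF mu])
      have "D (mod_macdonald \<mu>) = scale_symf (B_eval f \<mu>) (mod_macdonald \<mu>)"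
        using D mu by (simp add: is_Delta_def partitions_of_def plethysm_B_part scale_symf_def)
      then show "D (gen.tri.proj n \<mu> G) = scale_symf (B_eval f \<mu>) (gen.tri.proj n \<mu> G)"
        unfolding a D.scale by (simp add: mult.commute)
    qed
    finally show ?thesis .
  qed
  define D1 where "D1 = linear_ext (\<lambda>\<kappa>. \<Sum>\<mu>\<in>partitions_of (sum_list \<kappa>).
      scale_symf (B_eval f \<mu>) (gen.tri.proj (sum_list \<kappa>) \<mu> (power_sum_part \<kappa>)))"
  have D1: "D1 G = (\<Sum>\<mu>\<in>partitions_of n. scale_symf (B_eval f \<mu>) (gen.tri.proj n \<mu> G))"
    if G: "homogeneous_symf n G" for n G
  proof -
    let ?c = "power_sum_coeffs G"
    have sub: "{\<mu>. ?c \<mu> \<noteq> 0} \<subseteq> partitions_of n" using power_sum_coeffs_homogeneous[OF G] by blast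
    have "D1 G = (\<Sum>\<kappa>\<in>partitions_of n. scale_symf (?c \<kappa>) (\<Sum>\<mu>\<in>partitions_of (sum_list \<kappa>).
        scale_symf (B_eval f \<mu>) (gen.tri.proj (sum_list \<kappa>) \<mu> (power_sum_part \<kappa>))))"
      unfolding D1_def by (rule linear_ext_superset[OF finite_partitions_of sub])
    also have "\<dots> = (\<Sum>\<kappa>\<in>partitions_of n. \<Sum>\<mu>\<in>partitions_of n.
        scale_symf (B_eval f \<mu>) (gen.tri.proj n \<mu> (scale_symf (?c \<kappa>) (power_sum_part \<kappa>))))"
    proof (intro sum.cong refl)
      fix \<kappa> assume "\<kappa> \<in> partitions_of n"
      then have "sum_list \<kappa> = n" by (simp add: partitions_of_def)
      then show "scale_symf (?c \<kappa>) (\<Sum>\<mu>\<in>partitions_of (sum_list \<kappa>).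
          scale_symf (B_eval f \<mu>) (gen.tri.proj (sum_list \<kappa>) \<mu> (power_sum_part \<kappa>))) =
          (\<Sum>\<mu>\<in>partitions_of n. scale_symf (B_eval f \<mu>) (gen.tri.proj n \<mu> (scale_symf (?c \<kappa>) (power_sum_part \<kappa>))))"
        by (simp add: scale_symf_sum_right gen.tri.proj_scale mult.commute)
    qed
    also have "\<dots> = (\<Sum>\<mu>\<in>partitions_of n. \<Sum>\<kappa>\<in>partitions_of n.
        scale_symf (B_eval f \<mu>) (gen.tri.proj n \<mu> (scale_symf (?c \<kappa>) (power_sum_part \<kappa>))))"
      by (rule sum.swap)
    also have "\<dots> = (\<Sum>\<mu>\<in>partitions_of n. scale_symf (B_eval f \<mu>)
        (gen.tri.proj n \<mu> (\<Sum>\<kappa>\<in>partitions_of n. scale_symf (?c \<kappa>) (power_sum_part \<kappa>))))"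
      by (simp only: gen.tri.proj_def gen.tri.spectral_proj_sum scale_symf_sum_right)
    also have "(\<Sum>\<kappa>\<in>partitions_of n. scale_symf (?c \<kappa>) (power_sum_part \<kappa>)) = G"
      by (rule power_sum_expansion_superset[symmetric, OF finite_partitions_of sub])
    finally show ?thesis .
  qed
  have "is_Delta D1"
    unfolding is_Delta_def
  proof (intro conjI allI impI)
    show "Vector_Spaces.linear scale_symf scale_symf D1" unfolding D1_def by (rule linear_linear_ext)
    fix \<mu> assume p: "is_partition \<mu>"
    define n where "n = sum_list \<mu>"
    have mu: "\<mu> \<in> partitions_of n" using p by (simp add: partitions_of_def n_def)
    have "gen.tri.eigvec \<mu> \<in> symf.span (h_dil q_var ` dom_up \<mu>)"
      using gen.tri.eigvec_in_span[OF mu] unfolding dom_up_insert[OF mu] .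
    then have "homogeneous_symf n (mod_macdonald \<mu>)"
      unfolding mod_macdonald_eigvec[OF mu] by (intro homogeneous_scale homogeneous_dom_span[OF mu])
    then have "D1 (mod_macdonald \<mu>) = (\<Sum>\<kappa>\<in>partitions_of n. scale_symf (B_eval f \<kappa>) (gen.tri.proj n \<kappa> (mod_macdonald \<mu>)))"
      by (rule D1)
    also have "\<dots> = (\<Sum>\<kappa>\<in>partitions_of n. if \<kappa> = \<mu> then scale_symf (B_eval f \<mu>) (mod_macdonald \<mu>) else 0)"
      by (intro sum.cong refl)
         (auto simp: mod_macdonald_eigvec[OF mu] gen.tri.proj_scale gen.tri.proj_eigvec[OF _ mu])
    also have "\<dots> = plethysm f (const_symf (B_part \<mu>)) * mod_macdonald \<mu>"
      using mu by (simp add: plethysm_B_part scale_symf_def)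
    finally show "D1 (mod_macdonald \<mu>) = plethysm f (const_symf (B_part \<mu>)) * mod_macdonald \<mu>" .
  qed
  moreover have "D = D1" if D: "is_Delta D" for D
  proof
    fix G
    interpret D: Vector_Spaces.linear scale_symf scale_symf D using D by (simp add: is_Delta_def)
    interpret D1: Vector_Spaces.linear scale_symf scale_symf D1 unfolding D1_def by (rule linear_linear_ext)
    have eq: "D (power_sum_part \<mu>) = D1 (power_sum_part \<mu>)" if "is_partition \<mu>" for \<mu>
    proof -
      have "homogeneous_symf (sum_list \<mu>) (power_sum_part \<mu> :: qt symf)"
        using that by (intro homogeneous_power_sum_part) (auto simp: is_partition_def)
      then show ?thesis using formula[OF D] D1 by metis
    qed
    have "D (\<Sum>\<mu> | power_sum_coeffs G \<mu> \<noteq> 0. scale_symf (power_sum_coeffs G \<mu>) (power_sum_part \<mu>)) =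
        D1 (\<Sum>\<mu> | power_sum_coeffs G \<mu> \<noteq> 0. scale_symf (power_sum_coeffs G \<mu>) (power_sum_part \<mu>))"
      unfolding D.sum D1.sum D.scale D1.scale
      by (intro sum.cong refl) (use eq power_sum_coeffs_partition in auto)
    then show "D G = D1 G" by (simp only: power_sum_expansion)
  qed
  ultimately have "Delta f = D1"
    unfolding Delta_def is_Delta_def[symmetric] by (rule the_equality)
  then show ?thesis using D1[OF F] by simp
qed

subsection \<open>The involution omega\<close>

text \<open>The series of the h_n is invertible, with inverse \<Sum> (-1)^n e_n z^n, so the power
  sums can be read back from Newton's equation.\<close>

lemma newton_determines:
  fixes u v :: "nat \<Rightarrow> 'a :: field_char_0 symf"
  assumes "newton u (Abs_fps complete_sym)" "newton v (Abs_fps complete_sym)" "k > 0"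
  shows "u k = v k"
proof -
  define E H where "E = Abs_fps (\<lambda>n. (- 1) ^ n * elem_sym n :: 'a symf)" and "H = (Abs_fps complete_sym :: 'a symf fps)"
  have "newton (\<lambda>_. 0) (E * H)"
    using newton_mult[OF newton_alt_elem_sym newton_complete_sym] by (simp add: E_def H_def)
  then have EH: "E * H = 1" using newton_one by (rule newton_unique)
  have "Abs_fps (\<lambda>k. if k = 0 then 0 else u k) * H = Abs_fps (\<lambda>k. if k = 0 then 0 else v k) * H"
    using assms(1,2) unfolding newton_def H_def by metis
  then have "Abs_fps (\<lambda>k. if k = 0 then 0 else u k) * (E * H) = Abs_fps (\<lambda>k. if k = 0 then 0 else v k) * (E * H)"
    by (simp only: mult.left_commute[of _ E])
  then have "Abs_fps (\<lambda>k. if k = 0 then 0 else u k) $ k = Abs_fps (\<lambda>k. if k = 0 then 0 else v k) $ k"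
    by (simp only: EH mult.right_neutral)
  then show ?thesis using assms(3) by simp
qed

text \<open>The images of the e_k fix the images of the p_k through Newton's equation, and thereby
  the whole homomorphism; this is the uniqueness that the description of \<open>omega\<close>
  needs.\<close>

lemma omega_power_sum:
  assumes "n > 0"
  shows "omega (power_sum n) = - ((- 1) ^ n * power_sum n :: 'a :: field_char_0 symf)"
proof -
  define W :: "'a symf \<Rightarrow> 'a symf" where "W = psub const_symf (\<lambda>k. - ((- 1) ^ k * power_sum k))"
  note \<iota> = comm_ring_hom_const_symf[where 'a = 'a]
  interpret W: comm_ring_hom W unfolding W_def by (rule psub_hom[OF \<iota>])
  have Wp: "W (power_sum k) = - ((- 1) ^ k * power_sum k)" if "k > 0" for k
    unfolding W_def by (rule psub_power_sum[OF \<iota> that])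
  have Wc: "W (const_symf c) = const_symf c" for c unfolding W_def by (rule psub_const[OF \<iota>])
  have We: "W (elem_sym k) = complete_sym k" for k
  proof -
    have "W (elem_sym k) = Abs_fps complete_sym $ k"
      by (rule hom_elem_sym[OF W.comm_ring_hom_axioms newton_complete_sym])
         (simp add: Wp flip: mult.assoc power_mult_distrib)
    then show ?thesis by simp
  qed
  have "omega = W"
    unfolding omega_def
  proof (rule the_equality)
    show "(\<forall>f g. W (f + g) = W f + W g) \<and> (\<forall>f g. W (f * g) = W f * W g) \<and>
        (\<forall>c f. W (scale_symf c f) = scale_symf c (W f)) \<and> (\<forall>k. W (elem_sym k) = complete_sym k)"
      by (auto simp: W.hom_add W.hom_mult scale_symf_def Wc We)
  next
    fix w :: "'a symf \<Rightarrow> 'a symf"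
    assume w: "(\<forall>f g. w (f + g) = w f + w g) \<and> (\<forall>f g. w (f * g) = w f * w g) \<and>
        (\<forall>c f. w (scale_symf c f) = scale_symf c (w f)) \<and> (\<forall>k. w (elem_sym k) = complete_sym k)"
    \<comment> \<open>Unitality is not among the clauses of the description; it comes from e_0 = 1
      and h_0 = 1.\<close>
    have w1: "w 1 = 1" using w elem_sym_0 complete_sym_0 by metis
    have whom: "comm_ring_hom w" using w w1 by (intro comm_ring_homI) auto
    interpret w: comm_ring_hom w by (rule whom)
    have wc: "w (const_symf c) = const_symf c" for c
    proof -
      have "w (scale_symf c 1) = scale_symf c (w 1)" using w by blast
      then show ?thesis by (simp add: w1 scale_symf_def)
    qed
    have "newton (\<lambda>k. w (- ((- 1) ^ k * power_sum k))) (Abs_fps complete_sym)"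
      using newton_hom[OF whom newton_elem_sym] w by simp
    moreover have "newton (\<lambda>k. W (- ((- 1) ^ k * power_sum k))) (Abs_fps complete_sym)"
      using newton_hom[OF W.comm_ring_hom_axioms newton_elem_sym] We by simp
    ultimately have wW: "w (- ((- 1) ^ k * power_sum k)) = W (- ((- 1) ^ k * power_sum k))" if "k > 0" for k
      using newton_determines that by blast
    show "w = W"
    proof
      fix f show "w f = W f"
      proof (rule symf_hom_eqI[OF whom W.comm_ring_hom_axioms])
        show "w (const_symf c) = W (const_symf c)" for c by (simp add: wc Wc)
        show "w (power_sum k) = W (power_sum k)" if "k > 0" for k
        proof -
          have "(- 1) ^ k * w (power_sum k) = (- 1) ^ k * W (power_sum k)"
            using wW[OF that] by (simp add: w.hom_uminus w.hom_mult w.hom_power W.hom_uminus W.hom_mult W.hom_power)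
          then have "(- 1) ^ k * ((- 1) ^ k * w (power_sum k)) = (- 1) ^ k * ((- 1) ^ k * W (power_sum k))" by simp
          then show ?thesis by simp
        qed
      qed
    qed
  qed
  then show ?thesis using Wp[OF assms] by simp
qed

subsection \<open>Assembling the formula\<close>

text \<open>A cell at t = 1/q has weight q to its content, and the contents of the hook run through
  -r, ..., n - r - 1 once each; multiplication by q^r shifts them to 0, ..., n - 1.\<close>

lemma cell_sum_hook:
  fixes q :: "'a :: field"
  assumes "r < n" "q \<noteq> 0"
  shows "cell_sum q (inverse q) (hook n r) = inverse q ^ r * (\<Sum>i<n. q ^ i)"
proof -
  have col: "cell_sum q (inverse q) (replicate r 1) = (\<Sum>i<r. inverse q ^ i)" for r
    by (simp add: cell_sum_def)
  have "q ^ r * cell_sum q (inverse q) (hook n r) = q ^ r * (\<Sum>j<n - r. q ^ j) + (\<Sum>i<r. q ^ r * inverse q ^ Suc i)"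
    unfolding hook_def cell_sum_Cons col by (simp add: distrib_left sum_distrib_left)
  also have "(\<Sum>i<r. q ^ r * inverse q ^ Suc i) = (\<Sum>i<r. q ^ i)"
  proof (rule sum.reindex_bij_witness[of _ "\<lambda>i. r - Suc i" "\<lambda>i. r - Suc i"])
    fix i assume "i \<in> {..<r}"
    then have "r = (r - Suc i) + Suc i" by simp
    then have "q ^ r = q ^ (r - Suc i) * q ^ Suc i" by (metis power_add)
    moreover have "q ^ Suc i * inverse q ^ Suc i = 1"
      using assms(2) by (metis power_mult_distrib power_one right_inverse)
    ultimately show "q ^ (r - Suc i) = q ^ r * inverse q ^ Suc i" by (simp only: mult.assoc mult.right_neutral)
  qed auto
  also have "q ^ r * (\<Sum>j<n - r. q ^ j) + (\<Sum>i<r. q ^ i) = (\<Sum>i<n. q ^ i)"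
  proof -
    have "{..<n} = {..<r} \<union> {r..<n}" "{..<r} \<inter> {r..<n} = {}" using assms(1) by auto
    then have "(\<Sum>i<n. q ^ i) = (\<Sum>i<r. q ^ i) + (\<Sum>i\<in>{r..<n}. q ^ i)"
      by (simp add: sum.union_disjoint)
    also have "(\<Sum>i\<in>{r..<n}. q ^ i) = (\<Sum>j<n - r. q ^ r * q ^ j)"
      by (rule sum.reindex_bij_witness[of _ "\<lambda>j. r + j" "\<lambda>i. i - r"]) (auto simp flip: power_add)
    finally show ?thesis by (simp add: sum_distrib_left add.commute)
  qed
  finally have "inverse q ^ r * (q ^ r * cell_sum q (inverse q) (hook n r)) = inverse q ^ r * (\<Sum>i<n. q ^ i)" by simp
  moreover have "inverse q ^ r * q ^ r = 1" using assms(2) by (metis left_inverse power_mult_distrib power_one)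
  ultimately show ?thesis by (simp flip: mult.assoc)
qed

text \<open>Every partition in the expansion of f has size k, so the powers of x always multiply to
  x^k.\<close>

lemma psub_homogeneous_scale:
  fixes f :: "'a :: field_char_0 symf"
  assumes "homogeneous_symf k f"
  shows "psub (\<lambda>x. x) (\<lambda>i. x ^ i * v i) f = x ^ k * psub (\<lambda>x. x) v f"
proof -
  have p: "prod_list (map (\<lambda>i. x ^ i * v i) \<mu>) = x ^ sum_list \<mu> * prod_list (map v \<mu>)" for \<mu>
    by (induction \<mu>) (simp_all add: power_add mult_ac)
  show ?thesis
    unfolding psub_def sum_distrib_left p
    by (intro sum.cong refl) (use power_sum_coeffs_homogeneous[OF assms] in \<open>auto simp: partitions_of_def mult_ac\<close>)
qed

text \<open>The hook Schur function in the alphabet X/(1 - q), an eigenvector at t = 1/q.\<close>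

definition hook_vec :: "nat \<Rightarrow> nat \<Rightarrow> qt symf" where
  "hook_vec n r = dilate (\<lambda>k. inverse (1 - q_var ^ k)) (bern (n - r) (elem_sym r))"

lemma hook_vec_eigen:
  "D0 q_var (1 / q_var) (hook_vec n r) = scale_symf (eigenval q_var (1 / q_var) (hook n r)) (hook_vec n r)"
proof -
  note inv = dilate_inverse_q
  have "dilate (\<lambda>k. 1 - q_var ^ k) (D0 q_var (1 / q_var) (hook_vec n r)) =
      scale_symf (eigenval q_var (1 / q_var) (hook n r)) (bern (n - r) (elem_sym r))"
    unfolding dilate_D0 hook_vec_def inv by (rule hook_eigen) simp
  from arg_cong[OF this, of "dilate (\<lambda>k. inverse (1 - q_var ^ k))"] show ?thesis
    by (simp add: dilate_inverse_q dilate_scale hook_vec_def)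
qed

lemma power_sum_hook_vec:
  assumes "n > 0"
  shows "power_sum n = scale_symf (1 - q_var ^ n) (\<Sum>r<n. (- 1) ^ r * hook_vec n r)"
proof -
  have "(\<Sum>r<n. (- 1) ^ r * hook_vec n r) = dilate (\<lambda>k. inverse (1 - q_var ^ k)) (power_sum n)"
    unfolding power_sum_hooks[OF assms] hook_vec_def
    by (simp add: dilate.hom_sum dilate.hom_mult dilate.hom_power dilate.hom_uminus dilate.hom_one)
  also have "\<dots> = scale_symf (inverse (1 - q_var ^ n)) (power_sum n)"
    using assms by (simp add: dilate_power_sum scale_symf_def)
  finally show ?thesis using q_var_generic[OF assms] by simp
qed

lemma spec_proj_hook_vec:
  assumes "r < n" "\<mu> \<in> partitions_of n"
  shows "spec.tri.proj n \<mu> (hook_vec n r) = (if \<mu> = hook n r then hook_vec n r else 0)"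
  using spec.tri.proj_eigen[OF assms(2) hook_partition[OF assms(1)] hook_vec_eigen] by auto

lemma qint_power_sum: "(1 - q) * (\<Sum>i<n. q ^ i) = 1 - (q :: 'a :: comm_ring_1) ^ n"
  by (induction n) (simp_all add: distrib_left, simp add: algebra_simps)

text \<open>\<open>h\<^sub>n[X (1 - q\<^sup>-\<^sup>k) / (1 - q)] = (-1)\<^sup>n q\<^sup>-\<^sup>k\<^sup>n e\<^sub>n[X [k]\<^sub>q]\<close>.\<close>

lemma dilate_complete_elem:
  fixes x :: qt
  assumes k: "k > 0" and x: "x = inverse q_var ^ k"
  shows "dilate (\<lambda>i. inverse (1 - q_var ^ i)) (dilate (\<lambda>i. 1 - x ^ i) (complete_sym n)) =
    scale_symf ((- 1) ^ n * x ^ n) (dilate (\<lambda>i. \<Sum>j<k. (q_var ^ i) ^ j) (elem_sym n))"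
proof -
  let ?q = "\<lambda>i. \<Sum>j<k. (q_var ^ i) ^ j"
  let ?A = "Abs_fps (\<lambda>n. const_symf x ^ n * dilate ?q ((- 1) ^ n * elem_sym n))"
  have "newton (\<lambda>i. const_symf x ^ i * dilate ?q (- power_sum i)) ?A"
    using newton_scale[OF newton_hom[OF comm_ring_hom_dilate newton_alt_elem_sym]] by simp
  then have N: "newton (\<lambda>i. const_symf (- (x ^ i * ?q i)) * power_sum i) ?A"
    by (rule newton_cong) (simp add: dilate.hom_uminus dilate_power_sum const_symf_minus const_symf_mult const_symf_power mult.assoc)
  \<comment> \<open>1 - x^i = -x^i (1 - q^(ik)). The alphabet is therefore -x times [k]_q, which is
    the origin of the sign (-1)^n and of the factor x^n.\<close>
  have val: "(1 - x ^ i) * inverse (1 - q_var ^ i) = - (x ^ i * ?q i)" if "i > 0" for i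
  proof -
    have nz: "1 - q_var ^ i \<noteq> 0" using q_var_generic[OF that] by auto
    have "x ^ i * (q_var ^ i) ^ k = 1"
      by (simp add: x power_mult_distrib[symmetric] flip: power_mult) (simp add: mult.commute[of i k] flip: power_mult_distrib)
    then have "- (x ^ i * ((1 - q_var ^ i) * ?q i)) = 1 - x ^ i"
      unfolding qint_power_sum by (simp add: right_diff_distrib)
    then show ?thesis using nz by (simp add: field_simps)
  qed
  have "dilate (\<lambda>i. inverse (1 - q_var ^ i)) (dilate (\<lambda>i. 1 - x ^ i) (complete_sym n)) = ?A $ n"
  proof (rule hom_complete_sym[OF comm_ring_hom_comp[OF comm_ring_hom_dilate comm_ring_hom_dilate] N])
    fix i :: nat assume i: "i > 0"
    show "dilate (\<lambda>i. inverse (1 - q_var ^ i)) (dilate (\<lambda>i. 1 - x ^ i) (power_sum i)) = const_symf (- (x ^ i * ?q i)) * power_sum i"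
      using i by (simp add: dilate_power_sum dilate.hom_mult val[OF i, symmetric] const_symf_mult mult.assoc)
  qed
  then show ?thesis
    by (simp add: dilate.hom_mult dilate.hom_power dilate.hom_uminus dilate.hom_one scale_symf_def
        const_symf_mult const_symf_power const_symf_minus mult_ac)
qed

theorem theorem7p5:
  fixes n k :: nat and f :: "qt symf"
  assumes "n \<ge> 1" and "k \<ge> 1"
    and "homogeneous_symf k f" and "t_regular f"
  shows "t_regular (Delta f (omega (power_sum n))) \<and>
    t_specialize (Delta f (omega (power_sum n))) =
      scale_symf (q_int n / (q_int k * q_var ^ (k * (n - 1))))
        (plethysm (t_specialize f) (const_symf (q_int n)) *
         plethysm (elem_sym n) (X_alphabet * const_symf (q_int k)))"
proof (rule symf_specD)
  have n: "n > 0" and k: "k > 0" using assms by auto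
  define F where "F = omega (power_sum n :: qt symf)"
  have F: "F = scale_symf (- ((- 1) ^ n)) (power_sum n)"
    by (simp add: F_def omega_power_sum[OF n] scale_symf_def const_symf_minus const_symf_power)
  have "homogeneous_symf n (power_sum n :: qt symf)"
    using homogeneous_power_sum_part[of "[n]" n] n by simp
  then have homF: "homogeneous_symf n F" unfolding F by (rule homogeneous_scale)
  have "sp (- ((- 1) ^ n)) (- ((- 1) ^ n))"
    by (intro qt_spec_uminus qt_spec_power qt_spec_1)
  then have FF: "symf_spec F F" unfolding F by (intro symf_spec_scale symf_spec_power_sum)
  define g where "g = t_specialize f"
  have fg: "symf_spec f g" unfolding g_def by (rule symf_spec_t_specialize[OF assms(4)])
  \<comment> \<open>The coefficients of f may involve t, so the eigenvalues at t = 1/q are computed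
    from g. Homogeneity, which yields the factor q^(-rk), has to be passed on to g.\<close>
  have homg: "homogeneous_symf k g"
    unfolding homogeneous_symf_def
  proof (intro allI impI)
    fix m assume "coeff_symf g m \<noteq> 0"
    then have "coeff_symf f m \<noteq> 0" by (auto simp: g_def t_specialize.rep_eq)
    then show "size m = k" using assms(3) by (simp add: homogeneous_symf_def)
  qed
  define b where "b = (\<lambda>\<mu>. psub (\<lambda>x. x) (\<lambda>i. cell_sum (q_var ^ i) ((1 / q_var) ^ i) \<mu>) g)"
  have Bb: "sp (B_eval f \<mu>) (b \<mu>)" for \<mu>
    unfolding B_eval_def b_def
    by (rule psub_ident_spec[OF fg]) (intro qt_spec_cell_sum qt_spec_power qt_spec_q qt_spec_t)
  \<comment> \<open>This is q^(-k), the ratio of the eigenvalues at consecutive hooks; with it the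
    sum over hooks takes the form of \<open>sum_hooks_complete\<close>.\<close>
  define x where "x = inverse q_var ^ k"
  define gn where "gn = psub (\<lambda>x. x) (\<lambda>i. \<Sum>j<n. (q_var ^ i) ^ j) g"
  have b_hook: "b (hook n r) = x ^ r * gn" if r: "r < n" for r
  proof -
    have "b (hook n r) = psub (\<lambda>x. x) (\<lambda>i. (inverse q_var ^ r) ^ i * (\<Sum>j<n. (q_var ^ i) ^ j)) g"
      unfolding b_def
    proof (rule psub_cong)
      fix i
      have "(1 / q_var) ^ i = inverse (q_var ^ i)" by (simp add: divide_inverse power_inverse)
      moreover have "inverse (q_var ^ i) ^ r = (inverse q_var ^ r) ^ i"
        by (simp add: power_inverse mult.commute flip: power_mult)
      ultimately show "cell_sum (q_var ^ i) ((1 / q_var) ^ i) (hook n r) = (inverse q_var ^ r) ^ i * (\<Sum>j<n. (q_var ^ i) ^ j)"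
        using cell_sum_hook[OF r, of "q_var ^ i"] by simp
    qed
    also have "\<dots> = (inverse q_var ^ r) ^ k * gn" unfolding gn_def by (rule psub_homogeneous_scale[OF homg])
    also have "(inverse q_var ^ r) ^ k = x ^ r" by (simp add: x_def mult.commute flip: power_mult)
    finally show ?thesis .
  qed
  let ?P = "partitions_of n"
  \<comment> \<open>The sign (-1)^(n-1) of \<open>omega\<close> on p_n, times the factor 1 - q^n
    from \<open>power_sum_hook_vec\<close>.\<close>
  let ?c = "- ((- 1) ^ n) * (1 - q_var ^ n)"
  have "symf_spec (Delta f F) (\<Sum>\<mu>\<in>?P. scale_symf (b \<mu>) (spec.tri.proj n \<mu> F))"
    unfolding Delta_homogeneous[OF homF]
    by (intro symf_spec_sum symf_spec_scale Bb proj_spec FF)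
  also have "(\<Sum>\<mu>\<in>?P. scale_symf (b \<mu>) (spec.tri.proj n \<mu> F)) =
      scale_symf ?c (\<Sum>r<n. scale_symf ((- 1) ^ r * b (hook n r)) (hook_vec n r))"
  proof -
    have "F = scale_symf ?c (\<Sum>r<n. scale_symf ((- 1) ^ r) (hook_vec n r))"
      unfolding F by (subst power_sum_hook_vec[OF n]) (simp add: scale_symf_def[of "(- 1) ^ _"] const_symf_power const_symf_minus)
    then have "spec.tri.proj n \<mu> F = scale_symf ?c (\<Sum>r<n. scale_symf ((- 1) ^ r) (spec.tri.proj n \<mu> (hook_vec n r)))" for \<mu>
      by (simp only: spec.tri.proj_def spec.tri.spectral_proj_scale spec.tri.spectral_proj_sum)
    then have "(\<Sum>\<mu>\<in>?P. scale_symf (b \<mu>) (spec.tri.proj n \<mu> F)) =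
        scale_symf ?c (\<Sum>\<mu>\<in>?P. \<Sum>r<n. scale_symf ((- 1) ^ r * b \<mu>) (spec.tri.proj n \<mu> (hook_vec n r)))"
      by (simp add: scale_symf_sum_right mult_ac)
    also have "(\<Sum>\<mu>\<in>?P. \<Sum>r<n. scale_symf ((- 1) ^ r * b \<mu>) (spec.tri.proj n \<mu> (hook_vec n r))) =
        (\<Sum>r<n. \<Sum>\<mu>\<in>?P. scale_symf ((- 1) ^ r * b \<mu>) (spec.tri.proj n \<mu> (hook_vec n r)))"
      by (rule sum.swap)
    also have "\<dots> = (\<Sum>r<n. scale_symf ((- 1) ^ r * b (hook n r)) (hook_vec n r))"
    proof (intro sum.cong refl)
      fix r assume "r \<in> {..<n}"
      then have r: "r < n" by simp
      have "(\<Sum>\<mu>\<in>?P. scale_symf ((- 1) ^ r * b \<mu>) (spec.tri.proj n \<mu> (hook_vec n r))) =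
          (\<Sum>\<mu>\<in>?P. if \<mu> = hook n r then scale_symf ((- 1) ^ r * b (hook n r)) (hook_vec n r) else 0)"
        by (intro sum.cong refl) (simp add: spec_proj_hook_vec[OF r])
      then show "(\<Sum>\<mu>\<in>?P. scale_symf ((- 1) ^ r * b \<mu>) (spec.tri.proj n \<mu> (hook_vec n r))) =
          scale_symf ((- 1) ^ r * b (hook n r)) (hook_vec n r)"
        using hook_partition[OF r] by simp
    qed
    finally show ?thesis .
  qed
  also have "(\<Sum>r<n. scale_symf ((- 1) ^ r * b (hook n r)) (hook_vec n r)) =
      scale_symf gn (\<Sum>r<n. (- const_symf x) ^ r * hook_vec n r)"
    unfolding scale_symf_sum_right
  proof (intro sum.cong refl)
    fix r assume "r \<in> {..<n}"
    then have "(- 1) ^ r * b (hook n r) = gn * (- x) ^ r" by (simp add: b_hook power_minus[of x])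
    then show "scale_symf ((- 1) ^ r * b (hook n r)) (hook_vec n r) = scale_symf gn ((- const_symf x) ^ r * hook_vec n r)"
      by (simp add: scale_symf_def const_symf_mult const_symf_power const_symf_minus mult.assoc)
  qed
  also have "(\<Sum>r<n. (- const_symf x) ^ r * hook_vec n r) =
      scale_symf (inverse (1 - x) * ((- 1) ^ n * x ^ n)) (dilate (\<lambda>i. \<Sum>j<k. (q_var ^ i) ^ j) (elem_sym n))"
  proof -
    let ?d = "dilate (\<lambda>i. inverse (1 - q_var ^ i))"
    have "x \<noteq> 1" using q_var_generic[OF k] by (simp add: x_def power_inverse)
    then have x1: "1 - x \<noteq> 0" by simp
    have "scale_symf (1 - x) (\<Sum>r<n. (- const_symf x) ^ r * hook_vec n r) =
        ?d ((1 - const_symf x) * (\<Sum>r<n. (- const_symf x) ^ r * bern (n - r) (elem_sym r)))"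
      by (simp add: scale_symf_def const_symf_diff hook_vec_def dilate.hom_mult dilate.hom_sum dilate.hom_power
          dilate.hom_uminus dilate.hom_minus dilate.hom_one)
    also have "\<dots> = scale_symf ((- 1) ^ n * x ^ n) (dilate (\<lambda>i. \<Sum>j<k. (q_var ^ i) ^ j) (elem_sym n))"
      unfolding sum_hooks_complete[OF n] by (rule dilate_complete_elem[OF k x_def])
    finally have "scale_symf (inverse (1 - x)) (scale_symf (1 - x) (\<Sum>r<n. (- const_symf x) ^ r * hook_vec n r)) =
        scale_symf (inverse (1 - x) * ((- 1) ^ n * x ^ n)) (dilate (\<lambda>i. \<Sum>j<k. (q_var ^ i) ^ j) (elem_sym n))"
      by simp
    then show ?thesis using x1 by simp
  qed
  also have "dilate (\<lambda>i. \<Sum>j<k. (q_var ^ i) ^ j) (elem_sym n) = plethysm (elem_sym n) (X_alphabet * const_symf (q_int k))"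
    unfolding q_int_def by (rule plethysm_X_times_const[symmetric]) (intro qt_spec_sum qt_spec_power qt_spec_q)
  also have "scale_symf ?c (scale_symf gn (scale_symf (inverse (1 - x) * ((- 1) ^ n * x ^ n))
        (plethysm (elem_sym n) (X_alphabet * const_symf (q_int k))))) =
      scale_symf (?c * (inverse (1 - x) * ((- 1) ^ n * x ^ n)))
        (const_symf gn * plethysm (elem_sym n) (X_alphabet * const_symf (q_int k)))"
    by (simp only: scale_symf_def const_symf_mult mult_ac)
  also have "const_symf gn = plethysm (t_specialize f) (const_symf (q_int n))"
    unfolding gn_def g_def[symmetric] q_int_def
    by (rule plethysm_const[symmetric]) (intro qt_spec_sum qt_spec_power qt_spec_q)
  \<comment> \<open>The two signs (-1)^n cancel. The identity 1 - x = -x (1 - q^k) absorbs the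
    remaining minus sign and one power of x, which leaves x^(n-1) = q^(-k(n-1)).\<close>
  also have "?c * (inverse (1 - x) * ((- 1) ^ n * x ^ n)) = q_int n / (q_int k * q_var ^ (k * (n - 1)))"
  proof -
    have q1: "1 - q_var \<noteq> 0" using q_var_generic[of 1] by auto
    have qn: "1 - q_var ^ n = (1 - q_var) * q_int n" and qk: "1 - q_var ^ k = (1 - q_var) * q_int k"
      by (simp_all add: q_int_def qint_power_sum)
    have xq: "x * q_var ^ k = 1" by (simp add: x_def flip: power_mult_distrib)
    have x0: "x \<noteq> 0" by (simp add: x_def)
    have k1: "1 - q_var ^ k \<noteq> 0" using q_var_generic[OF k] by auto
    have "1 - x = - (x * (1 - q_var ^ k))" using xq by (simp add: right_diff_distrib)
    then have inv: "inverse (1 - x) = - (inverse x * inverse (1 - q_var ^ k))" by simp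
    have sgn: "(- 1) ^ n * (- 1) ^ n = (1 :: qt)" by (simp flip: power_mult_distrib)
    have xn: "inverse x * x ^ n = x ^ (n - 1)" using n x0 by (cases n) auto
    have "?c * (inverse (1 - x) * ((- 1) ^ n * x ^ n)) =
        ((- 1) ^ n * (- 1) ^ n) * ((1 - q_var ^ n) * inverse (1 - q_var ^ k)) * (inverse x * x ^ n)"
      unfolding inv by (simp only: mult_minus_left mult_minus_right minus_minus mult_ac)
    also have "\<dots> = (1 - q_var ^ n) * inverse (1 - q_var ^ k) * x ^ (n - 1)"
      unfolding sgn xn by simp
    also have "(1 - q_var ^ n) * inverse (1 - q_var ^ k) = q_int n / q_int k"
      unfolding qn qk using q1 by (simp add: divide_inverse)
    also have "x ^ (n - 1) = inverse (q_var ^ (k * (n - 1)))"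
      by (simp add: x_def power_inverse flip: power_mult)
    finally show ?thesis by (simp add: divide_inverse mult.assoc)
  qed
  finally show "symf_spec (Delta f (omega (power_sum n)))
      (scale_symf (q_int n / (q_int k * q_var ^ (k * (n - 1))))
        (plethysm (t_specialize f) (const_symf (q_int n)) *
         plethysm (elem_sym n) (X_alphabet * const_symf (q_int k))))"
    unfolding F_def .
qed


end
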